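(* Let $(X,\|\cdot\|,\tau)$ be a Saks space with mixed topology $\gamma$ and submixed topology $\gamma_{\mathrm s}$, let $I$ be a Hausdorff topological space, $\mathcal F$ a set of functions from $I$ to $[0,\infty)$ and $(S(t))_{t\in I}$ a family of linear maps from $X$ to $X$. Consider the following assertions. (a) $(S(t))_{t\in I}$ is locally $\tau$-bi-continuous and $\mathcal F$-bounded. (b) $(S(t))_{t\in I}$ is $\gamma$-strongly continuous and $\mathcal F$-$\gamma$-equicontinuous. (c) $(S(t))_{t\in I}$ is $\gamma$-strongly continuous and $\mathcal F$-$(\|\cdot\|,\tau)$-equitight. (d) $(S(t))_{t\in I}$ is $\gamma$-strongly continuous, in $\mathcal L(X,\gamma)$ and $\mathcal F$-bounded. Then the following holds. (i) If $(X,\gamma)$ is C-sequential, $I$ is a $k_{\mathrm{lcs}}$-space, and $\mathcal F$ consists of locally bounded functions and has rV$_\infty$, then (a)$\Rightarrow$(b). If all elements of $\mathcal F$ are locally bounded away from zero, then (b)$\Rightarrow$(a). (ii) If $\gamma=\gamma_{\mathrm s}$, then (b)$\Rightarrow$(c). If $(S(t))_{t\in I}$ is a family in $\mathcal L(X)$ and $\mathcal F$-bounded, then (c)$\Rightarrow$(b). (iii) If $(X,\gamma)$ is a strong Mackey space, $I$ is locally compact, and $\mathcal F$ consists of strictly positive continuous functions and has rV$_\infty$, then (b)$\Leftrightarrow$(d). (iv) If $(X,\gamma)$ is a strong Mackey space and a Mazur space, $I$ is locally compact, and $\mathcal F$ consists of strictly positive continuous functions and has rV$_\infty$, then (a)$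\Leftrightarrow$(b)$\Leftrightarrow$(d).
   Context: Linear spaces are over $\mathbb R$ or $\mathbb C$. For a Hausdorff locally convex space $(X,\tau)$, $\mathcal P_\tau$ denotes a directed system of seminorms generating $\tau$, $\mathcal L(X,\tau)$ the continuous linear maps $X\to X$, and $(X,\tau)'$ the topological dual. For a normed space $(X,\|\cdot\|)$, $\tau_{\|\cdot\|}$ is the norm topology and $\mathcal L(X)$ the bounded linear operators with the operator norm. Saks space: a triple $(X,\|\cdot\|,\tau)$ where $(X,\|\cdot\|)$ is a normed space and $\tau\subseteq\tau_{\|\cdot\|}$ is a Hausdorff locally convex topology on $X$ such that there is a directed system of seminorms $\mathcal P_\tau$ generating $\tau$ with $\|x\|=\sup_{p\in\mathcal P_\tau}p(x)$ for all $x\in X$ (fix such $\mathcal P_\tau$). Mixed topology $\gamma=\gamma(\|\cdot\|,\tau)$: the finest linear topology on $X$ that coincides with $\tau$ on $\|\cdot\|$-bounded sets and satisfies $\tau\subseteq\gamma\subseteq\tau_{\|\cdot\|}$; it is Hausdorff locally convex. Submixed topology $\gamma_{\mathrm s}$: the Hausdorff locally convex topology generated by the seminorms $x\mapsto\sup_{n\in\mathbb N}p_n(x)a_n$, where $(p_n)_{n\in\mathbb N}$ runs through the sequences in $\mathcal P_\tau$ and $(a_n)_{n\in\mathbb N}$ through the non-negative real null sequences. A family $(S(t))_{t\in J}$ of linear maps $X\to X$ is: $\sigma$-strongly continuous (for a topology $\sigma$ on $X$ and $J$ a Hausdorff topological space) if $t\mapsto S(t)x\in(X,\sigma)$ is continuous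 for every $x\in X$; $\gamma$-equicontinuous if for every $p\in\mathcal P_\gamma$ there are $q\in\mathcal P_\gamma$, $K\ge0$ with $\sup_{t\in J}p(S(t)x)\le Kq(x)$ for all $x\in X$; bounded (for a family in $\mathcal L(X)$) if $\sup_{t\in J}\|S(t)\|_{\mathcal L(X)}<\infty$; bi-equicontinuous if for every $\|\cdot\|$-bounded sequence $(x_n)$ in $X$ and $x\in X$ with $x_n\to x$ w.r.t. $\tau$ one has $\tau$-$\lim_{n\to\infty}S(t)(x_n-x)=0$ uniformly for $t\in J$; $(\|\cdot\|,\tau)$-equitight if for all $\varepsilon>0$, $p\in\mathcal P_\tau$ there are $q\in\mathcal P_\tau$, $K\ge0$ such that $p(S(t)x)\le Kq(x)+\varepsilon\|x\|$ for all $t\in J$, $x\in X$. For $I$ a Hausdorff topological space, "locally (property)" means that $(S(t))_{t\in M}$ has the property for every compact $M\subseteq I$. $(S(t))_{t\in I}$ is $\mathcal F$-$\gamma$-equicontinuous (resp. $\mathcal F$-$(\|\cdot\|,\tau)$-equitight) if there is $k\in\mathcal F$ such that $(k(t)S(t))_{t\in I}$ is $\gamma$-equicontinuous (resp. $(\|\cdot\|,\tau)$-equitight); a family $(S(t))_{t\in I}$ in $\mathcal L(X)$ is $\mathcal F$-bounded if there is $k\in\mathcal F$ such that $(k(t)S(t))_{t\in I}$ is bounded. $(S(t))_{t\in I}$ is locally $\tau$-bi-continuous if it is a family in $\mathcal L(X)$ that is $\tau$-strongly continuous, locally bounded and locally bi-equicontinuous. $\mathcal F$ has rV$_\infty$ if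 for every $k_1\in\mathcal F$ there is $k_2\in\mathcal F$ such that for every $\varepsilon>0$ there is a compact $M\subseteq I$ with $k_2(t)\le\varepsilon k_1(t)$ for all $t\in I\setminus M$. A function $k\colon I\to[0,\infty)$ is locally bounded if $\sup_{t\in M}k(t)<\infty$, and locally bounded away from zero if $\inf_{t\in M}k(t)>0$, for every compact $M\subseteq I$. A Hausdorff locally convex space is C-sequential if every convex sequentially open subset is open ($U$ is sequentially open if every sequence converging to a point of $U$ is eventually in $U$). A Hausdorff topological space $I$ is a $k_{\mathrm{lcs}}$-space if every map $f$ from $I$ to any Hausdorff locally convex space whose restriction to each compact subset of $I$ is continuous is continuous. A Hausdorff locally convex space $(X,\sigma)$ with dual $X'$ is a strong Mackey space if every $\sigma(X',X)$-compact subset of $X'$ is equicontinuous; it is a Mazur space if every sequentially continuous linear functional on it is continuous.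
   Formalization: In the second sentence of (ii), the family is assumed equitight and bounded with one common weight k in F; with two unrelated weights for F-equitight and F-bounded the implication (c)⇒(b) is false. *)

theory Defs
  imports "HOL-Analysis.Analysis" "HOL-Library.Function_Algebras"
begin

section \<open>Scalars\<close>

text \<open>
  The field of scalars is the real or the complex field.  In the class below \<open>i = 0\<close> is the real
  case and \<open>i * i = - 1\<close> the complex one; since the norm of a \<^class>\<open>real_normed_field\<close> is
  multiplicative, it is then the usual absolute value.
\<close>

class real_or_complex = real_normed_field +
  assumes ex_imaginary_unit:
    "\<exists>i. (i = 0 \<or> i * i = - 1) \<and> (\<forall>z. \<exists>a b. z = a *\<^sub>R 1 + b *\<^sub>R i)"

instance real :: real_or_complex
  by standard (rule exI[of _ 0], auto)

instance complex :: real_or_complex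
proof
  have "z = Re z *\<^sub>R 1 + Im z *\<^sub>R \<i>" for z
    by (simp add: complex_eq_iff)
  then show "\<exists>i::complex. (i = 0 \<or> i * i = - 1) \<and> (\<forall>z. \<exists>a b. z = a *\<^sub>R 1 + b *\<^sub>R i)"
    by (intro exI[of _ \<i>]) auto
qed


section \<open>Locally convex topologies\<close>

text \<open>
  A vector space is a type of class \<^class>\<open>ab_group_add\<close> with a scalar multiplication \<open>smul\<close>
  as in the locale \<^locale>\<open>vector_space\<close>.  All topologies on it are values of type
  \<^typ>\<open>'a topology\<close>, because several of them are compared on one space.
\<close>

definition coarser_topology :: "'a topology \<Rightarrow> 'a topology \<Rightarrow> bool" where
  "coarser_topology S T \<longleftrightarrow> (\<forall>U. openin S U \<longrightarrow> openin T U)"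

definition linear_topology ::
    "('k::real_or_complex \<Rightarrow> 'a::ab_group_add \<Rightarrow> 'a) \<Rightarrow> 'a topology \<Rightarrow> bool" where
  "linear_topology smul T \<longleftrightarrow>
     topspace T = UNIV \<and>
     continuous_map (prod_topology T T) T (\<lambda>(x, y). x + y) \<and>
     continuous_map (prod_topology euclidean T) T (\<lambda>(c, x). smul c x)"

definition seminorm ::
    "('k::real_or_complex \<Rightarrow> 'a::ab_group_add \<Rightarrow> 'a) \<Rightarrow> ('a \<Rightarrow> real) \<Rightarrow> bool" where
  "seminorm smul p \<longleftrightarrow>
     (\<forall>x. 0 \<le> p x) \<and>
     (\<forall>x y. p (x + y) \<le> p x + p y) \<and>
     (\<forall>c x. p (smul c x) = norm c * p x)"

definition directed_seminorms ::
    "('k::real_or_complex \<Rightarrow> 'a::ab_group_add \<Rightarrow> 'a) \<Rightarrow> ('a \<Rightarrow> real) set \<Rightarrow> bool" where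
  "directed_seminorms smul P \<longleftrightarrow>
     P \<noteq> {} \<and> (\<forall>p\<in>P. seminorm smul p) \<and>
     (\<forall>p\<in>P. \<forall>q\<in>P. \<exists>r\<in>P. \<exists>C\<ge>0. \<forall>x. max (p x) (q x) \<le> C * r x)"

definition seminorm_topology :: "('a::ab_group_add \<Rightarrow> real) set \<Rightarrow> 'a topology" where
  "seminorm_topology P = topology_generated_by {{y. p (y - x) < r} | p x r. p \<in> P \<and> 0 < r}"

definition generating_seminorms ::
    "('k::real_or_complex \<Rightarrow> 'a::ab_group_add \<Rightarrow> 'a) \<Rightarrow> ('a \<Rightarrow> real) set \<Rightarrow> 'a topology \<Rightarrow> bool" where
  "generating_seminorms smul P T \<longleftrightarrow> directed_seminorms smul P \<and> T = seminorm_topology P"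

definition Hausdorff_lcs ::
    "('k::real_or_complex \<Rightarrow> 'a::ab_group_add \<Rightarrow> 'a) \<Rightarrow> 'a topology \<Rightarrow> bool" where
  "Hausdorff_lcs smul T \<longleftrightarrow>
     vector_space smul \<and> Hausdorff_space T \<and> (\<exists>P. generating_seminorms smul P T)"


section \<open>Saks spaces, mixed and submixed topology\<close>

text \<open>
  A normed space over \<open>'k\<close>: the library's real normed space, whose real scalar multiplication and
  norm are extended to the scalars in \<open>'k\<close>.
\<close>

definition normed_space_over ::
    "('k::real_or_complex \<Rightarrow> 'a::real_normed_vector \<Rightarrow> 'a) \<Rightarrow> bool" where
  "normed_space_over smul \<longleftrightarrow>
     vector_space smul \<and>
     (\<forall>r x. smul (of_real r) x = r *\<^sub>R x) \<and>
     (\<forall>c x. norm (smul c x) = norm c * norm x)"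

definition Saks_space ::
    "('k::real_or_complex \<Rightarrow> 'a::real_normed_vector \<Rightarrow> 'a) \<Rightarrow> ('a \<Rightarrow> real) set \<Rightarrow> 'a topology \<Rightarrow> bool"
  where
  "Saks_space smul P \<tau> \<longleftrightarrow>
     normed_space_over smul \<and>
     Hausdorff_lcs smul \<tau> \<and>
     coarser_topology \<tau> euclidean \<and>
     generating_seminorms smul P \<tau> \<and>
     (\<forall>x. bdd_above ((\<lambda>p. p x) ` P) \<and> norm x = (SUP p\<in>P. p x))"

definition mixed_topology_candidate ::
    "('k::real_or_complex \<Rightarrow> 'a::real_normed_vector \<Rightarrow> 'a) \<Rightarrow> 'a topology \<Rightarrow> 'a topology \<Rightarrow> bool"
  where
  "mixed_topology_candidate smul \<tau> T \<longleftrightarrow>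
     linear_topology smul T \<and>
     (\<forall>B. bounded B \<longrightarrow> subtopology T B = subtopology \<tau> B) \<and>
     coarser_topology \<tau> T \<and> coarser_topology T euclidean"

definition is_mixed_topology ::
    "('k::real_or_complex \<Rightarrow> 'a::real_normed_vector \<Rightarrow> 'a) \<Rightarrow> 'a topology \<Rightarrow> 'a topology \<Rightarrow> bool"
  where
  "is_mixed_topology smul \<tau> \<gamma> \<longleftrightarrow>
     mixed_topology_candidate smul \<tau> \<gamma> \<and>
     (\<forall>T. mixed_topology_candidate smul \<tau> T \<longrightarrow> coarser_topology T \<gamma>)"

text \<open>
  On a Saks space the suprema below are finite, because \<open>p n x \<le> norm x\<close> and \<open>a\<close> is bounded.
\<close>

definition submixed_topology :: "('a::real_normed_vector \<Rightarrow> real) set \<Rightarrow> 'a topology" where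
  "submixed_topology P =
     seminorm_topology {\<lambda>x. (SUP n. p n x * a n) | (p :: nat \<Rightarrow> 'a \<Rightarrow> real) (a :: nat \<Rightarrow> real).
                          (\<forall>n. p n \<in> P) \<and> (\<forall>n. 0 \<le> a n) \<and> a \<longlonglongrightarrow> 0}"


section \<open>Continuous linear maps and properties of locally convex spaces\<close>

definition bounded_operators ::
    "('k::real_or_complex \<Rightarrow> 'a::real_normed_vector \<Rightarrow> 'a) \<Rightarrow> ('a \<Rightarrow> 'a) set" where
  "bounded_operators smul = {T. Vector_Spaces.linear smul smul T \<and> bounded_linear T}"

definition continuous_operators ::
    "('k::real_or_complex \<Rightarrow> 'a::ab_group_add \<Rightarrow> 'a) \<Rightarrow> 'a topology \<Rightarrow> ('a \<Rightarrow> 'a) set" where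
  "continuous_operators smul \<sigma> =
     {T. Vector_Spaces.linear smul smul T \<and> continuous_map \<sigma> \<sigma> T}"

definition topological_dual ::
    "('k::real_or_complex \<Rightarrow> 'a::ab_group_add \<Rightarrow> 'a) \<Rightarrow> 'a topology \<Rightarrow> ('a \<Rightarrow> 'k) set" where
  "topological_dual smul \<sigma> =
     {f. Vector_Spaces.linear smul (*) f \<and> continuous_map \<sigma> euclidean f}"

definition weak_star_topology ::
    "('k::real_or_complex \<Rightarrow> 'a::ab_group_add \<Rightarrow> 'a) \<Rightarrow> 'a topology \<Rightarrow> ('a \<Rightarrow> 'k) topology" where
  "weak_star_topology smul \<sigma> =
     subtopology (product_topology (\<lambda>_. euclidean) UNIV) (topological_dual smul \<sigma>)"

definition equicontinuous_functionals ::
    "'a::ab_group_add topology \<Rightarrow> ('a \<Rightarrow> 'k::real_or_complex) set \<Rightarrow> bool" where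
  "equicontinuous_functionals \<sigma> H \<longleftrightarrow>
     (\<forall>\<epsilon>>0. \<exists>U. openin \<sigma> U \<and> 0 \<in> U \<and> (\<forall>f\<in>H. \<forall>x\<in>U. norm (f x) < \<epsilon>))"

definition strong_Mackey_space ::
    "('k::real_or_complex \<Rightarrow> 'a::ab_group_add \<Rightarrow> 'a) \<Rightarrow> 'a topology \<Rightarrow> bool" where
  "strong_Mackey_space smul \<sigma> \<longleftrightarrow>
     (\<forall>H. compactin (weak_star_topology smul \<sigma>) H \<longrightarrow> equicontinuous_functionals \<sigma> H)"

definition Mazur_space ::
    "('k::real_or_complex \<Rightarrow> 'a::ab_group_add \<Rightarrow> 'a) \<Rightarrow> 'a topology \<Rightarrow> bool" where
  "Mazur_space smul \<sigma> \<longleftrightarrow>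
     (\<forall>f :: 'a \<Rightarrow> 'k.
        Vector_Spaces.linear smul (*) f \<and>
        (\<forall>xs x. limitin \<sigma> xs x sequentially \<longrightarrow> (\<lambda>n. f (xs n)) \<longlonglongrightarrow> f x) \<longrightarrow>
        continuous_map \<sigma> euclidean f)"

definition sequentially_openin :: "'a topology \<Rightarrow> 'a set \<Rightarrow> bool" where
  "sequentially_openin \<sigma> U \<longleftrightarrow>
     U \<subseteq> topspace \<sigma> \<and>
     (\<forall>xs x. x \<in> U \<and> limitin \<sigma> xs x sequentially \<longrightarrow> (\<forall>\<^sub>F n in sequentially. xs n \<in> U))"

definition C_sequential :: "'a::real_vector topology \<Rightarrow> bool" where
  "C_sequential \<sigma> \<longleftrightarrow> (\<forall>U. convex U \<and> sequentially_openin \<sigma> U \<longrightarrow> openin \<sigma> U)"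


section \<open>\<open>k\<^sub>l\<^sub>c\<^sub>s\<close>-spaces\<close>

definition continuous_if_on_compacts ::
    "'i topology \<Rightarrow> ('k::real_or_complex \<Rightarrow> 'v::ab_group_add \<Rightarrow> 'v) \<Rightarrow> bool" where
  "continuous_if_on_compacts I smul \<longleftrightarrow>
     (\<forall>\<sigma> f. Hausdorff_lcs smul \<sigma> \<and>
        (\<forall>M. compactin I M \<longrightarrow> continuous_map (subtopology I M) \<sigma> f) \<longrightarrow> continuous_map I \<sigma> f)"

text \<open>
  A \<open>k\<^sub>l\<^sub>c\<^sub>s\<close>-space is defined by maps into all Hausdorff locally convex spaces.  HOL cannot quantify
  over the type of the target inside a definition, so the definition ranges over all Hausdorff
  locally convex topologies on the real vector space \<^typ>\<open>'i \<Rightarrow> real\<close> only.  Nothing is lost: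
  theorem \<open>k_lcs_space_continuous\<close> below derives from it the property for every Hausdorff locally
  convex space, real or complex, on every type.
\<close>

definition k_lcs_space :: "'i topology \<Rightarrow> bool" where
  "k_lcs_space I \<longleftrightarrow>
     Hausdorff_space I \<and>
     continuous_if_on_compacts I (\<lambda>(c::real) (y :: 'i \<Rightarrow> real). (\<lambda>i. c * y i))"

section \<open>Families of linear maps\<close>

definition strongly_continuous :: "'a topology \<Rightarrow> 'i topology \<Rightarrow> ('i \<Rightarrow> 'a \<Rightarrow> 'a) \<Rightarrow> bool" where
  "strongly_continuous \<sigma> J S \<longleftrightarrow> (\<forall>x. continuous_map J \<sigma> (\<lambda>t. S t x))"

definition equicontinuous_family ::
    "('a \<Rightarrow> real) set \<Rightarrow> 'i set \<Rightarrow> ('i \<Rightarrow> 'a \<Rightarrow> 'a) \<Rightarrow> bool" where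
  "equicontinuous_family P J S \<longleftrightarrow>
     (\<forall>p\<in>P. \<exists>q\<in>P. \<exists>K\<ge>0. \<forall>t\<in>J. \<forall>x. p (S t x) \<le> K * q x)"

definition bounded_family ::
    "('k::real_or_complex \<Rightarrow> 'a::real_normed_vector \<Rightarrow> 'a) \<Rightarrow> 'i set \<Rightarrow> ('i \<Rightarrow> 'a \<Rightarrow> 'a) \<Rightarrow> bool" where
  "bounded_family smul J S \<longleftrightarrow>
     (\<forall>t\<in>J. S t \<in> bounded_operators smul) \<and> bdd_above ((\<lambda>t. onorm (S t)) ` J)"

definition bi_equicontinuous_family ::
    "'a::real_normed_vector topology \<Rightarrow> 'i set \<Rightarrow> ('i \<Rightarrow> 'a \<Rightarrow> 'a) \<Rightarrow> bool" where
  "bi_equicontinuous_family \<tau> J S \<longleftrightarrow>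
     (\<forall>xs x. bounded (range xs) \<and> limitin \<tau> xs x sequentially \<longrightarrow>
        (\<forall>U. openin \<tau> U \<and> 0 \<in> U \<longrightarrow> (\<forall>\<^sub>F n in sequentially. \<forall>t\<in>J. S t (xs n - x) \<in> U)))"

definition equitight_family ::
    "('a::real_normed_vector \<Rightarrow> real) set \<Rightarrow> 'i set \<Rightarrow> ('i \<Rightarrow> 'a \<Rightarrow> 'a) \<Rightarrow> bool" where
  "equitight_family P J S \<longleftrightarrow>
     (\<forall>\<epsilon>>0. \<forall>p\<in>P. \<exists>q\<in>P. \<exists>K\<ge>0. \<forall>t\<in>J. \<forall>x. p (S t x) \<le> K * q x + \<epsilon> * norm x)"

definition locally_bi_continuous ::
    "('k::real_or_complex \<Rightarrow> 'a::real_normed_vector \<Rightarrow> 'a) \<Rightarrow> 'a topology \<Rightarrow>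
     'i topology \<Rightarrow> ('i \<Rightarrow> 'a \<Rightarrow> 'a) \<Rightarrow> bool" where
  "locally_bi_continuous smul \<tau> I S \<longleftrightarrow>
     (\<forall>t\<in>topspace I. S t \<in> bounded_operators smul) \<and>
     strongly_continuous \<tau> I S \<and>
     (\<forall>M. compactin I M \<longrightarrow> bounded_family smul M S) \<and>
     (\<forall>M. compactin I M \<longrightarrow> bi_equicontinuous_family \<tau> M S)"

definition weighted :: "('i \<Rightarrow> real) \<Rightarrow> ('i \<Rightarrow> 'a \<Rightarrow> 'a) \<Rightarrow> 'i \<Rightarrow> 'a \<Rightarrow> 'a::real_vector" where
  "weighted k S = (\<lambda>t x. k t *\<^sub>R S t x)"

definition F_equicontinuous ::
    "('a::real_vector \<Rightarrow> real) set \<Rightarrow> 'i topology \<Rightarrow> ('i \<Rightarrow> real) set \<Rightarrow> ('i \<Rightarrow> 'a \<Rightarrow> 'a) \<Rightarrow> bool" where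
  "F_equicontinuous P I F S \<longleftrightarrow> (\<exists>k\<in>F. equicontinuous_family P (topspace I) (weighted k S))"

definition F_equitight ::
    "('a::real_normed_vector \<Rightarrow> real) set \<Rightarrow> 'i topology \<Rightarrow> ('i \<Rightarrow> real) set \<Rightarrow>
     ('i \<Rightarrow> 'a \<Rightarrow> 'a) \<Rightarrow> bool" where
  "F_equitight P I F S \<longleftrightarrow> (\<exists>k\<in>F. equitight_family P (topspace I) (weighted k S))"

definition F_bounded ::
    "('k::real_or_complex \<Rightarrow> 'a::real_normed_vector \<Rightarrow> 'a) \<Rightarrow> 'i topology \<Rightarrow> ('i \<Rightarrow> real) set \<Rightarrow>
     ('i \<Rightarrow> 'a \<Rightarrow> 'a) \<Rightarrow> bool" where
  "F_bounded smul I F S \<longleftrightarrow>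
     (\<forall>t\<in>topspace I. S t \<in> bounded_operators smul) \<and>
     (\<exists>k\<in>F. bounded_family smul (topspace I) (weighted k S))"


text \<open>
  \<open>\<F>\<close>-equitight and \<open>\<F>\<close>-bounded with one common weight \<open>k\<close>.  Without further assumptions on \<open>\<F>\<close>
  this is more than the conjunction of \<open>F_equitight\<close> and \<open>F_bounded\<close>, which does not imply
  \<open>F_equicontinuous\<close>: take the bounded sequences with the supremum norm, \<open>\<tau>\<close> the topology of
  pointwise convergence, \<open>I\<close> the discrete space \<open>{1, 2} \<times> {1, 2, \<dots>}\<close>, \<open>S (1, n) x = n x\<^sub>1 e\<^sub>n\<close>,
  \<open>S (2, n) x = x\<^sub>n e\<^sub>1\<close> and \<open>\<F> = {k, k'}\<close>, where \<open>k\<close> is \<open>1\<close> on the first copy and \<open>1 / n\<^sup>2\<close> on the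
  second, and \<open>k'\<close> is \<open>1 / n\<^sup>2\<close> on the first and \<open>1\<close> on the second.  Then \<open>k\<close> witnesses that \<open>S\<close> is
  \<open>\<F>\<close>-equitight and \<open>k'\<close> that \<open>S\<close> is \<open>\<F>\<close>-bounded, but \<open>S\<close> is not \<open>\<F>\<close>-\<open>\<gamma>\<close>-equicontinuous.
\<close>

definition F_equitight_bounded ::
    "('k::real_or_complex \<Rightarrow> 'a::real_normed_vector \<Rightarrow> 'a) \<Rightarrow> ('a \<Rightarrow> real) set \<Rightarrow> 'i topology \<Rightarrow>
     ('i \<Rightarrow> real) set \<Rightarrow> ('i \<Rightarrow> 'a \<Rightarrow> 'a) \<Rightarrow> bool" where
  "F_equitight_bounded smul P I F S \<longleftrightarrow>
     (\<forall>t\<in>topspace I. S t \<in> bounded_operators smul) \<and>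
     (\<exists>k\<in>F. equitight_family P (topspace I) (weighted k S) \<and>
            bounded_family smul (topspace I) (weighted k S))"


section \<open>Weights\<close>

definition rV_infinity :: "'i topology \<Rightarrow> ('i \<Rightarrow> real) set \<Rightarrow> bool" where
  "rV_infinity I F \<longleftrightarrow>
     (\<forall>k1\<in>F. \<exists>k2\<in>F. \<forall>\<epsilon>>0. \<exists>M. compactin I M \<and> (\<forall>t\<in>topspace I - M. k2 t \<le> \<epsilon> * k1 t))"

definition locally_bounded_weight :: "'i topology \<Rightarrow> ('i \<Rightarrow> real) \<Rightarrow> bool" where
  "locally_bounded_weight I k \<longleftrightarrow> (\<forall>M. compactin I M \<longrightarrow> bdd_above (k ` M))"

text \<open>The infimum over the empty set is \<open>\<infinity>\<close>, which is why \<open>M = {}\<close> is exempt.\<close>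

definition locally_bounded_away_from_zero :: "'i topology \<Rightarrow> ('i \<Rightarrow> real) \<Rightarrow> bool" where
  "locally_bounded_away_from_zero I k \<longleftrightarrow>
     (\<forall>M. compactin I M \<and> M \<noteq> {} \<longrightarrow> 0 < (INF t\<in>M. k t))"


section \<open>Targets of maps on \<open>k\<^sub>l\<^sub>c\<^sub>s\<close>-spaces\<close>

lemma seminorm_zero:
  assumes "vector_space smul" "seminorm smul p" shows "p 0 = 0"
proof -
  interpret vector_space smul by fact
  have "p (smul 0 0) = norm (0::'a) * p 0"
    using assms(2) unfolding seminorm_def by blast
  then show ?thesis by simp
qed

lemma seminorm_diff_commute:
  assumes "vector_space smul" "seminorm smul p" shows "p (x - y) = p (y - x)"
proof -
  interpret vector_space smul by fact
  have "p (smul (- 1) (x - y)) = norm (- 1 :: 'a) * p (x - y)"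
    using assms(2) unfolding seminorm_def by blast
  then show ?thesis by simp
qed

lemma seminorm_triangle:
  assumes "seminorm smul p" shows "p (x - z) \<le> p (x - y) + p (y - z)"
proof -
  have "x - z = (x - y) + (y - z)" by simp
  then show ?thesis using assms unfolding seminorm_def by metis
qed

lemma openin_seminorm_topology:
  assumes vs: "vector_space smul" and P: "directed_seminorms smul P"
  shows "openin (seminorm_topology P) U \<longleftrightarrow> (\<forall>x\<in>U. \<exists>p\<in>P. \<exists>r>0. {y. p (y - x) < r} \<subseteq> U)"
    (is "?L \<longleftrightarrow> ?R")
proof
  have sn: "seminorm smul p" if "p \<in> P" for p
    using that P by (auto simp: directed_seminorms_def)
  let ?B = "{{y. p (y - x) < r} | p x r. p \<in> P \<and> 0 < r}"
  show ?R if ?L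
  proof -
    have "generate_topology_on ?B U"
      using that unfolding seminorm_topology_def by (simp add: openin_topology_generated_by_iff)
    then show ?R
    proof induction
      case Empty
      then show ?case by simp
    next
      case (Int U V)
      show ?case
      proof
        fix x assume "x \<in> U \<inter> V"
        with Int.IH obtain p q r s where pq: "p \<in> P" "q \<in> P" "0 < r" "0 < s"
          and sub: "{y. p (y - x) < r} \<subseteq> U" "{y. q (y - x) < s} \<subseteq> V"
          by (meson IntE)
        obtain u C where u: "u \<in> P" "0 \<le> C" "\<And>x. max (p x) (q x) \<le> C * u x"
          using P pq unfolding directed_seminorms_def by metis
        have "{y. u (y - x) < min r s / (C + 1)} \<subseteq> U \<inter> V"
        proof
          fix y assume y: "y \<in> {y. u (y - x) < min r s / (C + 1)}"
          have "u (y - x) \<ge> 0" using sn[OF u(1)] by (auto simp: seminorm_def)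
          then have "C * u (y - x) \<le> u (y - x) * (C + 1)" by (simp add: algebra_simps)
          also have "\<dots> < min r s" using y u(2) by (simp add: pos_less_divide_eq)
          finally have "max (p (y - x)) (q (y - x)) < min r s" using u(3)[of "y - x"] by linarith
          then show "y \<in> U \<inter> V" using sub by auto
        qed
        moreover have "min r s / (C + 1) > 0" using pq u by simp
        ultimately show "\<exists>p\<in>P. \<exists>r>0. {y. p (y - x) < r} \<subseteq> U \<inter> V" using u(1) by blast
      qed
    next
      case (UN K)
      then show ?case by (meson Union_iff Union_upper subset_trans)
    next
      case (Basis B)
      then obtain p x r where B: "B = {y. p (y - x) < r}" and p: "p \<in> P" "0 < r" by auto
      show ?case
      proof
        fix y assume "y \<in> B"
        then have "0 < r - p (y - x)" by (simp add: B)
        moreover have "{z. p (z - y) < r - p (y - x)} \<subseteq> B"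
          using seminorm_triangle[OF sn[OF p(1)], of _ x y] unfolding B by (smt (verit) Collect_mono)
        ultimately show "\<exists>p\<in>P. \<exists>r>0. {z. p (z - y) < r} \<subseteq> B" using p by blast
      qed
    qed
  qed
  show ?L if R: ?R
  proof (subst openin_subopen, intro ballI)
    fix x assume "x \<in> U"
    with R obtain p r where p: "p \<in> P" "0 < r" "{y. p (y - x) < r} \<subseteq> U" by blast
    moreover have "openin (seminorm_topology P) {y. p (y - x) < r}"
      unfolding seminorm_topology_def using p by (intro topology_generated_by_Basis) auto
    moreover have "x \<in> {y. p (y - x) < r}"
      using seminorm_zero[OF vs sn[OF p(1)]] p by simp
    ultimately show "\<exists>T. openin (seminorm_topology P) T \<and> x \<in> T \<and> T \<subseteq> U" by blast
  qed
qed

lemma topspace_seminorm_topology: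
  assumes "vector_space smul" "directed_seminorms smul P"
  shows "topspace (seminorm_topology P) = UNIV"
proof -
  have "openin (seminorm_topology P) UNIV"
    unfolding openin_seminorm_topology[OF assms] using assms(2)
    by (auto simp: directed_seminorms_def intro: exI[of _ "1::real"])
  then show ?thesis using openin_subset by blast
qed

lemma openin_seminorm_ball:
  assumes "p \<in> P" "0 < r" shows "openin (seminorm_topology P) {y. p (y - x) < r}"
  unfolding seminorm_topology_def using assms by (intro topology_generated_by_Basis) auto

lemma continuous_map_seminorm_topology:
  assumes vs: "vector_space smul" and P: "directed_seminorms smul P"
  shows "continuous_map J (seminorm_topology P) f \<longleftrightarrow>
    (\<forall>x\<in>topspace J. \<forall>p\<in>P. \<forall>r>0. \<exists>U. openin J U \<and> x \<in> U \<and> (\<forall>y\<in>U. p (f y - f x) < r))"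
    (is "?L \<longleftrightarrow> ?R")
proof
  have sn: "seminorm smul p" if "p \<in> P" for p
    using that P by (auto simp: directed_seminorms_def)
  show ?R if ?L
  proof (intro ballI allI impI)
    fix x p and r :: real assume *: "x \<in> topspace J" "p \<in> P" "0 < r"
    have "openin J {y \<in> topspace J. f y \<in> {z. p (z - f x) < r}}"
      using that openin_seminorm_ball[OF *(2,3)] by (rule openin_continuous_map_preimage)
    then show "\<exists>U. openin J U \<and> x \<in> U \<and> (\<forall>y\<in>U. p (f y - f x) < r)"
      using * seminorm_zero[OF vs sn[OF *(2)]]
      by (intro exI[of _ "{y \<in> topspace J. f y \<in> {z. p (z - f x) < r}}"]) auto
  qed
  show ?L if R: ?R
    unfolding continuous_map
  proof (intro conjI allI impI)
    show "f ` topspace J \<subseteq> topspace (seminorm_topology P)"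
      by (simp add: topspace_seminorm_topology[OF vs P])
    fix V assume V: "openin (seminorm_topology P) V"
    show "openin J {x \<in> topspace J. f x \<in> V}"
    proof (subst openin_subopen, intro ballI)
      fix x assume x: "x \<in> {x \<in> topspace J. f x \<in> V}"
      then have "\<exists>p\<in>P. \<exists>r>0. {y. p (y - f x) < r} \<subseteq> V"
        using V[unfolded openin_seminorm_topology[OF vs P], rule_format, of "f x"] by simp
      then obtain p r where p: "p \<in> P" "0 < r" "{y. p (y - f x) < r} \<subseteq> V" by auto
      have "x \<in> topspace J" using x by simp
      then have "\<exists>U. openin J U \<and> x \<in> U \<and> (\<forall>y\<in>U. p (f y - f x) < r)"
        using R[rule_format, of x p r] p by simp
      then obtain U where "openin J U" "x \<in> U" "\<forall>y\<in>U. p (f y - f x) < r" by auto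
      moreover from this have "U \<subseteq> {x \<in> topspace J. f x \<in> V}"
        using p openin_subset by blast
      ultimately show "\<exists>T. openin J T \<and> x \<in> T \<and> T \<subseteq> {x \<in> topspace J. f x \<in> V}" by blast
    qed
  qed
qed

lemma Hausdorff_seminorm_topology:
  assumes vs: "vector_space smul" and P: "directed_seminorms smul P"
  shows "Hausdorff_space (seminorm_topology P) \<longleftrightarrow> (\<forall>x. x \<noteq> 0 \<longrightarrow> (\<exists>p\<in>P. 0 < p x))"
    (is "?L \<longleftrightarrow> ?R")
proof
  have sn: "seminorm smul p" if "p \<in> P" for p
    using that P by (auto simp: directed_seminorms_def)
  show ?R if H: ?L
  proof (intro allI impI)
    fix x :: 'b assume "x \<noteq> 0"
    then obtain U V where UV: "openin (seminorm_topology P) U" "0 \<in> U" "x \<in> V" "disjnt U V"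
      using H unfolding Hausdorff_space_def topspace_seminorm_topology[OF vs P]
      by (metis UNIV_I)
    then obtain p r where p: "p \<in> P" "0 < r" "{y. p (y - 0) < r} \<subseteq> U"
      unfolding openin_seminorm_topology[OF vs P] by blast
    have "x \<notin> U" using UV by (auto simp: disjnt_iff)
    then have "\<not> p x < r" using p by auto
    then show "\<exists>p\<in>P. 0 < p x" using p by (intro bexI[of _ p]) auto
  qed
  show ?L if R: ?R
    unfolding Hausdorff_space_def
  proof (intro allI impI)
    fix x y :: 'b
    assume *: "x \<in> topspace (seminorm_topology P) \<and> y \<in> topspace (seminorm_topology P) \<and> x \<noteq> y"
    then obtain p where p: "p \<in> P" "0 < p (x - y)" using R by (metis right_minus_eq)
    let ?U = "\<lambda>x. {z. p (z - x) < p (x - y) / 2}"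
    let ?V = "{z. p (z - y) < p (x - y) / 2}"
    have "disjnt (?U x) ?V"
    proof -
      have "False" if "p (z - x) < p (x - y) / 2" "p (z - y) < p (x - y) / 2" for z
        using that seminorm_triangle[OF sn[OF p(1)], of x y z]
          seminorm_diff_commute[OF vs sn[OF p(1)], of x z] by linarith
      then show ?thesis by (auto simp: disjnt_iff)
    qed
    moreover have "x \<in> ?U x" "y \<in> ?V"
      using p seminorm_zero[OF vs sn[OF p(1)]] by auto
    moreover have "openin (seminorm_topology P) (?U x)" "openin (seminorm_topology P) ?V"
      using p by (intro openin_seminorm_ball; simp)+
    ultimately show "\<exists>U V. openin (seminorm_topology P) U \<and> openin (seminorm_topology P) V \<and>
        x \<in> U \<and> y \<in> V \<and> disjnt U V" by blast
  qed
qed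

lemma coordinates_on_span:
  fixes s :: "real \<Rightarrow> 'v::ab_group_add \<Rightarrow> 'v" and f :: "'i \<Rightarrow> 'v"
  assumes "vector_space s"
  shows "\<exists>(L :: 'v \<Rightarrow> 'i \<Rightarrow> real) R.
    Vector_Spaces.linear s (\<lambda>c y i. c * y i) L \<and> Vector_Spaces.linear (\<lambda>c y i. c * y i) s R \<and>
    (\<forall>t u. R (L (f t - f u)) = f t - f u)"
proof -
  interpret vector_space s by fact
  let ?fs = "\<lambda>(c::real) (y :: 'i \<Rightarrow> real) i. c * y i"
  have fs: "vector_space ?fs"
    by unfold_locales (auto simp: fun_eq_iff algebra_simps)
  interpret pair: vector_space_pair s ?fs
    by (simp add: vector_space_pair_def assms fs)
  obtain B where B: "B \<subseteq> range f" "independent B" "range f \<subseteq> span B"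
    using maximal_independent_subset[of "range f"] by blast
  define g where "g b = (SOME t. f t = b)" for b
  have g: "f (g b) = b" if "b \<in> B" for b
    using that B(1) unfolding g_def by (metis (mono_tags) imageE someI_ex subsetD)
  let ?E = "extend_basis B"
  have E: "B \<subseteq> ?E" "independent ?E" "span ?E = UNIV"
    using extend_basis_superset[OF B(2)] independent_extend_basis[OF B(2)] span_extend_basis[OF B(2)]
    by auto
  define L where "L v = (\<lambda>i. representation ?E v (f i))" for v
  have L: "Vector_Spaces.linear s ?fs L"
    unfolding Vector_Spaces.linear_iff
  proof (intro conjI allI)
    show "L (x + y) = L x + L y" for x y
      using E by (auto simp: L_def fun_eq_iff representation_add)
    show "L (s c x) = (\<lambda>i. c * L x i)" for c x
      using E by (auto simp: L_def fun_eq_iff representation_scale)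
  qed (fact assms fs)+
  have inj: "inj_on L (span B)"
  proof (rule inj_onI)
    fix v w assume v: "v \<in> span B" and w: "w \<in> span B" and eq: "L v = L w"
    have rep: "representation ?E z = representation B z" if "z \<in> span B" for z
      using representation_extend[OF E(2) that E(1)] by simp
    have "representation B v b = representation B w b" for b
    proof (cases "b \<in> B")
      case True
      then show ?thesis using fun_cong[OF eq, of "g b"] v w by (simp add: L_def g rep)
    next
      case False
      then show ?thesis using representation_ne_zero by metis
    qed
    then have *: "representation B v = representation B w" by auto
    show "v = w"
      using sum_nonzero_representation_eq[OF B(2) v] sum_nonzero_representation_eq[OF B(2) w]
      unfolding * by (rule trans[OF sym])
  qed
  obtain R where R: "Vector_Spaces.linear ?fs s R" "\<forall>v\<in>span B. R (L v) = v"
    using pair.linear_exists_left_inverse_on[OF L subspace_span inj] by blast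
  have "R (L (f t - f u)) = f t - f u" for t u
    using R(2) B(3) by (meson rangeI span_diff subsetD)
  with L R(1) show ?thesis by blast
qed

theorem k_lcs_space_continuous:
  fixes smul :: "'k::real_or_complex \<Rightarrow> 'v::ab_group_add \<Rightarrow> 'v" and I :: "'i topology"
  assumes "k_lcs_space I"
  shows "continuous_if_on_compacts I smul"
  unfolding continuous_if_on_compacts_def
proof (intro allI impI)
  fix \<sigma> and f :: "'i \<Rightarrow> 'v"
  assume *: "Hausdorff_lcs smul \<sigma> \<and>
    (\<forall>M. compactin I M \<longrightarrow> continuous_map (subtopology I M) \<sigma> f)"
  then have vs: "vector_space smul" and cf: "\<And>M. compactin I M \<Longrightarrow> continuous_map (subtopology I M) \<sigma> f"
    by (auto simp: Hausdorff_lcs_def)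
  obtain P where P: "directed_seminorms smul P" and \<sigma>: "\<sigma> = seminorm_topology P"
    using * by (auto simp: Hausdorff_lcs_def generating_seminorms_def)
  have sn: "seminorm smul p" if "p \<in> P" for p
    using that P by (auto simp: directed_seminorms_def)
  have sep: "\<exists>p\<in>P. 0 < p x" if "x \<noteq> 0" for x
    using * that Hausdorff_seminorm_topology[OF vs P] by (auto simp: Hausdorff_lcs_def \<sigma>)
  interpret vector_space smul by fact
  let ?s = "\<lambda>(r::real) v. smul (of_real r) v"
  let ?fs = "\<lambda>(c::real) (y :: 'i \<Rightarrow> real) i. c * y i"
  have s: "vector_space ?s"
    by unfold_locales (auto simp: scale_right_distrib scale_left_distrib)
  have fs: "vector_space ?fs"
    by unfold_locales (auto simp: fun_eq_iff algebra_simps)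
  obtain L R where L: "Vector_Spaces.linear ?s ?fs L" and R: "Vector_Spaces.linear ?fs ?s R"
    and RL: "\<And>t u. R (L (f t - f u)) = f t - f u"
    using coordinates_on_span[OF s, of f] by blast
  interpret L: Vector_Spaces.linear ?s ?fs L by fact
  interpret R: Vector_Spaces.linear ?fs ?s R by fact
  define N where "N p A y = p (R y) + (\<Sum>i\<in>A. \<bar>y i - L (R y) i\<bar>)" for p and A :: "'i set" and y
  define P' where "P' = {N p A | p A. p \<in> P \<and> finite A}"
  have N_seminorm: "seminorm ?fs (N p A)" if p: "p \<in> P" for p A
    unfolding seminorm_def
  proof (intro conjI allI)
    show "0 \<le> N p A x" for x
      using sn[OF p] unfolding N_def seminorm_def by (simp add: sum_nonneg)
    show "N p A (x + y) \<le> N p A x + N p A y" for x y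
    proof -
      have "p (R (x + y)) \<le> p (R x) + p (R y)"
        using sn[OF p] by (simp add: seminorm_def R.add)
      moreover have "(\<Sum>i\<in>A. \<bar>(x + y) i - L (R (x + y)) i\<bar>)
          \<le> (\<Sum>i\<in>A. \<bar>x i - L (R x) i\<bar> + \<bar>y i - L (R y) i\<bar>)"
        by (intro sum_mono) (simp add: R.add L.add)
      ultimately show ?thesis by (simp add: N_def sum.distrib)
    qed
    show "N p A (\<lambda>i. c * x i) = norm c * N p A x" for c x
    proof -
      have "p (R (\<lambda>i. c * x i)) = \<bar>c\<bar> * p (R x)"
        using sn[OF p] by (simp add: seminorm_def R.scale)
      moreover have "\<bar>c * x i - L (R (\<lambda>i. c * x i)) i\<bar> = \<bar>c\<bar> * \<bar>x i - L (R x) i\<bar>" for i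
        by (simp add: R.scale L.scale flip: right_diff_distrib abs_mult)
      ultimately show ?thesis by (simp add: N_def distrib_left sum_distrib_left)
    qed
  qed
  have P': "directed_seminorms ?fs P'"
    unfolding directed_seminorms_def
  proof (intro conjI ballI)
    obtain p0 where "p0 \<in> P" using P by (auto simp: directed_seminorms_def)
    then have "N p0 {} \<in> P'" by (auto simp: P'_def)
    then show "P' \<noteq> {}" by blast
    show "seminorm ?fs p" if "p \<in> P'" for p
      using that N_seminorm by (auto simp: P'_def)
    fix n1 n2 assume "n1 \<in> P'" "n2 \<in> P'"
    then obtain p A q B where n: "n1 = N p A" "n2 = N q B" "p \<in> P" "q \<in> P" "finite A" "finite B"
      by (auto simp: P'_def)
    then obtain u C where u: "u \<in> P" "0 \<le> C" "\<And>x. max (p x) (q x) \<le> C * u x"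
      using P unfolding directed_seminorms_def by metis
    have "max (n1 x) (n2 x) \<le> (C + 1) * N u (A \<union> B) x" for x
    proof -
      let ?d = "\<lambda>i. \<bar>x i - L (R x) i\<bar>"
      have "sum ?d A \<le> sum ?d (A \<union> B)" "sum ?d B \<le> sum ?d (A \<union> B)"
        using n by (auto intro!: sum_mono2)
      moreover have "0 \<le> C * sum ?d (A \<union> B)" using u by (simp add: sum_nonneg)
      moreover have "0 \<le> u (R x)" using sn[OF u(1)] by (simp add: seminorm_def)
      moreover have "p (R x) \<le> C * u (R x)" "q (R x) \<le> C * u (R x)" using u(3)[of "R x"] by auto
      ultimately show ?thesis unfolding n N_def by (simp add: algebra_simps)
    qed
    then show "\<exists>r\<in>P'. \<exists>C\<ge>0. \<forall>x. max (n1 x) (n2 x) \<le> C * r x"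
      using u n by (intro bexI[of _ "N u (A \<union> B)"] exI[of _ "C + 1"]) (auto simp: P'_def)
  qed
  have "Hausdorff_space (seminorm_topology P')"
    unfolding Hausdorff_seminorm_topology[OF fs P']
  proof (intro allI impI)
    fix y :: "'i \<Rightarrow> real" assume y: "y \<noteq> 0"
    obtain p0 where p0: "p0 \<in> P" using P by (auto simp: directed_seminorms_def)
    show "\<exists>n\<in>P'. 0 < n y"
    proof (cases "R y = 0")
      case True
      obtain i where "y i \<noteq> 0" using y by (auto simp: fun_eq_iff)
      then have "0 < N p0 {i} y"
        using True p0 seminorm_zero[OF vs sn[OF p0]] by (simp add: N_def L.zero)
      moreover have "N p0 {i} \<in> P'" using p0 by (auto simp: P'_def)
      ultimately show ?thesis by blast
    next
      case False
      then obtain p where "p \<in> P" "0 < p (R y)" using sep by blast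
      then show ?thesis by (intro bexI[of _ "N p {}"]) (auto simp: P'_def N_def)
    qed
  qed
  then have lcs: "Hausdorff_lcs ?fs (seminorm_topology P')"
    using fs P' by (auto simp: Hausdorff_lcs_def generating_seminorms_def)
  have N: "N p A (L (f t) - L (f u)) = p (f t - f u)" for p A t u
  proof -
    have "L (f t) - L (f u) = L (f t - f u)" by (simp add: L.diff)
    then show ?thesis by (simp add: N_def RL)
  qed
  have all_P': "(\<forall>n\<in>P'. X n) \<longleftrightarrow> (\<forall>p\<in>P. \<forall>A. finite A \<longrightarrow> X (N p A))" for X
    by (auto simp: P'_def)
  have all_finite: "(\<forall>A::'i set. finite A \<longrightarrow> X) \<longleftrightarrow> X" for X
    by (auto intro: finite.emptyI)
  have eq: "continuous_map J (seminorm_topology P') (\<lambda>t. L (f t)) \<longleftrightarrow> continuous_map J \<sigma> f"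
    for J :: "'i topology"
    unfolding \<sigma> continuous_map_seminorm_topology[OF vs P] continuous_map_seminorm_topology[OF fs P']
    by (simp only: all_P' N all_finite)
  have "continuous_if_on_compacts I ?fs"
    using assms by (simp add: k_lcs_space_def)
  then have "continuous_map I (seminorm_topology P') (\<lambda>t. L (f t))"
    unfolding continuous_if_on_compacts_def
    by (elim allE[of _ "seminorm_topology P'"] allE[of _ "\<lambda>t. L (f t)"]) (simp add: lcs eq cf)
  then show "continuous_map I \<sigma> f"
    by (simp only: eq)
qed

end

theory Submission
  imports Defs
begin

text \<open>
  The whole proof rests on two descriptions of \<open>\<gamma>\<close>.  A seminorm is \<open>\<gamma>\<close>-continuous as soon as it
  is \<open>\<tau>\<close>-continuous at \<open>0\<close> on the unit ball, because adding it to the seminorms of \<open>\<tau>\<close> gives a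
  topology that competes with \<open>\<gamma>\<close>; and a \<open>\<gamma>\<close>-bounded set is norm bounded, so a sequence
  \<open>\<gamma>\<close>-converges iff it is norm bounded and \<open>\<tau>\<close>-converges.  Equicontinuity of \<open>k(t) S(t)\<close> means that
  the seminorms \<open>x \<mapsto> sup\<^sub>t p(k(t) S(t) x)\<close> are \<open>\<gamma>\<close>-continuous.  Under (a), \<open>rV\<^sub>\<infinity>\<close> makes the
  supremum over the complement of a compact set small, and bi-equicontinuity handles the compact set,
  so these seminorms are sequentially continuous; C-sequentiality finishes.  In a strong Mackey
  space, \<open>rV\<^sub>\<infinity>\<close> makes the functionals \<open>k(t) f \<circ> S(t)\<close> with \<open>f\<close> in a polar, together with \<open>0\<close>, a
  weak* compact set, hence an equicontinuous one, and the theorem of Hahn--Banach turns this into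
  equicontinuity of the operators.
\<close>

section \<open>Hahn--Banach\<close>

text \<open>Since \<open>\<gamma>\<close> is specified by maximality, there is no formula for its
  seminorms. A seminorm is shown to be \<open>\<gamma>\<close>-continuous by exhibiting a competing
  topology; conversely, a given seminorm of \<open>\<gamma>\<close> is evaluated on norm balls,
  where \<open>\<tau>\<close> takes over. The second obstacle is the weight. The weight that
  witnesses boundedness controls norms only, and a norm estimate alone does not give continuity for
  \<open>\<gamma>\<close>. A second weight, infinitely smaller at infinity, makes everything outside
  a compact subset of \<open>I\<close> small on bounded sets, and only the compact part is left to
  the topological hypotheses. So the implications that use \<open>rV_infinity\<close> change the
  weight, while those that start from equicontinuity or equitightness keep it. The functional
  \<open>0\<close> in the weak* compact set is the value at the point that would compactify
  \<open>I\<close>. Real and complex scalars share one proof: they are written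
  \<open>a + b * i\<close>, where \<open>i = 0\<close> or \<open>i * i = - 1\<close>.\<close>

definition sublinear :: "('a::real_vector \<Rightarrow> real) \<Rightarrow> bool" where
  "sublinear q \<longleftrightarrow>
     (\<forall>x y. q (x + y) \<le> q x + q y) \<and> (\<forall>r\<ge>0. \<forall>x. q (r *\<^sub>R x) \<le> r * q x)"

text \<open>Homogeneity is asked of \<open>sublinear\<close> only as an inequality, the form that
  infima inherit; rescaling by \<open>inverse r\<close> returns the equality.\<close>

lemma sublinearD:
  assumes "sublinear q"
  shows sublinear_add: "q (x + y) \<le> q x + q y"
    and sublinear_scale: "0 \<le> r \<Longrightarrow> q (r *\<^sub>R x) = r * q x"
    and sublinear_zero: "q 0 = 0"
    and sublinear_minus: "- q (- x) \<le> q x"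
proof -
  have add: "q (x + y) \<le> q x + q y" for x y
    using assms by (simp add: sublinear_def)
  have le: "q (r *\<^sub>R x) \<le> r * q x" if "0 \<le> r" for r x
    using assms that by (simp add: sublinear_def)
  show "q (x + y) \<le> q x + q y"
    by (fact add)
  show zero: "q 0 = 0"
    using le[of 0 0] add[of 0 0] by simp
  show "- q (- x) \<le> q x"
    using add[of x "- x"] zero by simp
  show "q (r *\<^sub>R x) = r * q x" if "0 \<le> r"
  proof (cases "r = 0")
    case True
    then show ?thesis by (simp add: zero)
  next
    case False
    then have "q x \<le> inverse r * q (r *\<^sub>R x)"
      using le[of "inverse r" "r *\<^sub>R x"] that by simp
    then have "r * q x \<le> q (r *\<^sub>R x)"
      using False that by (simp add: field_simps)
    then show ?thesis using le[OF that, of x] by linarith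
  qed
qed

text \<open>For sublinear \<open>q\<close> this is the largest sublinear functional below
  \<open>q\<close> whose value at \<open>- y\<close> is at most \<open>- q y\<close>:
  \<open>t = 0\<close> gives the bound by \<open>q\<close>, and \<open>t = 1\<close> the value at
  \<open>- y\<close>. Hence every linear functional below it agrees with \<open>q\<close> at
  \<open>y\<close>.\<close>

definition directional_minorant :: "('a::real_vector \<Rightarrow> real) \<Rightarrow> 'a \<Rightarrow> 'a \<Rightarrow> real" where
  "directional_minorant q y x = (INF t\<in>{0..}. q (x + t *\<^sub>R y) - t * q y)"

lemma directional_minorant_lower:
  assumes "sublinear q" "0 \<le> t"
  shows "directional_minorant q y x \<le> q (x + t *\<^sub>R y) - t * q y"
  unfolding directional_minorant_def
proof (rule cINF_lower)
  show "bdd_below ((\<lambda>t. q (x + t *\<^sub>R y) - t * q y) ` {0..})"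
  proof (rule bdd_belowI2)
    fix t :: real assume "t \<in> {0..}"
    then show "- q (- x) \<le> q (x + t *\<^sub>R y) - t * q y"
      using sublinear_add[OF assms(1), of "x + t *\<^sub>R y" "- x"]
        sublinear_scale[OF assms(1), of t y] by simp
  qed
qed (use assms in auto)

text \<open>The parameters combine as the arguments do: \<open>s + t\<close> is inserted for
  \<open>x + x'\<close>, and \<open>r * s\<close> for \<open>r *\<^sub>R x\<close>.\<close>

lemma sublinear_directional_minorant:
  assumes "sublinear q"
  shows "sublinear (directional_minorant q y)"
  unfolding sublinear_def
proof (intro conjI allI impI)
  let ?m = "directional_minorant q y"
  note lower = directional_minorant_lower[OF assms]
  show "?m (x + x') \<le> ?m x + ?m x'" for x x'
  proof -
    have *: "?m (x + x') \<le> (q (x + s *\<^sub>R y) - s * q y) + (q (x' + t *\<^sub>R y) - t * q y)"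
      if "0 \<le> s" "0 \<le> t" for s t
      using lower[of "s + t" y "x + x'"] that
        sublinear_add[OF assms, of "x + s *\<^sub>R y" "x' + t *\<^sub>R y"]
      by (simp add: algebra_simps)
    have "?m (x + x') - ?m x' \<le> q (x + s *\<^sub>R y) - s * q y" if "0 \<le> s" for s
    proof -
      have "?m (x + x') - (q (x + s *\<^sub>R y) - s * q y) \<le> ?m x'"
        unfolding directional_minorant_def[of q y x']
        using *[OF that] by (intro cINF_greatest) (auto simp: algebra_simps)
      then show ?thesis by linarith
    qed
    then have "?m (x + x') - ?m x' \<le> ?m x"
      unfolding directional_minorant_def[of q y x] by (intro cINF_greatest) auto
    then show ?thesis by linarith
  qed
  show "?m (r *\<^sub>R x) \<le> r * ?m x" if "0 \<le> r" for r x
  proof (cases "r = 0")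
    case True
    then show ?thesis using lower[of 0 y 0] sublinear_zero[OF assms] by simp
  next
    case False
    then have r: "0 < r" using that by simp
    have "?m (r *\<^sub>R x) / r \<le> q (x + s *\<^sub>R y) - s * q y" if "0 \<le> s" for s
      using lower[of "r * s" y "r *\<^sub>R x"] that r sublinear_scale[OF assms, of r "x + s *\<^sub>R y"]
      by (simp add: pos_divide_le_eq) (simp add: algebra_simps)
    then have "?m (r *\<^sub>R x) / r \<le> ?m x"
      unfolding directional_minorant_def[of q y x] by (intro cINF_greatest) auto
    then show ?thesis using r by (simp add: pos_divide_le_eq mult.commute)
  qed
qed

text \<open>Of two members of a chain the smaller one, \<open>q\<close>, lies below both, so
  \<open>q1 x + q2 y\<close> is at least \<open>q x + q y\<close>, hence at least
  \<open>q (x + y)\<close>. The common lower bound \<open>- p (- x)\<close> keeps the pointwise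
  infima finite.\<close>

lemma sublinear_INF_chain:
  assumes C: "C \<noteq> {}" "\<And>q. q \<in> C \<Longrightarrow> sublinear q \<and> q \<le> p"
    and chain: "\<And>q q'. q \<in> C \<Longrightarrow> q' \<in> C \<Longrightarrow> q \<le> q' \<or> q' \<le> q"
  shows "sublinear (\<lambda>x. INF q\<in>C. q x)" "\<And>q x. q \<in> C \<Longrightarrow> (INF q\<in>C. q x) \<le> q x"
proof -
  show lower: "(INF q\<in>C. q x) \<le> q x" if "q \<in> C" for q x
  proof (rule cINF_lower[OF _ that])
    show "bdd_below ((\<lambda>q. q x) ` C)"
    proof (rule bdd_belowI2)
      fix q assume "q \<in> C"
      then have "sublinear q" "q (- x) \<le> p (- x)"
        using C(2) by (auto simp: le_fun_def)
      then show "- p (- x) \<le> q x"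
        using sublinear_minus[of q x] by linarith
    qed
  qed
  show "sublinear (\<lambda>x. INF q\<in>C. q x)"
    unfolding sublinear_def
  proof (intro conjI allI impI)
    fix x y
    have *: "(INF q\<in>C. q (x + y)) \<le> q1 x + q2 y" if q: "q1 \<in> C" "q2 \<in> C" for q1 q2
    proof -
      obtain q where "q \<in> C" "q \<le> q1" "q \<le> q2"
        using chain[OF q] q by auto
      then show ?thesis
        using lower[of q "x + y"] sublinear_add[of q x y] C(2)[of q]
        by (force simp: le_fun_def intro: order_trans add_mono)
    qed
    have "(INF q\<in>C. q (x + y)) - (INF q\<in>C. q y) \<le> q1 x" if "q1 \<in> C" for q1
    proof -
      have "(INF q\<in>C. q (x + y)) - q1 x \<le> (INF q\<in>C. q y)"
        using *[OF that] by (intro cINF_greatest C(1)) (auto simp: algebra_simps)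
      then show ?thesis by linarith
    qed
    then have "(INF q\<in>C. q (x + y)) - (INF q\<in>C. q y) \<le> (INF q\<in>C. q x)"
      by (intro cINF_greatest C(1))
    then show "(INF q\<in>C. q (x + y)) \<le> (INF q\<in>C. q x) + (INF q\<in>C. q y)"
      by linarith
  next
    fix r :: real and x assume r: "0 \<le> r"
    show "(INF q\<in>C. q (r *\<^sub>R x)) \<le> r * (INF q\<in>C. q x)"
    proof (cases "r = 0")
      case True
      obtain q where "q \<in> C" using C(1) by blast
      then show ?thesis using True lower[of q 0] C(2) sublinear_zero[of q] by simp
    next
      case False
      have "(INF q\<in>C. q (r *\<^sub>R x)) / r \<le> q x" if "q \<in> C" for q
        using lower[OF that, of "r *\<^sub>R x"] sublinear_scale[of q r x] C(2)[OF that] r False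
        by (simp add: pos_divide_le_eq mult.commute)
      then have "(INF q\<in>C. q (r *\<^sub>R x)) / r \<le> (INF q\<in>C. q x)"
        by (intro cINF_greatest C(1))
      then show ?thesis using r False by (simp add: pos_divide_le_eq mult.commute)
    qed
  qed
qed

text \<open>
  A minimal sublinear functional below \<open>p\<close> equals all its directional minorants; evaluating these at
  \<open>t = 1\<close> gives superadditivity.
\<close>

lemma ex_linear_le_sublinear:
  assumes p: "sublinear p"
  shows "\<exists>f. linear f \<and> f \<le> p"
proof -
  let ?A = "{q. sublinear q \<and> q \<le> p}"
  \<comment> \<open>Zorn's lemma is applied to the reversed pointwise order, so a chain is bounded
    by its pointwise infimum and a maximal element is a minimal functional.\<close>
  have "\<exists>m\<in>?A. \<forall>q\<in>?A. m \<ge> q \<longrightarrow> q = m"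
  proof (rule predicate_Zorn)
    show "partial_order_on ?A (relation_of (\<lambda>x y. y \<le> x) ?A)"
      by (rule partial_order_on_relation_ofI) auto
    fix C assume "C \<in> Chains (relation_of (\<lambda>x y. y \<le> x) ?A)"
    then have C: "q \<le> q' \<or> q' \<le> q" "sublinear q" "q \<le> p" if "q \<in> C" "q' \<in> C" for q q'
      using that unfolding Chains_def relation_of_def by auto
    show "\<exists>u\<in>?A. \<forall>q\<in>C. u \<le> q"
    proof (cases "C = {}")
      case True
      then show ?thesis using p by auto
    next
      case False
      then obtain q where q: "q \<in> C" by blast
      have *: "sublinear (\<lambda>x. INF q\<in>C. q x)" "\<And>q x. q \<in> C \<Longrightarrow> (INF q\<in>C. q x) \<le> q x"
        using sublinear_INF_chain[of C p] False C by blast+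
      have "(\<lambda>x. INF q\<in>C. q x) \<le> p"
        using *(2)[OF q] C(3)[OF q q] by (auto simp: le_fun_def intro: order_trans)
      then show ?thesis
        using * by (intro bexI[of _ "\<lambda>x. INF q\<in>C. q x"]) (auto simp: le_fun_def)
    qed
  qed
  then obtain m where m: "sublinear m" "m \<le> p"
    and min: "\<And>q. sublinear q \<Longrightarrow> q \<le> p \<Longrightarrow> q \<le> m \<Longrightarrow> q = m"
    by blast
  have minorant: "directional_minorant m y = m" for y
  proof (rule min)
    show "directional_minorant m y \<le> m"
      using directional_minorant_lower[OF m(1), of 0 y] by (simp add: le_fun_def)
    then show "directional_minorant m y \<le> p" using m(2) by order
  qed (rule sublinear_directional_minorant[OF m(1)])
  have add: "m (x + y) = m x + m y" for x y
    using directional_minorant_lower[OF m(1), of 1 y x] sublinear_add[OF m(1), of x y]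
    by (simp add: minorant)
  have minus: "m (- x) = - m x" for x
    using add[of x "- x"] sublinear_zero[OF m(1)] by simp
  have "m (r *\<^sub>R x) = r * m x" for r x
    using sublinear_scale[OF m(1), of r x] sublinear_scale[OF m(1), of "- r" x] minus[of "r *\<^sub>R x"]
    by (cases "0 \<le> r") auto
  then have "linear m"
    using add by (intro linearI) auto
  then show ?thesis using m by blast
qed

text \<open>Existence is applied to \<open>directional_minorant p x\<^sub>0\<close> in place of
  \<open>p\<close>: its value at \<open>- x\<^sub>0\<close> is at most \<open>- p x\<^sub>0\<close>,
  which forces equality at \<open>x\<^sub>0\<close>.\<close>

theorem Hahn_Banach_sublinear:
  assumes p: "sublinear p"
  shows "\<exists>f. linear f \<and> f \<le> p \<and> f x\<^sub>0 = p x\<^sub>0"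
proof -
  obtain f where f: "linear f" "f \<le> directional_minorant p x\<^sub>0"
    using ex_linear_le_sublinear[OF sublinear_directional_minorant[OF p]] by blast
  have le: "f x \<le> p x" for x
    using f(2) directional_minorant_lower[OF p, of 0 x\<^sub>0 x] by (force simp: le_fun_def intro: order_trans)
  have "f (- x\<^sub>0) \<le> directional_minorant p x\<^sub>0 (- x\<^sub>0)"
    using f(2) by (simp add: le_fun_def)
  also have "\<dots> \<le> - p x\<^sub>0"
    using directional_minorant_lower[OF p, of 1 x\<^sub>0 "- x\<^sub>0"] sublinear_zero[OF p] by simp
  finally have "p x\<^sub>0 \<le> f x\<^sub>0"
    using linear_neg[OF f(1), of x\<^sub>0] by simp
  then show ?thesis using f(1) le by (intro exI[of _ f]) (auto simp: le_fun_def intro: antisym)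
qed

section \<open>Real and complex scalars treated together\<close>

lemma imaginary_unit_cases:
  obtains i :: "'k::real_or_complex" where "i = 0 \<or> i * i = - 1"
    "\<And>z. \<exists>a b. z = of_real a + of_real b * i" "norm i \<le> 1"
proof -
  obtain i :: 'k where i: "i = 0 \<or> i * i = - 1" "\<And>z. \<exists>a b. z = a *\<^sub>R 1 + b *\<^sub>R i"
    using ex_imaginary_unit by blast
  have "norm i \<le> 1"
  proof (cases "i = 0")
    case False
    then have "norm i * norm i = 1"
      using i(1) by (metis norm_minus_cancel norm_mult norm_one)
    then show ?thesis
      by (metis abs_norm_cancel abs_square_eq_1 order_refl power2_eq_square)
  qed simp
  then show ?thesis
    using that[of i] i by (simp add: scaleR_conv_of_real)
qed

text \<open>Multiplication by the conjugate \<open>?w\<close>: the product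
  \<open>norm ?z * norm ?w\<close> is \<open>a\<^sup>2 + b\<^sup>2\<close>, which is at least half
  of \<open>(\<bar>a\<bar> + \<bar>b\<bar>)\<^sup>2\<close>, while \<open>norm ?w\<close> is at most
  \<open>\<bar>a\<bar> + \<bar>b\<bar>\<close>.\<close>

lemma real_part_le_norm:
  fixes i :: "'k::real_or_complex"
  assumes i: "i = 0 \<or> i * i = - 1" "norm i \<le> 1"
  shows "\<bar>a\<bar> \<le> 2 * norm (of_real a + of_real b * i)"
proof (cases "i = 0")
  case False
  let ?z = "of_real a + of_real b * i" and ?w = "of_real a - of_real b * i"
  have "?z * ?w = of_real (a\<^sup>2) - (of_real b * of_real b) * (i * i)"
    by (simp add: algebra_simps power2_eq_square)
  also have "\<dots> = of_real (a\<^sup>2 + b\<^sup>2)"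
    using i False by (simp add: power2_eq_square)
  finally have eq: "norm ?z * norm ?w = a\<^sup>2 + b\<^sup>2"
    by (metis norm_mult norm_of_real abs_of_nonneg sum_power2_ge_zero)
  have "norm (of_real b * i) \<le> \<bar>b\<bar>"
    using i mult_left_mono[of "norm i" 1 "\<bar>b\<bar>"] by (simp add: norm_mult)
  then have w: "norm ?w \<le> \<bar>a\<bar> + \<bar>b\<bar>"
    using norm_triangle_ineq4[of "of_real a" "of_real b * i"] by simp
  have "(\<bar>a\<bar> + \<bar>b\<bar>)\<^sup>2 \<le> 2 * (a\<^sup>2 + b\<^sup>2)"
    using sum_squares_ge_zero[of "\<bar>a\<bar> - \<bar>b\<bar>" 0] by (simp add: power2_eq_square algebra_simps)
  also have "\<dots> \<le> 2 * norm ?z * (\<bar>a\<bar> + \<bar>b\<bar>)"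
    using eq mult_left_mono[OF w, of "norm ?z"] by simp
  finally have "(\<bar>a\<bar> + \<bar>b\<bar>) * (\<bar>a\<bar> + \<bar>b\<bar>) \<le> 2 * norm ?z * (\<bar>a\<bar> + \<bar>b\<bar>)"
    by (simp only: power2_eq_square)
  then have "\<bar>a\<bar> + \<bar>b\<bar> \<le> 2 * norm ?z"
    by (cases "\<bar>a\<bar> + \<bar>b\<bar> = 0") (auto simp: mult_le_cancel_right add_nonneg_eq_0_iff)
  then show ?thesis by simp
qed simp

text \<open>By \<open>real_part_le_norm\<close> both coordinates of a point of the ball are at most
  \<open>2 * r\<close> in absolute value, the second one after multiplication by \<open>- i\<close>.
  The ball is thus a closed part of the image of a compact square. Compactness of sets of
  functionals rests on this.\<close>

lemma compact_cball_scalars: "compact (cball (0::'k::real_or_complex) r)"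
proof -
  obtain i :: 'k where i: "i = 0 \<or> i * i = - 1" "\<And>z. \<exists>a b. z = of_real a + of_real b * i" "norm i \<le> 1"
    using imaginary_unit_cases by blast
  let ?g = "\<lambda>(a, b). of_real a + of_real b * i"
  let ?B = "{- 2 * r..2 * r} \<times> {- 2 * r..2 * r}"
  have "compact (?g ` ?B)"
    by (intro compact_continuous_image compact_Times compact_Icc)
      (auto simp: case_prod_unfold intro!: continuous_intros)
  moreover have "cball 0 r \<subseteq> ?g ` ?B"
  proof
    fix z :: 'k assume z: "z \<in> cball 0 r"
    \<comment> \<open>If \<open>i = 0\<close>, then \<open>b\<close> does not affect
      \<open>z\<close> and could be arbitrarily large, so it is chosen to be
      \<open>0\<close>.\<close>
    obtain a b where ab: "z = of_real a + of_real b * i" "i = 0 \<longrightarrow> b = 0"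
    proof (cases "i = 0")
      case True
      then show ?thesis using i(2)[of z] that[of _ 0] by auto
    qed (use i(2)[of z] that in blast)
    have "\<bar>a\<bar> \<le> 2 * r"
      using real_part_le_norm[OF i(1,3), of a b] z ab by simp
    moreover have "\<bar>b\<bar> \<le> 2 * r"
    proof (cases "i = 0")
      case False
      then have "z * (- i) = of_real b + of_real (- a) * i"
        using i(1) by (simp add: ab(1) algebra_simps) (simp add: mult.left_commute[of i] flip: mult.assoc)
      moreover have "norm (z * (- i)) \<le> r"
        using z i(3) mult_left_mono[of "norm i" 1 "norm z"] by (simp add: norm_mult)
      ultimately show ?thesis using real_part_le_norm[OF i(1,3), of b "- a"] by simp
    qed (use ab z in auto)
    ultimately show "z \<in> ?g ` ?B"
      using ab by (intro image_eqI[of _ _ "(a, b)"]) auto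
  qed
  ultimately show ?thesis
    by (metis closed_Int_compact closed_cball inf.absorb_iff1)
qed

lemma seminorm_scaleR:
  assumes "normed_space_over smul" "seminorm smul p"
  shows "p (r *\<^sub>R x) = \<bar>r\<bar> * p x"
proof -
  have "p (smul (of_real r) x) = norm (of_real r :: 'a) * p x"
    using assms(2) unfolding seminorm_def by blast
  then show ?thesis using assms(1) by (simp add: normed_space_over_def)
qed

text \<open>
  The factors \<open>2\<close> are harmless for equicontinuity and make it unnecessary to identify the norm of
  \<open>a + b * i\<close> with \<open>sqrt (a\<^sup>2 + b\<^sup>2)\<close>.
\<close>

theorem Hahn_Banach_seminorm:
  fixes smul :: "'k::real_or_complex \<Rightarrow> 'a::real_normed_vector \<Rightarrow> 'a"
  assumes ns: "normed_space_over smul" and p: "seminorm smul p"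
  obtains f where "Vector_Spaces.linear smul (*) f" "\<And>x. norm (f x) \<le> 2 * p x"
    "p x\<^sub>0 \<le> 2 * norm (f x\<^sub>0)"
proof -
  interpret vector_space smul using ns by (simp add: normed_space_over_def)
  have real: "smul (of_real r) x = r *\<^sub>R x" for r x
    using ns by (simp add: normed_space_over_def)
  obtain i :: 'k where i: "i = 0 \<or> i * i = - 1" "\<And>z. \<exists>a b. z = of_real a + of_real b * i" "norm i \<le> 1"
    using imaginary_unit_cases by blast
  have "sublinear p"
    using p seminorm_scaleR[OF ns p] by (simp add: sublinear_def seminorm_def)
  then obtain g where g: "linear g" "g \<le> p" "g x\<^sub>0 = p x\<^sub>0"
    using Hahn_Banach_sublinear by blast
  interpret g: linear g by (fact g(1))
  have abs_g: "\<bar>g x\<bar> \<le> p x" for x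
    using le_funD[OF g(2), of x] le_funD[OF g(2), of "- x"] seminorm_scaleR[OF ns p, of "- 1" x]
    by (simp add: g.neg)
  \<comment> \<open>The usual passage from real to complex functionals,
    \<open>g x - i * g (i x)\<close>; for \<open>i = 0\<close> it is \<open>g\<close>
    itself.\<close>
  define f where "f x = of_real (g x) + of_real (- g (smul i x)) * i" for x
  have f_add: "f (x + y) = f x + f y" for x y
    by (simp add: f_def g.add scale_right_distrib algebra_simps)
  have f_real: "f (smul (of_real r) x) = of_real r * f x" for r x
  proof -
    have "smul i (smul (of_real r) x) = r *\<^sub>R smul i x"
      by (simp add: mult.commute flip: real)
    then show ?thesis by (simp add: f_def real g.scale algebra_simps)
  qed
  have "smul (i * i) x = - x" if "i \<noteq> 0" for x
    using i(1) that by simp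
  then have f_i: "f (smul i x) = i * f x" if "i \<noteq> 0" for x
    using i(1) that
    by (simp add: f_def g.neg algebra_simps) (simp add: add_eq_0_iff flip: mult.assoc)
  show ?thesis
  proof
    show "Vector_Spaces.linear smul (*) f"
      unfolding Vector_Spaces.linear_iff
    proof (intro conjI allI)
      fix z x
      obtain a b where z: "z = of_real a + of_real b * i" using i(2) by blast
      have "f (smul z x) = of_real a * f x + of_real b * f (smul i x)"
        by (simp add: z scale_left_distrib f_add f_real flip: scale_scale)
      also have "\<dots> = z * f x"
      proof (cases "i = 0")
        case True
        then show ?thesis by (simp add: z f_def)
      qed (simp add: z f_i algebra_simps)
      finally show "f (smul z x) = z * f x" .
    qed (auto simp: f_add vector_space_axioms intro!: vector_space.intro simp: algebra_simps)
    fix x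
    have "p (smul i x) = norm i * p x"
      using p by (simp add: seminorm_def)
    also have "\<dots> \<le> 1 * p x"
      using p i(3) by (intro mult_right_mono) (auto simp: seminorm_def)
    finally have "\<bar>g (smul i x)\<bar> \<le> p x"
      using abs_g[of "smul i x"] by simp
    moreover have "norm (of_real (- g (smul i x)) * i) \<le> \<bar>g (smul i x)\<bar> * 1"
      unfolding norm_mult using i(3) by (intro mult_mono) auto
    ultimately have "norm (of_real (- g (smul i x)) * i) \<le> p x" by simp
    then show "norm (f x) \<le> 2 * p x"
      using norm_triangle_ineq[of "of_real (g x) :: 'k" "of_real (- g (smul i x)) * i"] abs_g[of x]
      by (simp add: f_def)
    show "p x\<^sub>0 \<le> 2 * norm (f x\<^sub>0)"
      using real_part_le_norm[OF i(1,3), of "g x\<^sub>0" "- g (smul i x\<^sub>0)"] g(3) by (simp add: f_def)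
  qed
qed

section \<open>Seminorms and the topologies they generate\<close>

lemma seminormD:
  assumes "seminorm smul p"
  shows seminorm_nonneg: "0 \<le> p x"
    and seminorm_add_le: "p (x + y) \<le> p x + p y"
    and seminorm_smul: "p (smul c x) = norm c * p x"
  using assms by (auto simp: seminorm_def)

lemma linear_topology_seminorm_topology:
  fixes smul :: "'k::real_or_complex \<Rightarrow> 'a::ab_group_add \<Rightarrow> 'a"
  assumes vs: "vector_space smul" and P: "directed_seminorms smul P"
  shows "linear_topology smul (seminorm_topology P)"
proof -
  interpret vector_space smul by (fact vs)
  let ?T = "seminorm_topology P"
  note top = topspace_seminorm_topology[OF vs P]
  have sn: "seminorm smul p" if "p \<in> P" for p
    using that P by (auto simp: directed_seminorms_def)
  have "continuous_map (prod_topology ?T ?T) ?T (\<lambda>(x, y). x + y)"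
    unfolding continuous_map_seminorm_topology[OF vs P]
  proof (intro ballI allI impI)
    fix xy p and r :: real
    assume *: "xy \<in> topspace (prod_topology ?T ?T)" "p \<in> P" "0 < r"
    obtain x y where xy: "xy = (x, y)" by force
    let ?U = "{x'. p (x' - x) < r / 2} \<times> {y'. p (y' - y) < r / 2}"
    have "openin (prod_topology ?T ?T) ?U"
      unfolding openin_prod_Times_iff using * openin_seminorm_ball[OF *(2), of "r / 2"] by simp
    moreover have "xy \<in> ?U"
      using * seminorm_zero[OF vs sn[OF *(2)]] by (simp add: xy)
    moreover have "p (x' + y' - (x + y)) < r" if "(x', y') \<in> ?U" for x' y'
      using that seminorm_add_le[OF sn[OF *(2)], of "x' - x" "y' - y"]
      by (simp add: algebra_simps)
    ultimately show "\<exists>U. openin (prod_topology ?T ?T) U \<and> xy \<in> U \<and>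
        (\<forall>z\<in>U. p ((case z of (x, y) \<Rightarrow> x + y) - (case xy of (x, y) \<Rightarrow> x + y)) < r)"
      by (intro exI[of _ ?U]) (auto simp: xy)
  qed
  moreover have "continuous_map (prod_topology euclidean ?T) ?T (\<lambda>(c, x). smul c x)"
    unfolding continuous_map_seminorm_topology[OF vs P]
  proof (intro ballI allI impI)
    fix cx p and r :: real
    assume *: "cx \<in> topspace (prod_topology (euclidean :: 'k topology) ?T)" "p \<in> P" "0 < r"
    obtain c x where cx: "cx = (c, x)" by force
    note p = sn[OF *(2)]
    \<comment> \<open>The difference \<open>smul c' x' - smul c x\<close> is split into
      \<open>smul c' (x' - x)\<close> and \<open>smul (c' - c) x\<close>. From
      \<open>d \<le> 1\<close> follows \<open>norm c' \<le> norm c + 1\<close>; with that,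
      \<open>e\<close> and \<open>d\<close> leave \<open>r / 2\<close> for each summand. Adding
      \<open>1\<close> keeps the denominators positive.\<close>
    define d where "d = min 1 (r / (2 * (p x + 1)))"
    define e where "e = r / (2 * (norm c + 1))"
    have px: "0 < p x + 1" using seminorm_nonneg[OF p, of x] by linarith
    then have d: "0 < d" "d \<le> 1" "d * (p x + 1) \<le> r / 2"
    proof -
      show "0 < d" "d \<le> 1" using *(3) px by (auto simp: d_def)
      have "d * (p x + 1) \<le> r / (2 * (p x + 1)) * (p x + 1)"
        using px by (intro mult_right_mono) (auto simp: d_def)
      moreover have "r / (2 * m) * m = r / 2" if "0 < m" for m
        using that by simp
      ultimately show "d * (p x + 1) \<le> r / 2" using px by metis
    qed
    have nc: "0 < norm c + 1" by (simp add: add_nonneg_pos)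
    then have e: "0 < e" "e * (norm c + 1) = r / 2"
      using *(3) by (auto simp: e_def field_simps)
    let ?U = "ball c d \<times> {x'. p (x' - x) < e}"
    have "openin (prod_topology euclidean ?T) ?U"
      unfolding openin_prod_Times_iff using * e by (auto intro: openin_seminorm_ball)
    moreover have "cx \<in> ?U"
      using d e seminorm_zero[OF vs p] by (simp add: cx)
    moreover have "p (smul c' x' - smul c x) < r" if "(c', x') \<in> ?U" for c' x'
    proof -
      have c': "norm (c' - c) < d" and x': "p (x' - x) < e"
        using that by (auto simp: dist_norm norm_minus_commute)
      then have "norm c' \<le> norm c + 1"
        using norm_triangle_ineq2[of c' c] d(2) by linarith
      then have "norm c' * p (x' - x) \<le> (norm c + 1) * p (x' - x)"
        by (intro mult_right_mono seminorm_nonneg[OF p])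
      also have "\<dots> < (norm c + 1) * e"
        using x' nc by (intro mult_strict_left_mono)
      finally have 1: "norm c' * p (x' - x) < r / 2" using e by (simp add: mult.commute)
      have "norm (c' - c) * p x \<le> d * (p x + 1)"
        using c' d seminorm_nonneg[OF p, of x] by (intro mult_mono) auto
      then have 2: "norm (c' - c) * p x \<le> r / 2" using d by simp
      have "smul c' x' - smul c x = smul c' (x' - x) + smul (c' - c) x"
        by (simp add: algebra_simps)
      then have "p (smul c' x' - smul c x) \<le> norm c' * p (x' - x) + norm (c' - c) * p x"
        using seminorm_add_le[OF p, of "smul c' (x' - x)" "smul (c' - c) x"]
        by (simp only: seminorm_smul[OF p])
      then show ?thesis using 1 2 by linarith
    qed
    ultimately show "\<exists>U. openin (prod_topology euclidean ?T) U \<and> cx \<in> U \<and>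
        (\<forall>z\<in>U. p ((case z of (c, x) \<Rightarrow> smul c x) - (case cx of (c, x) \<Rightarrow> smul c x)) < r)"
      by (intro exI[of _ ?U]) (auto simp: cx)
  qed
  ultimately show ?thesis
    unfolding linear_topology_def top by blast
qed

lemma limitin_seminorm_topology:
  assumes vs: "vector_space smul" and P: "directed_seminorms smul P"
  shows "limitin (seminorm_topology P) f x F \<longleftrightarrow> (\<forall>p\<in>P. ((\<lambda>n. p (f n - x)) \<longlongrightarrow> 0) F)"
    (is "?L \<longleftrightarrow> ?R")
proof
  have sn: "seminorm smul p" if "p \<in> P" for p
    using that P by (auto simp: directed_seminorms_def)
  show ?R if L: ?L
  proof (intro ballI tendstoI)
    fix p and e :: real assume p: "p \<in> P" "0 < e"
    then have "\<forall>\<^sub>F n in F. f n \<in> {y. p (y - x) < e}"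
      using L[unfolded limitin_def, THEN conjunct2, rule_format, of "{y. p (y - x) < e}"]
        openin_seminorm_ball[OF p, of x] seminorm_zero[OF vs sn[OF p(1)]] p(2) by simp
    then show "\<forall>\<^sub>F n in F. dist (p (f n - x)) 0 < e"
      using seminorm_nonneg[OF sn[OF p(1)]] by simp
  qed
  show ?L if R: ?R
    unfolding limitin_def topspace_seminorm_topology[OF vs P]
  proof (intro conjI allI impI UNIV_I)
    fix U assume "openin (seminorm_topology P) U \<and> x \<in> U"
    then obtain p r where p: "p \<in> P" "0 < r" "{y. p (y - x) < r} \<subseteq> U"
      unfolding openin_seminorm_topology[OF vs P] by blast
    then have "\<forall>\<^sub>F n in F. p (f n - x) < r"
      using R order_tendstoD(2) by blast
    then show "\<forall>\<^sub>F n in F. f n \<in> U"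
      using p(3) by (auto elim: eventually_mono)
  qed
qed

lemma seminorm_SUP:
  assumes "A \<noteq> {}" "\<And>i. i \<in> A \<Longrightarrow> seminorm smul (q i)" "\<And>x. bdd_above ((\<lambda>i. q i x) ` A)"
  shows "seminorm smul (\<lambda>x. SUP i\<in>A. q i x)"
proof -
  note upper = cSUP_upper[OF _ assms(3)]
  obtain j where j: "j \<in> A" using assms(1) by blast
  have nonneg: "0 \<le> (SUP i\<in>A. q i x)" for x
    using upper[OF j, of x] seminorm_nonneg[OF assms(2)[OF j], of x] by linarith
  have le: "(SUP i\<in>A. q i (smul c x)) \<le> norm c * (SUP i\<in>A. q i x)" for c x
    using upper by (intro cSUP_least assms(1))
      (auto simp: seminorm_smul[OF assms(2)] intro!: mult_left_mono)
  show ?thesis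
    unfolding seminorm_def
  proof (intro conjI allI nonneg)
    show "(SUP i\<in>A. q i (x + y)) \<le> (SUP i\<in>A. q i x) + (SUP i\<in>A. q i y)" for x y
      using upper by (intro cSUP_least assms(1))
        (auto intro!: order_trans[OF seminorm_add_le[OF assms(2)]] add_mono)
    show "(SUP i\<in>A. q i (smul c x)) = norm c * (SUP i\<in>A. q i x)" for c x
    proof (cases "c = 0")
      case True
      then show ?thesis using le[of c x] nonneg[of "smul c x"] by simp
    next
      case False
      have "q i x \<le> (SUP i\<in>A. q i (smul c x)) / norm c" if "i \<in> A" for i
        using upper[OF that, of "smul c x"] False
        by (simp add: seminorm_smul[OF assms(2)[OF that]] field_simps)
      then have "(SUP i\<in>A. q i x) \<le> (SUP i\<in>A. q i (smul c x)) / norm c"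
        by (intro cSUP_least assms(1))
      then show ?thesis using False le[of c x] by (simp add: field_simps)
    qed
  qed
qed

text \<open>For a seminorm \<open>q\<close> and a directed system \<open>P\<close> this is
  continuity of \<open>q\<close> in \<open>seminorm_topology P\<close>; directedness is why one
  \<open>p\<close> suffices.\<close>

definition dominated :: "('a \<Rightarrow> real) set \<Rightarrow> ('a \<Rightarrow> real) \<Rightarrow> bool" where
  "dominated P q \<longleftrightarrow> (\<exists>p\<in>P. \<exists>K\<ge>0. \<forall>x. q x \<le> K * p x)"

lemma seminorm_le_of_ball:
  fixes smul :: "'k::real_or_complex \<Rightarrow> 'a::real_normed_vector \<Rightarrow> 'a"
  assumes ns: "normed_space_over smul" and p: "seminorm smul p" and q: "seminorm smul q"
    and r: "0 < r" and le: "\<And>x. p x < r \<Longrightarrow> q x \<le> c"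
  shows "q x \<le> c / r * p x"
proof (rule field_le_epsilon)
  have vs: "vector_space smul" using ns by (simp add: normed_space_over_def)
  have c: "0 \<le> c"
    using le[of 0] r seminorm_zero[OF vs p] seminorm_zero[OF vs q] by simp
  fix e :: real assume e: "0 < e"
  \<comment> \<open>Since \<open>p x\<close> may be \<open>0\<close>, the point is scaled by a
    number slightly larger than \<open>p x\<close>. The surplus \<open>e * r / (c + 1)\<close>
    contributes \<open>c / (c + 1) * e\<close>, hence at most \<open>e\<close>, to the final
    bound.\<close>
  define s where "s = p x + e * r / (c + 1)"
  have s: "p x < s" "0 < s"
    using e r c seminorm_nonneg[OF p, of x] by (auto simp: s_def add_nonneg_pos)
  have "p ((r / s) *\<^sub>R x) < r"
    using s r by (simp add: seminorm_scaleR[OF ns p] field_simps)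
  then have "q ((r / s) *\<^sub>R x) \<le> c" by (rule le)
  then have "q x \<le> c / r * s"
    using s r by (simp add: seminorm_scaleR[OF ns q] field_simps)
  also have "c / r * s = c / r * p x + c / (c + 1) * e"
    using r by (simp add: s_def field_simps)
  also have "\<dots> \<le> c / r * p x + 1 * e"
    using c e by (intro add_left_mono mult_right_mono) auto
  finally show "q x \<le> c / r * p x + e" by simp
qed

text \<open>The index set lets one pair \<open>p\<close>, \<open>K\<close> serve a whole family, as
  equicontinuity requires; a single seminorm is the case \<open>A = {()}\<close>.\<close>

lemma dominatedI_openin:
  fixes smul :: "'k::real_or_complex \<Rightarrow> 'a::real_normed_vector \<Rightarrow> 'a"
  assumes ns: "normed_space_over smul" and P: "directed_seminorms smul P"
    and q: "\<And>i. i \<in> A \<Longrightarrow> seminorm smul (q i)"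
    and U: "openin (seminorm_topology P) U" "0 \<in> U" "\<And>i x. i \<in> A \<Longrightarrow> x \<in> U \<Longrightarrow> q i x \<le> 1"
  shows "\<exists>p\<in>P. \<exists>K\<ge>0. \<forall>i\<in>A. \<forall>x. q i x \<le> K * p x"
proof -
  have vs: "vector_space smul" using ns by (simp add: normed_space_over_def)
  obtain p r where p: "p \<in> P" "0 < r" "{y. p (y - 0) < r} \<subseteq> U"
    using U(1,2) unfolding openin_seminorm_topology[OF vs P] by blast
  have sn: "seminorm smul p" using p(1) P by (auto simp: directed_seminorms_def)
  have "q i x \<le> 1 / r * p x" if "i \<in> A" for i x
    using p U(3) that by (intro seminorm_le_of_ball[OF ns sn q p(2)]) auto
  then show ?thesis
    using p by (intro bexI[OF _ p(1)] exI[of _ "1 / r"]) auto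
qed

section \<open>The mixed topology of a Saks space\<close>

text \<open>The maximality in \<open>is_mixed_topology\<close> ranges over linear topologies; local
  convexity of \<open>\<gamma>\<close> enters through \<open>generating\<close>, where
  \<open>Q\<close> is an arbitrary directed system. \<open>P\<close>, in contrast, is the fixed
  system whose supremum is the norm.\<close>

locale mixed_Saks_space =
  fixes smul :: "'k::real_or_complex \<Rightarrow> 'a::real_normed_vector \<Rightarrow> 'a"
    and \<tau> \<gamma> :: "'a topology" and P Q :: "('a \<Rightarrow> real) set"
  assumes Saks: "Saks_space smul P \<tau>"
    and mixed: "is_mixed_topology smul \<tau> \<gamma>"
    and generating: "generating_seminorms smul Q \<gamma>"
begin

lemma normed_space: "normed_space_over smul"
  using Saks by (simp add: Saks_space_def)

lemma smul_vector_space: "vector_space smul"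
  using normed_space by (simp add: normed_space_over_def)

lemma P_directed: "directed_seminorms smul P" and \<tau>_eq: "\<tau> = seminorm_topology P"
  using Saks by (auto simp: Saks_space_def generating_seminorms_def)

lemma Q_directed: "directed_seminorms smul Q" and \<gamma>_eq: "\<gamma> = seminorm_topology Q"
  using generating by (auto simp: generating_seminorms_def)

lemma P_seminorm: "p \<in> P \<Longrightarrow> seminorm smul p"
  using P_directed by (auto simp: directed_seminorms_def)

lemma Q_seminorm: "p \<in> Q \<Longrightarrow> seminorm smul p"
  using Q_directed by (auto simp: directed_seminorms_def)

lemma seminorm_norm: "seminorm smul norm"
  using normed_space by (auto simp: seminorm_def normed_space_over_def norm_triangle_ineq)

lemma P_le_norm: "p \<in> P \<Longrightarrow> p x \<le> norm x"
  using Saks unfolding Saks_space_def by (metis cSUP_upper)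

lemma norm_leI: "(\<And>p. p \<in> P \<Longrightarrow> p x \<le> c) \<Longrightarrow> norm x \<le> c"
  using Saks P_directed unfolding Saks_space_def directed_seminorms_def by (metis cSUP_least)

lemma candidate: "mixed_topology_candidate smul \<tau> \<gamma>"
  and finest: "mixed_topology_candidate smul \<tau> T \<Longrightarrow> coarser_topology T \<gamma>"
  using mixed by (auto simp: is_mixed_topology_def)

lemma coincide: "bounded B \<Longrightarrow> subtopology \<gamma> B = subtopology \<tau> B"
  and \<tau>_coarser: "openin \<tau> U \<Longrightarrow> openin \<gamma> U"
  and \<gamma>_coarser: "openin \<gamma> U \<Longrightarrow> open U"
  using candidate by (auto simp: mixed_topology_candidate_def coarser_topology_def)

lemma topspace_\<gamma>: "topspace \<gamma> = UNIV"
  unfolding \<gamma>_eq by (rule topspace_seminorm_topology[OF smul_vector_space Q_directed])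

lemma Hausdorff_lcs_\<gamma>: "Hausdorff_lcs smul \<gamma>"
proof -
  have "Hausdorff_space \<tau>"
    using Saks by (simp add: Saks_space_def Hausdorff_lcs_def)
  then have "Hausdorff_space \<gamma>"
    using \<tau>_coarser topspace_seminorm_topology[OF smul_vector_space P_directed]
    unfolding Hausdorff_space_def topspace_\<gamma> \<tau>_eq by (metis UNIV_I)
  then show ?thesis using smul_vector_space generating by (auto simp: Hausdorff_lcs_def)
qed

lemma directed_seminorms_add:
  assumes q: "seminorm smul q"
  shows "directed_seminorms smul {\<lambda>x. p x + q x | p. p \<in> P}"
  unfolding directed_seminorms_def
proof (intro conjI ballI)
  let ?P = "{\<lambda>x. p x + q x | p. p \<in> P}"
  show "?P \<noteq> {}" using P_directed by (auto simp: directed_seminorms_def)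
  show "seminorm smul s" if "s \<in> ?P" for s
  proof -
    obtain p where p: "seminorm smul p" "s = (\<lambda>x. p x + q x)"
      using \<open>s \<in> ?P\<close> P_seminorm by auto
    show ?thesis
      unfolding seminorm_def
    proof (intro conjI allI)
      show "0 \<le> s x" for x
        using seminorm_nonneg[OF p(1)] seminorm_nonneg[OF q] by (simp add: p(2))
      show "s (x + y) \<le> s x + s y" for x y
        using seminorm_add_le[OF p(1), of x y] seminorm_add_le[OF q, of x y] by (simp add: p(2))
      show "s (smul c x) = norm c * s x" for c x
        by (simp add: p(2) seminorm_smul[OF p(1)] seminorm_smul[OF q] distrib_left)
    qed
  qed
  fix s1 s2 assume "s1 \<in> ?P" "s2 \<in> ?P"
  then obtain p1 p2 where p: "p1 \<in> P" "p2 \<in> P" "s1 = (\<lambda>x. p1 x + q x)" "s2 = (\<lambda>x. p2 x + q x)"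
    by auto
  then obtain r C where r: "r \<in> P" "0 \<le> C" "\<And>x. max (p1 x) (p2 x) \<le> C * r x"
    using P_directed unfolding directed_seminorms_def by metis
  have "max (s1 x) (s2 x) \<le> (C + 1) * (r x + q x)" for x
  proof -
    have "max (s1 x) (s2 x) = max (p1 x) (p2 x) + q x" by (simp add: p max_def)
    moreover have "0 \<le> r x" "0 \<le> C * q x"
      using r seminorm_nonneg[OF P_seminorm[OF r(1)], of x] seminorm_nonneg[OF q, of x] by auto
    ultimately show ?thesis using r(3)[of x] by (simp add: algebra_simps)
  qed
  then show "\<exists>r\<in>?P. \<exists>C\<ge>0. \<forall>x. max (s1 x) (s2 x) \<le> C * r x"
    using r by (intro bexI[of _ "\<lambda>x. r x + q x"] exI[of _ "C + 1"]) auto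
qed

text \<open>
  The topology generated by \<open>\<tau>\<close> and \<open>q\<close> is a competitor in the definition of the mixed topology,
  hence coarser than \<open>\<gamma>\<close>.
\<close>

lemma dominatedI_unit_ball:
  assumes q: "seminorm smul q"
    and small: "\<And>e. 0 < e \<Longrightarrow> \<exists>p\<in>P. \<exists>d>0. \<forall>x. norm x \<le> 1 \<longrightarrow> p x < d \<longrightarrow> q x \<le> e"
  shows "dominated Q q"
proof -
  let ?P = "{\<lambda>x. p x + q x | p. p \<in> P}"
  let ?T = "seminorm_topology ?P"
  note P' = directed_seminorms_add[OF q]
  have open_T: "openin ?T U \<longleftrightarrow> (\<forall>x\<in>U. \<exists>p\<in>P. \<exists>r>0. {y. p (y - x) + q (y - x) < r} \<subseteq> U)" for U
    unfolding openin_seminorm_topology[OF smul_vector_space P'] bex_simps(8)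
    by (simp add: setcompr_eq_image)
  have \<tau>_T: "openin ?T U" if U: "openin \<tau> U" for U
    unfolding open_T
  proof
    fix x assume "x \<in> U"
    then obtain p r where p: "p \<in> P" "0 < r" "{y. p (y - x) < r} \<subseteq> U"
      using U unfolding \<tau>_eq openin_seminorm_topology[OF smul_vector_space P_directed] by blast
    have "{y. p (y - x) + q (y - x) < r} \<subseteq> {y. p (y - x) < r}"
      using seminorm_nonneg[OF q] by (smt (verit) Collect_mono)
    then show "\<exists>p\<in>P. \<exists>r>0. {y. p (y - x) + q (y - x) < r} \<subseteq> U"
      using p by (meson order_trans)
  qed
  \<comment> \<open>The case \<open>e = 1\<close> already bounds \<open>q\<close> by a multiple of
    the norm, because \<open>p0\<close> is below the norm. This puts the competitor below the norm
    topology.\<close>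
  have "\<exists>p\<in>P. \<exists>d>0. \<forall>x. norm x \<le> 1 \<longrightarrow> p x < d \<longrightarrow> q x \<le> 1"
    using small by simp
  then obtain p0 d0 where p0: "p0 \<in> P" "0 < d0" "\<And>x. norm x \<le> 1 \<Longrightarrow> p0 x < d0 \<Longrightarrow> q x \<le> 1"
    by auto
  have q_norm: "q x \<le> 1 / min 1 d0 * norm x" for x
  proof (rule seminorm_le_of_ball[OF normed_space seminorm_norm q])
    show "q x \<le> 1" if "norm x < min 1 d0" for x
      using that p0 P_le_norm[OF p0(1), of x] by auto
  qed (use p0 in auto)
  have open_norm: "open U" if U: "openin ?T U" for U
    unfolding open_dist
  proof
    fix x assume "x \<in> U"
    then obtain p r where p: "p \<in> P" "0 < r" "{y. p (y - x) + q (y - x) < r} \<subseteq> U"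
      using U unfolding open_T by blast
    let ?K = "1 + 1 / min 1 d0"
    have K: "0 < ?K" using p0 by (simp add: add_pos_nonneg)
    have "y \<in> U" if "dist y x < r / ?K" for y
    proof -
      have "p (y - x) + q (y - x) \<le> ?K * norm (y - x)"
        using P_le_norm[OF p(1), of "y - x"] q_norm[of "y - x"] by (simp add: algebra_simps)
      also have "\<dots> < r" using that K by (simp add: dist_norm pos_less_divide_eq mult.commute)
      finally show ?thesis using p by auto
    qed
    then show "\<exists>e>0. \<forall>y. dist y x < e \<longrightarrow> y \<in> U"
      using p K by (intro exI[of _ "r / ?K"]) auto
  qed
  have "subtopology ?T B = subtopology \<tau> B" if B: "bounded B" for B
    unfolding topology_eq
  proof (intro allI iffI)
    fix V
    show "openin (subtopology ?T B) V" if "openin (subtopology \<tau> B) V"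
      using that \<tau>_T unfolding openin_subtopology by blast
    assume "openin (subtopology ?T B) V"
    then obtain U where U: "openin ?T U" "V = U \<inter> B"
      unfolding openin_subtopology by blast
    show "openin (subtopology \<tau> B) V"
    proof (subst openin_subopen, intro ballI)
      fix x assume x: "x \<in> V"
      then obtain p r where p: "p \<in> P" "0 < r" "{y. p (y - x) + q (y - x) < r} \<subseteq> U"
        using U unfolding open_T by blast
      \<comment> \<open>Smallness is known in the unit ball around \<open>0\<close> but needed on
        \<open>B\<close> around \<open>x\<close>. Dividing \<open>y - x\<close> by \<open>R\<close>
        moves it into the unit ball; scaled back, the bound \<open>r / (4 * R)\<close> becomes
        \<open>r / 4\<close>, and together with the \<open>r / 2\<close> allowed to \<open>p\<close>
        it stays below \<open>r\<close>.\<close>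
      obtain R where R: "0 < R" "\<And>y. y \<in> B \<Longrightarrow> norm (y - x) \<le> R"
      proof -
        obtain b where "0 < b" "\<And>y. y \<in> B \<Longrightarrow> norm y \<le> b" using B bounded_pos by metis
        then show ?thesis
          using that[of "b + norm x"] norm_triangle_ineq4[of _ x]
          by (meson add_mono_thms_linordered_semiring(3) add_pos_nonneg norm_ge_zero order_trans)
      qed
      have "\<exists>p\<in>P. \<exists>d>0. \<forall>x. norm x \<le> 1 \<longrightarrow> p x < d \<longrightarrow> q x \<le> r / (4 * R)"
        using small R p by simp
      then obtain p' d where p': "p' \<in> P" "0 < d"
        "\<And>x. norm x \<le> 1 \<Longrightarrow> p' x < d \<Longrightarrow> q x \<le> r / (4 * R)"
        by auto
      let ?W = "{y. p (y - x) < r / 2} \<inter> {y. p' (y - x) < R * d}"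
      have "openin \<tau> ?W"
        unfolding \<tau>_eq using p p' R by (intro openin_Int openin_seminorm_ball) auto
      moreover have "x \<in> ?W"
        using p p' R seminorm_zero[OF smul_vector_space P_seminorm[OF p(1)]] seminorm_zero[OF smul_vector_space P_seminorm[OF p'(1)]]
        by auto
      moreover have "?W \<inter> B \<subseteq> V"
      proof
        fix y assume y: "y \<in> ?W \<inter> B"
        have "q ((1 / R) *\<^sub>R (y - x)) \<le> r / (4 * R)"
        proof (rule p'(3))
          show "norm ((1 / R) *\<^sub>R (y - x)) \<le> 1"
            using R y by simp
          show "p' ((1 / R) *\<^sub>R (y - x)) < d"
            using R y unfolding seminorm_scaleR[OF normed_space P_seminorm[OF p'(1)]] by (simp add: field_simps)
        qed
        then have "q (y - x) \<le> r / 4"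
          using R unfolding seminorm_scaleR[OF normed_space q] by (simp add: field_simps)
        then show "y \<in> V" using p y U by auto
      qed
      ultimately show "\<exists>T. openin (subtopology \<tau> B) T \<and> x \<in> T \<and> T \<subseteq> V"
        using x U by (intro exI[of _ "?W \<inter> B"]) (auto simp: openin_subtopology)
    qed
  qed
  then have "mixed_topology_candidate smul \<tau> ?T"
    using linear_topology_seminorm_topology[OF smul_vector_space P'] \<tau>_T open_norm
    by (auto simp: mixed_topology_candidate_def coarser_topology_def)
  then have T_\<gamma>: "openin \<gamma> U" if "openin ?T U" for U
    using finest that by (auto simp: coarser_topology_def)
  obtain p where p: "p \<in> P" using P_directed by (auto simp: directed_seminorms_def)
  let ?U = "{y. p (y - 0) + q (y - 0) < 1}"
  have "openin ?T ?U"
    using p by (intro openin_seminorm_ball[where p = "\<lambda>x. p x + q x"]) auto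
  moreover have "0 \<in> ?U"
    using seminorm_zero[OF smul_vector_space q] seminorm_zero[OF smul_vector_space P_seminorm[OF p]] by simp
  moreover have "q x \<le> 1" if "x \<in> ?U" for x
    using that seminorm_nonneg[OF P_seminorm[OF p], of x] by simp
  ultimately have "\<exists>p\<in>Q. \<exists>K\<ge>0. \<forall>i\<in>{()}. \<forall>x. q x \<le> K * p x"
    using T_\<gamma>[unfolded \<gamma>_eq] by (intro dominatedI_openin[OF normed_space Q_directed q, where U = ?U]) auto
  then show ?thesis by (simp add: dominated_def)
qed

text \<open>The counterpart of \<open>dominatedI_unit_ball\<close>: \<open>\<gamma>\<close> and
  \<open>\<tau>\<close> induce the same topology on a ball, so a \<open>\<tau>\<close>-neighbourhood
  of \<open>0\<close> makes \<open>s\<close> small there.\<close>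

lemma Q_small_on_bounded:
  assumes s: "s \<in> Q" and e: "0 < e"
  shows "\<exists>p\<in>P. \<exists>d>0. \<forall>x. norm x \<le> R \<longrightarrow> p x < d \<longrightarrow> s x < e"
proof -
  \<comment> \<open>The maximum keeps \<open>0\<close> in the ball when \<open>R\<close> is
    negative.\<close>
  let ?B = "cball 0 (max R 0) :: 'a set" and ?U = "{x. s (x - 0) < e}"
  have "openin (subtopology \<gamma> ?B) (?U \<inter> ?B)"
    unfolding \<gamma>_eq using openin_seminorm_ball[OF s e] openin_subtopology by blast
  then obtain W where W: "openin \<tau> W" "?U \<inter> ?B = W \<inter> ?B"
    unfolding coincide[OF bounded_cball] openin_subtopology by blast
  moreover have "0 \<in> ?U \<inter> ?B"
    using e seminorm_zero[OF smul_vector_space Q_seminorm[OF s]] by simp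
  ultimately obtain p d where p: "p \<in> P" "0 < d" "{y. p (y - 0) < d} \<subseteq> W"
    unfolding \<tau>_eq openin_seminorm_topology[OF smul_vector_space P_directed] by (metis IntD1)
  have "s x < e" if "norm x \<le> R" "p x < d" for x
  proof -
    have "x \<in> W \<inter> ?B" using that p(3) by auto
    then have "x \<in> ?U" using W(2) by blast
    then show ?thesis by simp
  qed
  then show ?thesis using p by blast
qed

lemma Q_le_norm:
  assumes s: "s \<in> Q"
  shows "\<exists>K\<ge>0. \<forall>x. s x \<le> K * norm x"
proof -
  have "open {x. s (x - 0) < 1}"
    using openin_seminorm_ball[OF s, of 1 0] \<gamma>_coarser by (simp add: \<gamma>_eq)
  moreover have "0 \<in> {x. s (x - 0) < 1}"
    using seminorm_zero[OF smul_vector_space Q_seminorm[OF s]] by simp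
  ultimately obtain r where r: "0 < r" "ball 0 r \<subseteq> {x. s (x - 0) < 1}"
    using open_contains_ball by blast
  have "s x \<le> 1 / r * norm x" for x
  proof (rule seminorm_le_of_ball[OF normed_space seminorm_norm Q_seminorm[OF s] r(1)])
    show "s x \<le> 1" if "norm x < r" for x
      using that r(2) by (force simp: subset_iff)
  qed
  then show ?thesis using r by (intro exI[of _ "1 / r"]) auto
qed

lemma P_dominated:
  assumes "p \<in> P"
  shows "dominated Q p"
  using assms by (intro dominatedI_unit_ball[OF P_seminorm[OF assms]]) (auto intro: less_imp_le)

section \<open>Submixed seminorms and bounded sets\<close>

lemma submixed_bdd_above:
  fixes a :: "nat \<Rightarrow> real"
  assumes p: "\<And>n. p n \<in> P" and a: "\<And>n. 0 \<le> a n" "a \<longlonglongrightarrow> 0"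
  shows "bdd_above (range (\<lambda>n. p n x * a n))"
proof -
  obtain A where A: "\<And>n. \<bar>a n\<bar> \<le> A"
    using convergent_imp_Bseq[OF convergentI[OF a(2)]] unfolding Bseq_def by auto
  have "p n x * a n \<le> norm x * A" for n
    using P_le_norm[OF p] A[of n] a(1)[of n] by (intro mult_mono) auto
  then show ?thesis by (rule bdd_aboveI2)
qed

lemma finitely_many_P_dominated:
  fixes a :: "nat \<Rightarrow> real"
  assumes p: "\<And>n. p n \<in> P" and a: "\<And>n. 0 \<le> a n"
  shows "\<exists>r\<in>P. \<exists>C\<ge>0. \<forall>n<N. \<forall>x. p n x * a n \<le> C * r x"
proof (induction N)
  case 0
  then show ?case using p by auto
next
  case (Suc N)
  then obtain r C where r: "r \<in> P" "0 \<le> C" "\<And>n x. n < N \<Longrightarrow> p n x * a n \<le> C * r x"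
    by blast
  then obtain r' C' where r': "r' \<in> P" "0 \<le> C'" "\<And>x. max (r x) (p N x) \<le> C' * r' x"
    using P_directed p[of N] unfolding directed_seminorms_def by metis
  have "p n x * a n \<le> (C + a N) * C' * r' x" if "n < Suc N" for n x
  proof -
    have nonneg: "0 \<le> C' * r' x" "r x \<le> C' * r' x" "p N x \<le> C' * r' x"
      using r'(3)[of x] r'(2) seminorm_nonneg[OF P_seminorm[OF r'(1)], of x] by auto
    then have 1: "C * r x \<le> C * (C' * r' x)" and 2: "p N x * a N \<le> a N * (C' * r' x)"
      using r(2) a[of N] by (auto intro: mult_left_mono mult_right_mono simp: mult.commute[of "a N"])
    have 3: "0 \<le> C * (C' * r' x)" "0 \<le> a N * (C' * r' x)"
      using r(2) a[of N] nonneg(1) by simp_all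
    show ?thesis
    proof (cases "n = N")
      case True
      then show ?thesis using 2 3 by (simp add: algebra_simps)
    next
      case False
      then show ?thesis using that r(3)[of n x] 1 3 by (simp add: algebra_simps)
    qed
  qed
  then show ?case
    using r r' a[of N] by (intro bexI[OF _ r'(1)] exI[of _ "(C + a N) * C'"]) auto
qed

text \<open>The supremum is split where \<open>a n\<close> drops below \<open>e\<close>: the tail is
  at most \<open>e * norm x\<close> because each \<open>p n\<close> is below the norm, and the
  finitely many remaining terms are absorbed by one seminorm of the directed system. The shape of
  the bound is that of equitightness.\<close>

lemma submixed_le:
  fixes a :: "nat \<Rightarrow> real"
  assumes p: "\<And>n. p n \<in> P" and a: "\<And>n. 0 \<le> a n" "a \<longlonglongrightarrow> 0" and e: "0 < e"
  shows "\<exists>r\<in>P. \<exists>C\<ge>0. \<forall>x. (SUP n. p n x * a n) \<le> C * r x + e * norm x"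
proof -
  obtain N where N: "\<And>n. N \<le> n \<Longrightarrow> a n < e"
    using order_tendstoD(2)[OF a(2) e] by (auto simp: eventually_sequentially)
  obtain r C where r: "r \<in> P" "0 \<le> C" "\<And>n x. n < N \<Longrightarrow> p n x * a n \<le> C * r x"
    using finitely_many_P_dominated[where p = p and a = a and N = N, OF p a(1)] by blast
  have "(SUP n. p n x * a n) \<le> C * r x + e * norm x" for x
  proof (rule cSUP_least)
    fix n
    have nonneg: "0 \<le> C * r x" "0 \<le> e * norm x"
      using r seminorm_nonneg[OF P_seminorm[OF r(1)], of x] e by simp_all
    show "p n x * a n \<le> C * r x + e * norm x"
    proof (cases "n < N")
      case True
      then show ?thesis using r(3)[OF True, of x] nonneg by linarith
    next
      case False
      then have "p n x * a n \<le> norm x * e"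
        using P_le_norm[OF p] N[of n] a(1) by (intro mult_mono) (auto simp: less_imp_le)
      then show ?thesis using nonneg by (simp add: mult.commute)
    qed
  qed simp
  then show ?thesis using r by blast
qed

lemma submixed_seminorm:
  fixes a :: "nat \<Rightarrow> real"
  assumes p: "\<And>n. p n \<in> P" and a: "\<And>n. 0 \<le> a n" "a \<longlonglongrightarrow> 0"
  shows "seminorm smul (\<lambda>x. SUP n. p n x * a n)"
proof (rule seminorm_SUP)
  show "seminorm smul (\<lambda>x. p n x * a n)" for n
    using P_seminorm[OF p[of n]] a(1)[of n] unfolding seminorm_def
    by (auto simp: distrib_right[symmetric] intro: mult_right_mono)
qed (use submixed_bdd_above[where p = p, OF p a] in auto)

text \<open>On the unit ball the norm term of \<open>submixed_le\<close> is at most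
  \<open>e / 2\<close>, so the criterion \<open>dominatedI_unit_ball\<close> applies. These
  seminorms later test whether a set is norm bounded.\<close>

lemma submixed_dominated:
  fixes a :: "nat \<Rightarrow> real"
  assumes p: "\<And>n. p n \<in> P" and a: "\<And>n. 0 \<le> a n" "a \<longlonglongrightarrow> 0"
  shows "dominated Q (\<lambda>x. SUP n. p n x * a n)"
proof (rule dominatedI_unit_ball[OF submixed_seminorm[where p = p, OF p a]])
  fix e :: real assume e: "0 < e"
  then obtain r C where r: "r \<in> P" "0 \<le> C"
    "\<And>x. (SUP n. p n x * a n) \<le> C * r x + e / 2 * norm x"
    using submixed_le[where p = p and a = a and e = "e / 2", OF p a] by (meson half_gt_zero)
  have "(SUP n. p n x * a n) \<le> e" if x: "norm x \<le> 1" "r x < e / (2 * (C + 1))" for x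
  proof -
    have "C * r x \<le> (C + 1) * r x"
      using seminorm_nonneg[OF P_seminorm[OF r(1)]] by (simp add: algebra_simps)
    also have "\<dots> \<le> e / 2"
      using x(2) r(2) by (simp add: field_simps)
    finally have "C * r x \<le> e / 2" .
    moreover have "e / 2 * norm x \<le> e / 2"
      using x(1) e by simp
    ultimately show ?thesis using r(3)[of x] by linarith
  qed
  then show "\<exists>p'\<in>P. \<exists>d>0. \<forall>x. norm x \<le> 1 \<longrightarrow> p' x < d \<longrightarrow> (SUP n. p n x * a n) \<le> e"
    using r e by (intro bexI[OF _ r(1)] exI[of _ "e / (2 * (C + 1))"]) auto
qed

text \<open>
  Points \<open>x\<^sub>n\<close> of norm larger than \<open>n\<^sup>2\<close> are detected by seminorms \<open>p\<^sub>n\<close>; then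
  \<open>sup\<^sub>n p\<^sub>n / n\<close> is \<open>\<gamma>\<close>-continuous and unbounded on the sequence.
\<close>

lemma Q_bounded_imp_bounded:
  assumes B: "\<And>s. s \<in> Q \<Longrightarrow> bdd_above (s ` B)"
  shows "bounded B"
proof (rule ccontr)
  assume "\<not> bounded B"
  then have "\<exists>x\<in>B. (real (Suc n))\<^sup>2 < norm x" for n
    unfolding bounded_iff by (meson not_le)
  then obtain x where x: "\<And>n. x n \<in> B" "\<And>n. (real (Suc n))\<^sup>2 < norm (x n)"
    by metis
  \<comment> \<open>Here the norm has to be the supremum of \<open>P\<close>, not just an upper
    bound: a large norm is then witnessed by a single seminorm.\<close>
  have "\<exists>p\<in>P. (real (Suc n))\<^sup>2 < p (x n)" for n
    using x(2)[of n] norm_leI[of "x n" "(real (Suc n))\<^sup>2"] by (meson not_le)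
  then obtain p where p: "\<And>n. p n \<in> P" "\<And>n. (real (Suc n))\<^sup>2 < p n (x n)"
    by metis
  define a where "a n = inverse (real (Suc n))" for n
  have a: "\<And>n. 0 \<le> a n" "a \<longlonglongrightarrow> 0"
    unfolding a_def using LIMSEQ_inverse_real_of_nat by auto
  obtain s K where s: "s \<in> Q" "0 \<le> K" "\<And>x. (SUP n. p n x * a n) \<le> K * s x"
    using submixed_dominated[where p = p, OF p(1) a] unfolding dominated_def by blast
  obtain b where b: "\<And>x. x \<in> B \<Longrightarrow> s x \<le> b"
    using B[OF s(1)] by (auto simp: bdd_above_def)
  have "real (Suc n) < K * b" for n
  proof -
    have "real (Suc n) < p n (x n) * a n"
      using p(2)[of n] by (simp add: a_def field_simps power2_eq_square)
    also have "\<dots> \<le> (SUP m. p m (x n) * a m)"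
      by (rule cSUP_upper[OF UNIV_I submixed_bdd_above[where p = p, OF p(1) a]])
    also have "\<dots> \<le> K * s (x n)" by (rule s(3))
    also have "\<dots> \<le> K * b" using b[OF x(1)] s(2) by (rule mult_left_mono)
    finally show ?thesis .
  qed
  moreover obtain n where "K * b < real n" using reals_Archimedean2 by blast
  ultimately show False by (metis less_trans lessI not_less_iff_gr_or_eq of_nat_less_iff)
qed

section \<open>Convergence and continuity with respect to \<gamma>\<close>

lemma limitin_\<gamma>_iff:
  "limitin \<gamma> xs x sequentially \<longleftrightarrow> bounded (range xs) \<and> limitin \<tau> xs x sequentially"
proof
  assume L: "limitin \<gamma> xs x sequentially"
  have "limitin \<tau> xs x sequentially"
    using L \<tau>_coarser topspace_seminorm_topology[OF smul_vector_space P_directed] by (auto simp: limitin_def \<tau>_eq)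
  moreover have "bounded (range xs)"
  proof (rule Q_bounded_imp_bounded)
    fix s assume s: "s \<in> Q"
    then have "(\<lambda>n. s (xs n - x)) \<longlonglongrightarrow> 0"
      using L unfolding \<gamma>_eq limitin_seminorm_topology[OF smul_vector_space Q_directed] by blast
    then have "Bseq (\<lambda>n. s (xs n - x))"
      by (rule convergent_imp_Bseq[OF convergentI])
    then obtain b where b: "\<And>n. \<bar>s (xs n - x)\<bar> \<le> b"
      by (auto simp: Bseq_def)
    have "s (xs n) \<le> b + s x" for n
      using b[of n] seminorm_add_le[OF Q_seminorm[OF s], of "xs n - x" x, unfolded diff_add_cancel]
      by linarith
    then show "bdd_above (s ` range xs)"
      unfolding image_image by (rule bdd_aboveI2)
  qed
  ultimately show "bounded (range xs) \<and> limitin \<tau> xs x sequentially" by blast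
next
  assume *: "bounded (range xs) \<and> limitin \<tau> xs x sequentially"
  then obtain b where b: "\<And>n. norm (xs n) \<le> b"
    by (auto simp: bounded_iff)
  \<comment> \<open>\<open>Q_small_on_bounded\<close> is about neighbourhoods of \<open>0\<close>,
    so the differences \<open>xs n - x\<close> have to stay in a fixed ball.\<close>
  have R: "norm (xs n - x) \<le> b + norm x" for n
    using b[of n] norm_triangle_ineq4[of "xs n" x] by linarith
  show "limitin \<gamma> xs x sequentially"
    unfolding \<gamma>_eq limitin_seminorm_topology[OF smul_vector_space Q_directed]
  proof (intro ballI tendstoI)
    fix s and e :: real assume s: "s \<in> Q" "0 < e"
    then obtain p d where p: "p \<in> P" "0 < d" "\<And>y. norm y \<le> b + norm x \<Longrightarrow> p y < d \<Longrightarrow> s y < e"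
      using Q_small_on_bounded by meson
    then have "\<forall>\<^sub>F n in sequentially. p (xs n - x) < d"
      using * order_tendstoD(2) unfolding \<tau>_eq limitin_seminorm_topology[OF smul_vector_space P_directed] by blast
    then show "\<forall>\<^sub>F n in sequentially. dist (s (xs n - x)) 0 < e"
      using p(3)[OF R] seminorm_nonneg[OF Q_seminorm[OF s(1)]] by (auto elim!: eventually_mono)
  qed
qed

text \<open>Continuity depends only on the topology induced on the image, and on a bounded image
  \<open>\<gamma>\<close> and \<open>\<tau>\<close> agree.\<close>

lemma continuous_map_\<gamma>I:
  assumes "continuous_map J \<tau> f" "bounded (f ` topspace J)"
  shows "continuous_map J \<gamma> f"
proof -
  have "continuous_map J (subtopology \<tau> (f ` topspace J)) f"
    using assms(1) by (simp add: continuous_map_in_subtopology)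
  then show ?thesis
    by (simp add: continuous_map_in_subtopology flip: coincide[OF assms(2)])
qed

lemma continuous_map_\<gamma>_imp_\<tau>:
  "continuous_map J \<gamma> f \<Longrightarrow> continuous_map J \<tau> f"
  using \<tau>_coarser topspace_seminorm_topology[OF smul_vector_space P_directed] unfolding continuous_map \<tau>_eq by auto

text \<open>C-sequentiality is applied to \<open>{x. q x < 1}\<close>, a convex set; it is
  sequentially open because \<open>q (xs n)\<close> exceeds \<open>q x\<close> by at most the null
  sequence \<open>q (xs n - x)\<close>.\<close>

lemma dominatedI_C_sequential:
  assumes C: "C_sequential \<gamma>" and q: "seminorm smul q"
    and null: "\<And>xs. limitin \<gamma> xs 0 sequentially \<Longrightarrow> (\<lambda>n. q (xs n)) \<longlonglongrightarrow> 0"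
  shows "dominated Q q"
proof -
  let ?U = "{x. q x < 1}"
  have "convex ?U"
    unfolding convex_def
  proof (intro ballI allI impI)
    fix x y and u v :: real
    assume *: "x \<in> ?U" "y \<in> ?U" "0 \<le> u" "0 \<le> v" "u + v = 1"
    have "q (u *\<^sub>R x + v *\<^sub>R y) \<le> u * q x + v * q y"
      using seminorm_add_le[OF q, of "u *\<^sub>R x" "v *\<^sub>R y"] *
      by (simp add: seminorm_scaleR[OF normed_space q])
    also have "\<dots> < 1"
      using * by (intro convex_bound_lt) auto
    finally show "u *\<^sub>R x + v *\<^sub>R y \<in> ?U" by simp
  qed
  moreover have "sequentially_openin \<gamma> ?U"
    unfolding sequentially_openin_def topspace_\<gamma>
  proof (intro conjI allI impI subset_UNIV)
    fix xs x assume *: "x \<in> ?U \<and> limitin \<gamma> xs x sequentially"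
    then have "limitin \<gamma> (\<lambda>n. xs n - x) 0 sequentially"
      unfolding \<gamma>_eq limitin_seminorm_topology[OF smul_vector_space Q_directed] by simp
    then have "\<forall>\<^sub>F n in sequentially. q (xs n - x) < 1 - q x"
      using null * by (intro order_tendstoD(2)) auto
    then show "\<forall>\<^sub>F n in sequentially. xs n \<in> ?U"
    proof eventually_elim
      case (elim n)
      then show ?case using seminorm_add_le[OF q, of "xs n - x" x] by simp
    qed
  qed
  ultimately have "openin \<gamma> ?U" using C by (simp add: C_sequential_def)
  then have "\<exists>p\<in>Q. \<exists>K\<ge>0. \<forall>i\<in>{()}. \<forall>x. q x \<le> K * p x"
    using seminorm_zero[OF smul_vector_space q]
    by (intro dominatedI_openin[OF normed_space Q_directed q, where U = ?U]) (auto simp: \<gamma>_eq)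
  then show ?thesis by (simp add: dominated_def)
qed

section \<open>Equicontinuity as continuity of one seminorm\<close>

lemma seminorm_comp_linear:
  assumes "seminorm smul s" "Vector_Spaces.linear smul smul T"
  shows "seminorm smul (\<lambda>x. s (T x))"
  using assms by (simp add: seminorm_def Vector_Spaces.linear_iff)

text \<open>A bound on the supremum seminorm is a bound uniform in \<open>t\<close>, so each
  criterion for \<open>dominated\<close> becomes one for equicontinuity. The empty family is treated
  apart because a supremum over it carries no information.\<close>

lemma equicontinuous_familyI_SUP:
  assumes lin: "\<And>t. t \<in> J \<Longrightarrow> Vector_Spaces.linear smul smul (R t)"
    and bdd: "\<And>s x. s \<in> Q \<Longrightarrow> bdd_above ((\<lambda>t. s (R t x)) ` J)"
    and dom: "\<And>s. s \<in> Q \<Longrightarrow> J \<noteq> {} \<Longrightarrow> seminorm smul (\<lambda>x. SUP t\<in>J. s (R t x)) \<Longrightarrow>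
      dominated Q (\<lambda>x. SUP t\<in>J. s (R t x))"
  shows "equicontinuous_family Q J R"
  unfolding equicontinuous_family_def
proof
  fix s assume s: "s \<in> Q"
  show "\<exists>q\<in>Q. \<exists>K\<ge>0. \<forall>t\<in>J. \<forall>x. s (R t x) \<le> K * q x"
  proof (cases "J = {}")
    case True
    then show ?thesis using s by auto
  next
    case False
    have "seminorm smul (\<lambda>x. SUP t\<in>J. s (R t x))"
      using seminorm_SUP[OF False, of smul "\<lambda>t x. s (R t x)"] bdd[OF s]
        seminorm_comp_linear[OF Q_seminorm[OF s] lin] by blast
    then obtain q K where q: "q \<in> Q" "0 \<le> K" "\<And>x. (SUP t\<in>J. s (R t x)) \<le> K * q x"
      using dom[OF s False] unfolding dominated_def by blast
    have "s (R t x) \<le> K * q x" if "t \<in> J" for t x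
      using cSUP_upper[OF that bdd[OF s], of x] q(3)[of x] by linarith
    then show ?thesis using q by blast
  qed
qed

end

section \<open>Weighted families of operators\<close>

lemma locally_bounded_away_from_zeroE:
  fixes k :: "'i \<Rightarrow> real"
  assumes "locally_bounded_away_from_zero I k" "compactin I M" "\<And>t. t \<in> topspace I \<Longrightarrow> 0 \<le> k t"
  obtains c where "0 < c" "\<And>t. t \<in> M \<Longrightarrow> c \<le> k t"
proof (cases "M = {}")
  case True
  then show ?thesis using that[of 1] by simp
next
  case False
  have "bdd_below (k ` M)"
    using assms(3) compactin_subset_topspace[OF assms(2)] by (intro bdd_belowI2[of _ 0]) auto
  then have "(INF t\<in>M. k t) \<le> k t" if "t \<in> M" for t
    using that by (rule cINF_lower)
  then show ?thesis
    using that[of "INF t\<in>M. k t"] False assms(1,2) by (simp add: locally_bounded_away_from_zero_def)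
qed

text \<open>Continuity is local, and every point has an open neighbourhood inside a compact set. For
  locally compact \<open>I\<close> this plays the role that the defining property of a
  \<open>k_lcs_space\<close> plays in (i).\<close>

lemma continuous_map_locally_compact:
  assumes I: "locally_compact_space I"
    and f: "\<And>M. compactin I M \<Longrightarrow> continuous_map (subtopology I M) X f"
  shows "continuous_map I X f"
  unfolding continuous_map
proof (intro conjI allI impI)
  have nbhd: "\<exists>U K. openin I U \<and> compactin I K \<and> t \<in> U \<and> U \<subseteq> K" if "t \<in> topspace I" for t
    using I that by (auto simp: locally_compact_space_def)
  show "f ` topspace I \<subseteq> topspace X"
  proof
    fix y assume "y \<in> f ` topspace I"
    then obtain t where t: "t \<in> topspace I" "y = f t" by blast
    then have "continuous_map (subtopology I {t}) X f" by (intro f) simp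
    then show "y \<in> topspace X"
      using t by (auto simp: continuous_map_def)
  qed
  fix V assume V: "openin X V"
  show "openin I {t \<in> topspace I. f t \<in> V}"
  proof (subst openin_subopen, intro ballI)
    fix t assume t: "t \<in> {t \<in> topspace I. f t \<in> V}"
    then obtain U K where U: "openin I U" "compactin I K" "t \<in> U" "U \<subseteq> K"
      using nbhd by blast
    have "openin (subtopology I K) {t \<in> topspace (subtopology I K). f t \<in> V}"
      using f[OF U(2)] V by (rule openin_continuous_map_preimage)
    then obtain W where W: "openin I W" "{t \<in> topspace (subtopology I K). f t \<in> V} = W \<inter> K"
      unfolding openin_subtopology by blast
    \<comment> \<open>\<open>W\<close> matches the preimage only inside \<open>K\<close>;
      intersecting with \<open>U\<close>, which is open in \<open>I\<close> and contained in
      \<open>K\<close>, gives a genuine neighbourhood in \<open>I\<close>.\<close>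
    have "openin I (W \<inter> U)" using W U by blast
    moreover have "t \<in> W \<inter> U" "W \<inter> U \<subseteq> {t \<in> topspace I. f t \<in> V}"
      using W(2) U t by auto
    ultimately show "\<exists>T. openin I T \<and> t \<in> T \<and> T \<subseteq> {t \<in> topspace I. f t \<in> V}" by blast
  qed
qed

context mixed_Saks_space
begin

lemma linear_scaleR:
  assumes "Vector_Spaces.linear smul smul T"
  shows "T (r *\<^sub>R x) = r *\<^sub>R T x"
  using assms normed_space unfolding Vector_Spaces.linear_iff normed_space_over_def by metis

lemma bounded_operatorsI:
  assumes T: "Vector_Spaces.linear smul smul T" and K0: "0 \<le> K" and K: "\<And>x. norm (T x) \<le> K * norm x"
  shows "T \<in> bounded_operators smul" "onorm T \<le> K"
proof -
  have "bounded_linear T"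
    using K T by (intro bounded_linear_intro[of T K])
      (auto simp: linear_scaleR[OF T] Vector_Spaces.linear_iff mult.commute)
  then show "T \<in> bounded_operators smul" using T by (simp add: bounded_operators_def)
  show "onorm T \<le> K" using K by (rule onorm_bound[OF K0])
qed

lemma bounded_family_iff:
  assumes lin: "\<And>t. t \<in> J \<Longrightarrow> Vector_Spaces.linear smul smul (R t)"
  shows "bounded_family smul J R \<longleftrightarrow> (\<exists>K\<ge>0. \<forall>t\<in>J. \<forall>x. norm (R t x) \<le> K * norm x)"
proof
  assume b: "bounded_family smul J R"
  then obtain K where K: "\<And>t. t \<in> J \<Longrightarrow> onorm (R t) \<le> K"
    by (auto simp: bounded_family_def bdd_above_def)
  have "norm (R t x) \<le> max K 0 * norm x" if t: "t \<in> J" for t x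
  proof -
    have "bounded_linear (R t)"
      using b t by (auto simp: bounded_family_def bounded_operators_def)
    then have "norm (R t x) \<le> onorm (R t) * norm x" by (rule onorm)
    also have "\<dots> \<le> max K 0 * norm x"
      using K[OF t] by (intro mult_right_mono) auto
    finally show ?thesis .
  qed
  then show "\<exists>K\<ge>0. \<forall>t\<in>J. \<forall>x. norm (R t x) \<le> K * norm x"
    by (intro exI[of _ "max K 0"]) auto
next
  assume "\<exists>K\<ge>0. \<forall>t\<in>J. \<forall>x. norm (R t x) \<le> K * norm x"
  then obtain K where K: "0 \<le> K" "\<And>t x. t \<in> J \<Longrightarrow> norm (R t x) \<le> K * norm x" by blast
  show "bounded_family smul J R"
    unfolding bounded_family_def
    using bounded_operatorsI[OF lin K(1) K(2)] by (auto intro!: bdd_aboveI2[of _ _ K])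
qed

section \<open>Consequences of equicontinuity\<close>

lemma linear_weighted:
  assumes "Vector_Spaces.linear smul smul (S t)"
  shows "Vector_Spaces.linear smul smul (weighted k S t)"
proof -
  interpret vector_space smul by (fact smul_vector_space)
  have "k t *\<^sub>R y = smul (of_real (k t)) y" for y
    using normed_space by (simp add: normed_space_over_def)
  then show ?thesis
    using assms by (simp add: weighted_def Vector_Spaces.linear_iff scale_right_distrib mult.commute)
qed

text \<open>The seminorms in \<open>Q\<close> are bounded on the unit ball, and an equicontinuous
  family carries this over to the union of the images of the ball. By
  \<open>Q_bounded_imp_bounded\<close> that union is norm bounded.\<close>

lemma equicontinuous_imp_norm_bounded:
  assumes lin: "\<And>t. t \<in> J \<Longrightarrow> Vector_Spaces.linear smul smul (R t)"
    and eq: "equicontinuous_family Q J R"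
  obtains K where "0 \<le> K" "\<And>t x. t \<in> J \<Longrightarrow> norm (R t x) \<le> K * norm x"
proof -
  let ?B = "{R t x | t x. t \<in> J \<and> norm x \<le> 1}"
  have "bounded ?B"
  proof (rule Q_bounded_imp_bounded)
    fix s assume "s \<in> Q"
    then obtain q K where q: "q \<in> Q" "0 \<le> K" "\<And>t x. t \<in> J \<Longrightarrow> s (R t x) \<le> K * q x"
      using eq unfolding equicontinuous_family_def by meson
    obtain K' where K': "0 \<le> K'" "\<And>x. q x \<le> K' * norm x"
      using Q_le_norm[OF q(1)] by blast
    have "s y \<le> K * K'" if y: "y \<in> ?B" for y
    proof -
      obtain t x where t: "t \<in> J" "norm x \<le> 1" "y = R t x" using y by blast
      then have "q x \<le> K'"
        using K'(2)[of x] mult_left_mono[OF t(2) K'(1)] by simp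
      then show ?thesis
        using order_trans[OF q(3)[OF t(1), of x] mult_left_mono[OF _ q(2)]] t(3) by simp
    qed
    then show "bdd_above (s ` ?B)" by (rule bdd_aboveI2)
  qed
  then obtain b where b: "0 < b" "\<And>y. y \<in> ?B \<Longrightarrow> norm y \<le> b"
    unfolding bounded_pos by blast
  have "norm (R t x) \<le> b / 1 * norm x" if t: "t \<in> J" for t x
  proof (rule seminorm_le_of_ball[OF normed_space seminorm_norm seminorm_comp_linear[OF seminorm_norm lin[OF t]]])
    show "norm (R t x) \<le> b" if "norm x < 1" for x
      using t less_imp_le[OF that] by (intro b(2)) blast
  qed simp
  then show ?thesis using that[of b] b(1) by simp
qed

text \<open>\<open>F_bounded\<close> also asks that every single \<open>S t\<close> be a bounded
  operator; it is recovered from the weighted one by dividing by \<open>k t\<close>.\<close>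

lemma equicontinuous_imp_F_bounded:
  assumes lin: "\<And>t. t \<in> topspace I \<Longrightarrow> Vector_Spaces.linear smul smul (S t)"
    and k: "k \<in> F" "\<And>t. t \<in> topspace I \<Longrightarrow> 0 < k t"
    and eq: "equicontinuous_family Q (topspace I) (weighted k S)"
  shows "F_bounded smul I F S"
proof -
  note linw = linear_weighted[of S _ k, OF lin]
  obtain K where K: "0 \<le> K" "\<And>t x. t \<in> topspace I \<Longrightarrow> norm (weighted k S t x) \<le> K * norm x"
    using equicontinuous_imp_norm_bounded[OF linw eq] by blast
  have "norm (S t x) \<le> K / k t * norm x" if "t \<in> topspace I" for t x
    using K(2)[OF that, of x] k(2)[OF that] by (simp add: weighted_def field_simps)
  then have "S t \<in> bounded_operators smul" if "t \<in> topspace I" for t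
    using bounded_operatorsI(1)[OF lin[OF that], of "K / k t"] that K(1) k(2)[OF that] by auto
  moreover have "bounded_family smul (topspace I) (weighted k S)"
    using K bounded_family_iff[of "topspace I" "weighted k S", OF linw] by blast
  ultimately show ?thesis using k(1) by (auto simp: F_bounded_def)
qed

text \<open>On a compact set the weight is at least some \<open>c > 0\<close>, so estimates for
  \<open>weighted k S\<close> become estimates for \<open>S\<close> after division by
  \<open>c\<close>. Bi-equicontinuity follows because a norm bounded
  \<open>\<tau>\<close>-convergent sequence converges for \<open>\<gamma>\<close>, to which the
  seminorms in \<open>Q\<close> apply.\<close>

lemma equicontinuous_imp_locally_bi_continuous:
  assumes lin: "\<And>t. t \<in> topspace I \<Longrightarrow> Vector_Spaces.linear smul smul (S t)"
    and k: "\<And>t. t \<in> topspace I \<Longrightarrow> 0 \<le> k t" "locally_bounded_away_from_zero I k"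
    and eq: "equicontinuous_family Q (topspace I) (weighted k S)"
    and cont: "strongly_continuous \<gamma> I S"
  shows "locally_bi_continuous smul \<tau> I S"
proof -
  note linw = linear_weighted[of S _ k, OF lin]
  obtain K where K: "0 \<le> K" "\<And>t x. t \<in> topspace I \<Longrightarrow> norm (weighted k S t x) \<le> K * norm x"
    using equicontinuous_imp_norm_bounded[OF linw eq] by blast
  have bdd: "bounded_family smul M S" if M: "compactin I M" for M
  proof -
    obtain c where c: "0 < c" "\<And>t. t \<in> M \<Longrightarrow> c \<le> k t"
      using locally_bounded_away_from_zeroE[OF k(2) M k(1)] by blast
    note sub = subsetD[OF compactin_subset_topspace[OF M]]
    have "norm (S t x) \<le> K / c * norm x" if t: "t \<in> M" for t x
    proof -
      have "c * norm (S t x) \<le> k t * norm (S t x)"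
        using c(2)[OF t] by (intro mult_right_mono) auto
      also have "\<dots> \<le> K * norm x"
        using K(2)[OF sub[OF t], of x] k(1)[OF sub[OF t]] by (simp add: weighted_def)
      finally show ?thesis using c(1) by (simp add: field_simps)
    qed
    moreover have "0 \<le> K / c" using K(1) c(1) by simp
    ultimately show ?thesis using bounded_family_iff[of M S] lin[OF sub] by blast
  qed
  have bi: "bi_equicontinuous_family \<tau> M S" if M: "compactin I M" for M
    unfolding bi_equicontinuous_family_def
  proof (intro allI impI)
    fix xs x U
    assume xs: "bounded (range xs) \<and> limitin \<tau> xs x sequentially" and U: "openin \<tau> U \<and> 0 \<in> U"
    obtain c where c: "0 < c" "\<And>t. t \<in> M \<Longrightarrow> c \<le> k t"
      using locally_bounded_away_from_zeroE[OF k(2) M k(1)] by blast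
    note sub = subsetD[OF compactin_subset_topspace[OF M]]
    obtain p r where p: "p \<in> P" "0 < r" "{y. p (y - 0) < r} \<subseteq> U"
      using U unfolding \<tau>_eq openin_seminorm_topology[OF smul_vector_space P_directed] by blast
    obtain s C where s: "s \<in> Q" "0 \<le> C" "\<And>x. p x \<le> C * s x"
      using P_dominated[OF p(1)] unfolding dominated_def by blast
    obtain q C' where q: "q \<in> Q" "0 \<le> C'"
      "\<And>t x. t \<in> topspace I \<Longrightarrow> s (weighted k S t x) \<le> C' * q x"
      using eq s(1) unfolding equicontinuous_family_def by meson
    have le: "c * p (S t y) \<le> C * C' * q y" if t: "t \<in> M" for t y
    proof -
      have "c * p (S t y) \<le> k t * p (S t y)"
        using c(2)[OF t] seminorm_nonneg[OF P_seminorm[OF p(1)]] by (intro mult_right_mono) auto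
      also have "\<dots> = p (weighted k S t y)"
        using k(1)[OF sub[OF t]]
        by (simp add: weighted_def seminorm_scaleR[OF normed_space P_seminorm[OF p(1)]])
      also have "\<dots> \<le> C * s (weighted k S t y)" by (rule s(3))
      also have "\<dots> \<le> C * (C' * q y)"
        using q(3)[OF sub[OF t]] s(2) by (intro mult_left_mono)
      finally show ?thesis by simp
    qed
    have "limitin \<gamma> xs x sequentially" using xs by (simp add: limitin_\<gamma>_iff)
    then have "(\<lambda>n. C * C' * q (xs n - x)) \<longlonglongrightarrow> C * C' * 0"
      using q(1) unfolding \<gamma>_eq limitin_seminorm_topology[OF smul_vector_space Q_directed] by (intro tendsto_mult_left) blast
    then have "\<forall>\<^sub>F n in sequentially. C * C' * q (xs n - x) < c * r"
      using c(1) p(2) by (intro order_tendstoD(2)) auto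
    then show "\<forall>\<^sub>F n in sequentially. \<forall>t\<in>M. S t (xs n - x) \<in> U"
    proof eventually_elim
      case (elim n)
      have "p (S t (xs n - x)) < r" if "t \<in> M" for t
        using le[OF that, of "xs n - x"] elim c(1) by (smt (verit) mult_left_mono)
      then show ?case using p(3) by auto
    qed
  qed
  have "S t \<in> bounded_operators smul" if "t \<in> topspace I" for t
    using bdd[of "{t}"] that by (simp add: bounded_family_def)
  moreover have "strongly_continuous \<tau> I S"
    using cont continuous_map_\<gamma>_imp_\<tau> unfolding strongly_continuous_def by blast
  ultimately show ?thesis
    using bdd bi by (auto simp: locally_bi_continuous_def)
qed

section \<open>From bi-continuity to equicontinuity\<close>

lemma locally_bi_continuous_bound:
  assumes "locally_bi_continuous smul \<tau> I S" "compactin I M"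
    and lin: "\<And>t. t \<in> topspace I \<Longrightarrow> Vector_Spaces.linear smul smul (S t)"
  obtains K where "0 \<le> K" "\<And>t x. t \<in> M \<Longrightarrow> norm (S t x) \<le> K * norm x"
proof -
  have "bounded_family smul M S"
    using assms by (simp add: locally_bi_continuous_def)
  then show ?thesis
    using that bounded_family_iff[of M S] lin compactin_subset_topspace[OF assms(2)] by blast
qed

text \<open>Local boundedness makes the orbit of \<open>x\<close> over \<open>M\<close> norm
  bounded, and there continuity for \<open>\<tau>\<close> is continuity for
  \<open>\<gamma>\<close>.\<close>

lemma locally_bi_continuous_imp_continuous_on_compacts:
  assumes S: "locally_bi_continuous smul \<tau> I S" and M: "compactin I M"
    and lin: "\<And>t. t \<in> topspace I \<Longrightarrow> Vector_Spaces.linear smul smul (S t)"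
  shows "continuous_map (subtopology I M) \<gamma> (\<lambda>t. S t x)"
proof (rule continuous_map_\<gamma>I)
  show "continuous_map (subtopology I M) \<tau> (\<lambda>t. S t x)"
    using S by (intro continuous_map_from_subtopology)
      (auto simp: locally_bi_continuous_def strongly_continuous_def)
  obtain K where "0 \<le> K" "\<And>t x. t \<in> M \<Longrightarrow> norm (S t x) \<le> K * norm x"
    using locally_bi_continuous_bound[OF S M lin] by blast
  then show "bounded ((\<lambda>t. S t x) ` topspace (subtopology I M))"
    by (auto simp: bounded_iff)
qed

text \<open>The change of weight: \<open>k1\<close> makes the family bounded by some
  \<open>K\<close>, and \<open>k2\<close> from \<open>rV_infinity\<close> is at most
  \<open>e / (K + 1) * k1\<close> off a compact set. The denominator \<open>K + 1\<close> covers
  \<open>K = 0\<close>.\<close>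

lemma vanishing_at_infinity:
  assumes lin: "\<And>t. t \<in> topspace I \<Longrightarrow> Vector_Spaces.linear smul smul (S t)"
    and F: "F \<subseteq> topspace I \<rightarrow> {0..}" "rV_infinity I F" "F_bounded smul I F S"
  obtains k where "k \<in> F" "\<And>e. 0 < e \<Longrightarrow>
    \<exists>M. compactin I M \<and> (\<forall>t\<in>topspace I - M. \<forall>x. norm (weighted k S t x) \<le> e * norm x)"
proof -
  obtain k1 where k1: "k1 \<in> F" "bounded_family smul (topspace I) (weighted k1 S)"
    using F(3) by (auto simp: F_bounded_def)
  then obtain K where K: "0 \<le> K" "\<And>t x. t \<in> topspace I \<Longrightarrow> norm (weighted k1 S t x) \<le> K * norm x"
    using bounded_family_iff[of "topspace I" "weighted k1 S", OF linear_weighted[OF lin]] by blast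
  obtain k2 where k2: "k2 \<in> F" "\<And>e. 0 < e \<Longrightarrow> \<exists>M. compactin I M \<and> (\<forall>t\<in>topspace I - M. k2 t \<le> e * k1 t)"
    using F(2) k1(1) unfolding rV_infinity_def by blast
  have pos: "0 \<le> k1 t" "0 \<le> k2 t" if "t \<in> topspace I" for t
    using F(1) k1(1) k2(1) that by auto
  show ?thesis
  proof (rule that[OF k2(1)])
    fix e :: real assume e: "0 < e"
    then obtain M where M: "compactin I M" "\<And>t. t \<in> topspace I - M \<Longrightarrow> k2 t \<le> e / (K + 1) * k1 t"
      using k2(2)[of "e / (K + 1)"] K(1) by auto
    have "norm (weighted k2 S t x) \<le> e * norm x" if t: "t \<in> topspace I - M" for t x
    proof -
      have "norm (weighted k2 S t x) = k2 t * norm (S t x)"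
        using pos t by (simp add: weighted_def)
      also have "\<dots> \<le> e / (K + 1) * k1 t * norm (S t x)"
        using M(2)[OF t] by (intro mult_right_mono) auto
      also have "\<dots> = e / (K + 1) * norm (weighted k1 S t x)"
        using pos t by (simp add: weighted_def)
      also have "norm (weighted k1 S t x) \<le> (K + 1) * norm x"
        using K(2)[of t x] t by (auto simp: distrib_right add_increasing2)
      then have "e / (K + 1) * norm (weighted k1 S t x) \<le> e / (K + 1) * ((K + 1) * norm x)"
        using K(1) e by (intro mult_left_mono) auto
      also have "\<dots> = e * norm x" using K(1) by simp
      finally show ?thesis .
    qed
    then show "\<exists>M. compactin I M \<and> (\<forall>t\<in>topspace I - M. \<forall>x. norm (weighted k2 S t x) \<le> e * norm x)"
      using M(1) by blast
  qed
qed

lemma locally_bi_continuous_imp_F_equicontinuous: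
  assumes lin: "\<And>t. t \<in> topspace I \<Longrightarrow> Vector_Spaces.linear smul smul (S t)"
    and F: "F \<subseteq> topspace I \<rightarrow> {0..}" "rV_infinity I F" "F_bounded smul I F S"
    and lb: "\<And>k. k \<in> F \<Longrightarrow> locally_bounded_weight I k"
    and C: "C_sequential \<gamma>"
    and S: "locally_bi_continuous smul \<tau> I S"
  shows "F_equicontinuous Q I F S"
proof -
  obtain k where k: "k \<in> F" and van: "\<And>e. 0 < e \<Longrightarrow>
    \<exists>M. compactin I M \<and> (\<forall>t\<in>topspace I - M. \<forall>x. norm (weighted k S t x) \<le> e * norm x)"
    using vanishing_at_infinity[OF lin F] by blast
  have pos: "0 \<le> k t" if "t \<in> topspace I" for t
    using F(1) k that by auto
  have loc: "\<exists>A K. 0 \<le> A \<and> 0 \<le> K \<and> (\<forall>t\<in>M. k t \<le> A) \<and> (\<forall>t\<in>M. \<forall>x. norm (weighted k S t x) \<le> K * norm x)"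
    if M: "compactin I M" for M
  proof -
    note sub = subsetD[OF compactin_subset_topspace[OF M]]
    have "\<exists>A. \<forall>t\<in>M. k t \<le> A"
      using lb[OF k] M by (auto simp: locally_bounded_weight_def bdd_above_def)
    then obtain A where A: "\<And>t. t \<in> M \<Longrightarrow> k t \<le> A" by blast
    obtain K where K: "0 \<le> K" "\<And>t x. t \<in> M \<Longrightarrow> norm (S t x) \<le> K * norm x"
      using locally_bi_continuous_bound[OF S M lin] by blast
    have "norm (weighted k S t x) \<le> max A 0 * K * norm x" if "t \<in> M" for t x
    proof -
      have "k t * norm (S t x) \<le> max A 0 * (K * norm x)"
        using A[OF that] K that by (intro mult_mono) auto
      then show ?thesis using pos[OF sub[OF that]] by (simp add: weighted_def)
    qed
    then show ?thesis
      using A K(1) by (intro exI[of _ "max A 0"] exI[of _ "max A 0 * K"]) (auto simp: le_max_iff_disj)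
  qed
  \<comment> \<open>A bound over all of \<open>I\<close>, obtained from the vanishing estimate with
    \<open>e = 1\<close> off a compact set and the local estimate on it; it makes the suprema over
    \<open>topspace I\<close> finite.\<close>
  obtain K where K: "0 \<le> K" "\<And>t x. t \<in> topspace I \<Longrightarrow> norm (weighted k S t x) \<le> K * norm x"
  proof -
    obtain M where M: "compactin I M" "\<And>t x. t \<in> topspace I - M \<Longrightarrow> norm (weighted k S t x) \<le> 1 * norm x"
      using van[of 1] by auto
    obtain K where K: "0 \<le> K" "\<And>t x. t \<in> M \<Longrightarrow> norm (weighted k S t x) \<le> K * norm x"
      using loc[OF M(1)] by blast
    have "norm (weighted k S t x) \<le> (K + 1) * norm x" if "t \<in> topspace I" for t x
    proof -
      have "0 \<le> K * norm x" using K(1) by simp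
      then show ?thesis
        using K(2)[of t x] M(2)[of t x] that
        by (cases "t \<in> M") (auto simp: distrib_right add_increasing add_increasing2)
    qed
    then show ?thesis using that[of "K + 1"] K(1) by simp
  qed
  have "equicontinuous_family Q (topspace I) (weighted k S)"
  proof (rule equicontinuous_familyI_SUP)
    show "Vector_Spaces.linear smul smul (weighted k S t)" if "t \<in> topspace I" for t
      using linear_weighted[of S t k, OF lin[OF that]] .
    show bdd: "bdd_above ((\<lambda>t. s (weighted k S t x)) ` topspace I)" if s: "s \<in> Q" for s x
    proof -
      obtain K' where K': "0 \<le> K'" "\<And>x. s x \<le> K' * norm x"
        using Q_le_norm[OF s] by blast
      have "s (weighted k S t x) \<le> K' * (K * norm x)" if "t \<in> topspace I" for t
        using K'(2)[of "weighted k S t x"] mult_left_mono[OF K(2)[OF that, of x] K'(1)] by linarith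
      then show ?thesis by (rule bdd_aboveI2)
    qed
    fix s assume s: "s \<in> Q" and ne: "topspace I \<noteq> {}"
      and sn: "seminorm smul (\<lambda>x. SUP t\<in>topspace I. s (weighted k S t x))"
    show "dominated Q (\<lambda>x. SUP t\<in>topspace I. s (weighted k S t x))"
    proof (rule dominatedI_C_sequential[OF C sn])
      fix xs assume xs: "limitin \<gamma> xs 0 sequentially"
      then have xs': "bounded (range xs) \<and> limitin \<tau> xs 0 sequentially"
        by (simp add: limitin_\<gamma>_iff)
      then obtain b where b: "0 < b" "\<And>n. norm (xs n) \<le> b"
        unfolding bounded_pos by auto
      obtain K' where K': "0 \<le> K'" "\<And>x. s x \<le> K' * norm x"
        using Q_le_norm[OF s] by blast
      show "(\<lambda>n. SUP t\<in>topspace I. s (weighted k S t (xs n))) \<longlonglongrightarrow> 0"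
      proof (rule tendstoI)
        fix e :: real assume e: "0 < e"
        \<comment> \<open>With \<open>norm (xs n) \<le> b\<close> and \<open>s\<close> at most
          \<open>K'\<close> times the norm, this choice leaves at most \<open>e / 2\<close> for all
          \<open>t\<close> outside the compact set.\<close>
        define e' where "e' = e / (2 * (K' + 1) * b)"
        have e': "0 < e'" using e K'(1) b(1) by (simp add: e'_def)
        obtain M where M: "compactin I M"
          "\<And>t x. t \<in> topspace I - M \<Longrightarrow> norm (weighted k S t x) \<le> e' * norm x"
          using van[OF e'] by blast
        note sub = subsetD[OF compactin_subset_topspace[OF M(1)]]
        have off: "s (weighted k S t (xs n)) \<le> e / 2" if "t \<in> topspace I - M" for t n
        proof -
          have "s (weighted k S t (xs n)) \<le> K' * norm (weighted k S t (xs n))"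
            by (rule K'(2))
          also have "\<dots> \<le> (K' + 1) * (e' * b)"
            using order_trans[OF M(2)[OF that, of "xs n"] mult_left_mono[OF b(2)[of n] less_imp_le[OF e']]] K'(1)
            by (intro mult_mono) auto
          also have "m * (e / (2 * m * b) * b) = e / 2" if "0 < m" for m
            using that b(1) by simp
          then have "(K' + 1) * (e' * b) = e / 2"
            using K'(1) by (simp only: e'_def)
          finally show ?thesis .
        qed
        obtain A B where AB: "0 \<le> A" "0 \<le> B" "\<And>t. t \<in> M \<Longrightarrow> k t \<le> A"
          "\<And>t x. t \<in> M \<Longrightarrow> norm (weighted k S t x) \<le> B * norm x"
          using loc[OF M(1)] by blast
        \<comment> \<open>For \<open>t\<close> in \<open>M\<close> the vectors
          \<open>weighted k S t (xs n)\<close> stay in the ball of radius \<open>B * b\<close>, so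
          making \<open>p\<close> small on them makes \<open>s\<close> small.\<close>
        obtain p d where p: "p \<in> P" "0 < d" "\<And>y. norm y \<le> B * b \<Longrightarrow> p y < d \<Longrightarrow> s y < e / 2"
          using Q_small_on_bounded[OF s, of "e / 2" "B * b"] e by auto
        \<comment> \<open>Bi-equicontinuity speaks about \<open>S\<close>, not about the weighted
          family; as \<open>k t \<le> A\<close> on \<open>M\<close>, the radius
          \<open>d / (A + 1)\<close> brings \<open>p\<close> below \<open>d\<close> after
          weighting.\<close>
        let ?U = "{y. p (y - 0) < d / (A + 1)}"
        have "openin \<tau> ?U \<and> 0 \<in> ?U"
          using p AB(1) seminorm_zero[OF smul_vector_space P_seminorm[OF p(1)]]
          by (auto simp: \<tau>_eq intro!: openin_seminorm_ball[of _ _ _ 0, simplified])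
        moreover have "bi_equicontinuous_family \<tau> M S"
          using S M(1) by (simp add: locally_bi_continuous_def)
        ultimately have "\<forall>\<^sub>F n in sequentially. \<forall>t\<in>M. S t (xs n - 0) \<in> ?U"
          using xs' unfolding bi_equicontinuous_family_def by blast
        then show "\<forall>\<^sub>F n in sequentially. dist (SUP t\<in>topspace I. s (weighted k S t (xs n))) 0 < e"
        proof eventually_elim
          case (elim n)
          have "s (weighted k S t (xs n)) \<le> e / 2" if t: "t \<in> topspace I" for t
          proof (cases "t \<in> M")
            case True
            have "p (weighted k S t (xs n)) = k t * p (S t (xs n))"
              using pos[OF t]
              by (simp add: weighted_def seminorm_scaleR[OF normed_space P_seminorm[OF p(1)]])
            also have "\<dots> \<le> A * p (S t (xs n))"
              using AB(3)[OF True] seminorm_nonneg[OF P_seminorm[OF p(1)]] by (rule mult_right_mono)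
            also have "\<dots> \<le> A * (d / (A + 1))"
              using elim True AB(1) by (intro mult_left_mono) auto
            also have "\<dots> < d"
              using AB(1) p(2) by (simp add: field_simps)
            finally have "p (weighted k S t (xs n)) < d" .
            moreover have "norm (weighted k S t (xs n)) \<le> B * b"
              using AB(4)[OF True, of "xs n"] mult_left_mono[OF b(2)[of n] AB(2)] by linarith
            ultimately show ?thesis using p(3) by (auto intro: less_imp_le)
          next
            case False
            then show ?thesis using off t by blast
          qed
          then have "(SUP t\<in>topspace I. s (weighted k S t (xs n))) \<le> e / 2"
            by (intro cSUP_least ne)
          then show ?case
            using e seminorm_nonneg[OF sn, of "xs n"] by simp
        qed
      qed
    qed
  qed
  then show ?thesis using k by (auto simp: F_equicontinuous_def)
qed

section \<open>Equitightness and the submixed topology\<close>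

lemma directed_submixed_seminorms:
  "directed_seminorms smul {\<lambda>x. (SUP n. p n x * a n) | (p :: nat \<Rightarrow> 'a \<Rightarrow> real) (a :: nat \<Rightarrow> real).
                          (\<forall>n. p n \<in> P) \<and> (\<forall>n. 0 \<le> a n) \<and> a \<longlonglongrightarrow> 0}"
  (is "directed_seminorms smul ?Z")
  unfolding directed_seminorms_def
proof (intro conjI ballI)
  obtain p where p: "p \<in> P" using P_directed by (auto simp: directed_seminorms_def)
  have "(\<lambda>x. SUP n. (\<lambda>_. p) n x * (\<lambda>_::nat. 0) n) \<in> ?Z"
    by (rule CollectI, rule exI[of _ "\<lambda>_. p"], rule exI[of _ "\<lambda>_. 0"]) (use p in simp)
  then show "?Z \<noteq> {}" by blast
  show "seminorm smul q" if "q \<in> ?Z" for q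
    using that submixed_seminorm by auto
  fix q1 q2 assume "q1 \<in> ?Z" "q2 \<in> ?Z"
  then obtain p1 a1 p2 a2 where q: "q1 = (\<lambda>x. SUP n. p1 n x * a1 n)" "q2 = (\<lambda>x. SUP n. p2 n x * a2 n)"
    and p: "\<And>n. p1 n \<in> P" "\<And>n. p2 n \<in> P" and a: "\<And>n. 0 \<le> a1 n" "\<And>n. 0 \<le> a2 n"
    and lim: "a1 \<longlonglongrightarrow> 0" "a2 \<longlonglongrightarrow> 0"
    by (auto simp: fun_eq_iff)
  \<comment> \<open>The two sequences are interleaved, the first on even and the second on odd
    indices: the weights still tend to \<open>0\<close>, and one supremum dominates both.\<close>
  define p3 where "p3 n = (if even n then p1 (n div 2) else p2 (n div 2))" for n
  define a3 where "a3 n = (if even n then a1 (n div 2) else a2 (n div 2))" for n :: nat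
  have p3: "p3 n \<in> P" and a3: "0 \<le> a3 n" for n
    using p a by (auto simp: p3_def a3_def)
  have lim3: "a3 \<longlonglongrightarrow> 0"
  proof (rule tendstoI)
    fix e :: real assume "0 < e"
    then obtain N1 N2 where N: "\<And>n. N1 \<le> n \<Longrightarrow> \<bar>a1 n\<bar> < e" "\<And>n. N2 \<le> n \<Longrightarrow> \<bar>a2 n\<bar> < e"
      using lim unfolding tendsto_iff eventually_sequentially by fastforce
    have "dist (a3 n) 0 < e" if "2 * (N1 + N2) \<le> n" for n
    proof -
      have "N1 \<le> n div 2" using that by (simp add: less_eq_div_iff_mult_less_eq)
      moreover have "N2 \<le> n div 2" using that by (simp add: less_eq_div_iff_mult_less_eq)
      ultimately show ?thesis using N by (auto simp: a3_def)
    qed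
    then show "\<forall>\<^sub>F n in sequentially. dist (a3 n) 0 < e"
      unfolding eventually_sequentially by blast
  qed
  note upper = cSUP_upper[OF UNIV_I submixed_bdd_above[where p = p3 and a = a3, OF p3 a3 lim3]]
  have "q1 x \<le> (SUP n. p3 n x * a3 n)" for x
    unfolding q
  proof (rule cSUP_least)
    show "p1 n x * a1 n \<le> (SUP n. p3 n x * a3 n)" for n
      using upper[of "2 * n" x] by (simp add: p3_def a3_def)
  qed simp
  moreover have "q2 x \<le> (SUP n. p3 n x * a3 n)" for x
    unfolding q
  proof (rule cSUP_least)
    show "p2 n x * a2 n \<le> (SUP n. p3 n x * a3 n)" for n
      using upper[of "2 * n + 1" x] by (simp add: p3_def a3_def)
  qed simp
  moreover have "(\<lambda>x. SUP n. p3 n x * a3 n) \<in> ?Z"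
    using p3 a3 lim3 by blast
  ultimately show "\<exists>r\<in>?Z. \<exists>C\<ge>0. \<forall>x. max (q1 x) (q2 x) \<le> C * r x"
    by (intro bexI[of _ "\<lambda>x. SUP n. p3 n x * a3 n"] exI[of _ 1]) auto
qed

text \<open>The equality of the topologies replaces the seminorm \<open>q\<close> that
  equicontinuity produces by a multiple of a submixed one, and \<open>submixed_le\<close> splits the
  latter into a seminorm of \<open>P\<close> and a small multiple of the norm.\<close>

lemma F_equicontinuous_imp_F_equitight:
  assumes sub: "\<gamma> = submixed_topology P" and S: "F_equicontinuous Q I F S"
  shows "F_equitight P I F S"
proof -
  obtain k where k: "k \<in> F" "equicontinuous_family Q (topspace I) (weighted k S)"
    using S by (auto simp: F_equicontinuous_def)
  have "equitight_family P (topspace I) (weighted k S)"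
    unfolding equitight_family_def
  proof (intro allI impI ballI)
    fix e :: real and p assume e: "0 < e" and p: "p \<in> P"
    obtain s C where s: "s \<in> Q" "0 \<le> C" "\<And>x. p x \<le> C * s x"
      using P_dominated[OF p] unfolding dominated_def by blast
    obtain q C' where q: "q \<in> Q" "0 \<le> C'"
      "\<And>t x. t \<in> topspace I \<Longrightarrow> s (weighted k S t x) \<le> C' * q x"
      using k(2) s(1) unfolding equicontinuous_family_def by meson
    let ?U = "{x. q (x - 0) < 1}"
    have "\<exists>z\<in>{\<lambda>x. (SUP n. p n x * a n) | (p :: nat \<Rightarrow> 'a \<Rightarrow> real) (a :: nat \<Rightarrow> real).
                          (\<forall>n. p n \<in> P) \<and> (\<forall>n. 0 \<le> a n) \<and> a \<longlonglongrightarrow> 0}.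
        \<exists>K\<ge>0. \<forall>i\<in>{()}. \<forall>x. q x \<le> K * z x"
      using openin_seminorm_ball[OF q(1), of 1 0] seminorm_zero[OF smul_vector_space Q_seminorm[OF q(1)]]
      by (intro dominatedI_openin[OF normed_space directed_submixed_seminorms Q_seminorm[OF q(1)], where U = ?U])
        (auto simp flip: submixed_topology_def sub \<gamma>_eq)
    then obtain pn a D where pn: "\<And>n::nat. pn n \<in> P" "\<And>n. 0 \<le> a n" "a \<longlonglongrightarrow> 0" "0 \<le> D"
      "\<And>x. q x \<le> D * (SUP n. pn n x * a n)"
      by auto
    \<comment> \<open>The product of the constants met on the way from \<open>p\<close> to the
      submixed seminorm; the norm term is therefore taken with \<open>e / (?E + 1)\<close>, so that
      at most \<open>e\<close> remains after multiplication by \<open>?E\<close>.\<close>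
    let ?E = "C * (C' * D)"
    have E: "0 \<le> ?E" using s q pn by simp
    then have e': "0 < e / (?E + 1)" using e by (simp add: add_nonneg_pos)
    obtain r B where r: "r \<in> P" "0 \<le> B"
      "\<And>x. (SUP n. pn n x * a n) \<le> B * r x + e / (?E + 1) * norm x"
      using submixed_le[where p = pn and a = a, OF pn(1-3) e'] by blast
    have "p (weighted k S t x) \<le> (?E * B) * r x + e * norm x" if "t \<in> topspace I" for t x
    proof -
      have "p (weighted k S t x) \<le> C * s (weighted k S t x)" by (rule s(3))
      also have "\<dots> \<le> C * (C' * q x)" using q(3)[OF that] s(2) by (rule mult_left_mono)
      also have "\<dots> \<le> C * (C' * (D * (B * r x + e / (?E + 1) * norm x)))"
        using s(2) q(2) order_trans[OF pn(5)[of x] mult_left_mono[OF r(3)[of x] pn(4)]]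
        by (intro mult_left_mono)
      also have "\<dots> = (?E * B) * r x + ?E / (?E + 1) * (e * norm x)"
        by (simp add: algebra_simps)
      also have "\<dots> \<le> (?E * B) * r x + 1 * (e * norm x)"
        using E e by (intro add_left_mono mult_right_mono) auto
      finally show ?thesis by simp
    qed
    then show "\<exists>q\<in>P. \<exists>K\<ge>0. \<forall>t\<in>topspace I. \<forall>x. p (weighted k S t x) \<le> K * q x + e * norm x"
      using r E by (intro bexI[OF _ r(1)] exI[of _ "?E * B"]) auto
  qed
  then show ?thesis using k(1) by (auto simp: F_equitight_def)
qed

text \<open>Boundedness with the same weight maps the unit ball into one ball of radius
  \<open>K\<close>, on which some \<open>p < d\<close> forces \<open>s < e\<close>. Equitightness
  with \<open>d / 2\<close> makes \<open>p\<close> that small: on the unit ball its norm term uses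
  up at most \<open>d / 2\<close>.\<close>

lemma F_equitight_bounded_imp_F_equicontinuous:
  assumes lin: "\<And>t. t \<in> topspace I \<Longrightarrow> Vector_Spaces.linear smul smul (S t)"
    and S: "F_equitight_bounded smul P I F S"
  shows "F_equicontinuous Q I F S"
proof -
  obtain k where k: "k \<in> F" "equitight_family P (topspace I) (weighted k S)"
    "bounded_family smul (topspace I) (weighted k S)"
    using S by (auto simp: F_equitight_bounded_def)
  note linw = linear_weighted[of S _ k, OF lin]
  obtain K where K: "0 \<le> K" "\<And>t x. t \<in> topspace I \<Longrightarrow> norm (weighted k S t x) \<le> K * norm x"
    using k(3) bounded_family_iff[of "topspace I" "weighted k S", OF linw] by blast
  have "equicontinuous_family Q (topspace I) (weighted k S)"
  proof (rule equicontinuous_familyI_SUP)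
    show "Vector_Spaces.linear smul smul (weighted k S t)" if "t \<in> topspace I" for t
      using linear_weighted[of S t k, OF lin[OF that]] .
    show "bdd_above ((\<lambda>t. s (weighted k S t x)) ` topspace I)" if s: "s \<in> Q" for s x
    proof -
      obtain K' where K': "0 \<le> K'" "\<And>x. s x \<le> K' * norm x"
        using Q_le_norm[OF s] by blast
      have "s (weighted k S t x) \<le> K' * (K * norm x)" if "t \<in> topspace I" for t
        using K'(2)[of "weighted k S t x"] mult_left_mono[OF K(2)[OF that, of x] K'(1)] by linarith
      then show ?thesis by (rule bdd_aboveI2)
    qed
    fix s assume s: "s \<in> Q" and ne: "topspace I \<noteq> {}"
      and sn: "seminorm smul (\<lambda>x. SUP t\<in>topspace I. s (weighted k S t x))"
    show "dominated Q (\<lambda>x. SUP t\<in>topspace I. s (weighted k S t x))"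
    proof (rule dominatedI_unit_ball[OF sn])
      fix e :: real assume e: "0 < e"
      obtain p d where p: "p \<in> P" "0 < d" "\<And>y. norm y \<le> K \<Longrightarrow> p y < d \<Longrightarrow> s y < e"
        using Q_small_on_bounded[OF s e, of K] by blast
      obtain q C where q: "q \<in> P" "0 \<le> C"
        "\<And>t x. t \<in> topspace I \<Longrightarrow> p (weighted k S t x) \<le> C * q x + d / 2 * norm x"
        using k(2)[unfolded equitight_family_def, rule_format, of "d / 2" p] p(1,2) by auto
      have "(SUP t\<in>topspace I. s (weighted k S t x)) \<le> e"
        if x: "norm x \<le> 1" "q x < d / (2 * (C + 1))" for x
      proof (rule cSUP_least[OF ne])
        fix t assume t: "t \<in> topspace I"
        have "C * q x \<le> C * (d / (2 * (C + 1)))"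
          using x(2) q(2) by (intro mult_left_mono) auto
        also have "\<dots> < d / 2"
          using p(2) q(2) by (simp add: field_simps)
        finally have "C * q x < d / 2" .
        moreover have "d / 2 * norm x \<le> d / 2"
          using x(1) p(2) by simp
        ultimately have "p (weighted k S t x) < d"
          using q(3)[OF t, of x] by linarith
        moreover have "norm (weighted k S t x) \<le> K"
          using K(2)[OF t, of x] mult_left_mono[OF x(1) K(1)] by simp
        ultimately show "s (weighted k S t x) \<le> e"
          using p(3) by (auto intro: less_imp_le)
      qed
      then show "\<exists>p\<in>P. \<exists>d>0. \<forall>x. norm x \<le> 1 \<longrightarrow> p x < d \<longrightarrow>
          (SUP t\<in>topspace I. s (weighted k S t x)) \<le> e"
        using p q by (intro bexI[OF _ q(1)] exI[of _ "d / (2 * (C + 1))"]) auto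
    qed
  qed
  then show ?thesis using k(1) by (auto simp: F_equicontinuous_def)
qed

end

section \<open>Strong Mackey spaces\<close>

text \<open>Alaoglu's argument: for pointwise convergence the set is the part of a product of
  compact balls cut out by the equations of linearity, which are closed conditions.\<close>

lemma compact_dominated_functionals:
  fixes smul :: "'k::real_or_complex \<Rightarrow> 'a::ab_group_add \<Rightarrow> 'a"
  assumes vs: "vector_space smul"
  shows "compact {f. Vector_Spaces.linear smul (*) f \<and> (\<forall>x. norm (f x) \<le> p x)}"
proof -
  let ?C = "{f :: 'a \<Rightarrow> 'k. (\<forall>x y. f (x + y) = f x + f y) \<and> (\<forall>c x. f (smul c x) = c * f x)}"
  let ?K = "\<Pi>\<^sub>E x\<in>UNIV. cball (0::'k) (p x)"
  have vs': "vector_space ((*) :: 'k \<Rightarrow> 'k \<Rightarrow> 'k)"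
    by unfold_locales (auto simp: algebra_simps)
  have "compactin (product_topology (\<lambda>_. euclidean) UNIV) ?K"
    by (simp add: compactin_PiE compact_cball_scalars)
  then have "compact ?K"
    by (simp add: euclidean_product_topology)
  moreover have "closed ?C"
    by (intro closed_Collect_conj closed_Collect_all closed_Collect_eq continuous_intros
        continuous_on_product_coordinates)
  ultimately have "compact (?C \<inter> ?K)"
    by (rule closed_Int_compact[rotated])
  also have "?C \<inter> ?K = {f. Vector_Spaces.linear smul (*) f \<and> (\<forall>x. norm (f x) \<le> p x)}"
    using vs vs' by (auto simp: Vector_Spaces.linear_iff PiE_iff)
  finally show ?thesis .
qed

lemma topological_dual_scale:
  fixes c :: "'k::real_or_complex"
  assumes "f \<in> topological_dual smul \<sigma>"
  shows "(\<lambda>x. c * f x) \<in> topological_dual smul \<sigma>"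
proof -
  have "continuous_map \<sigma> euclidean ((\<lambda>z. c * z) \<circ> f)"
    using assms by (intro continuous_map_compose[of _ euclidean])
      (auto simp: topological_dual_def continuous_map_iff_continuous2 intro!: continuous_intros)
  then show ?thesis
    using assms by (auto simp: topological_dual_def Vector_Spaces.linear_iff algebra_simps o_def)
qed

lemma zero_in_topological_dual:
  fixes smul :: "'k::real_or_complex \<Rightarrow> 'a::ab_group_add \<Rightarrow> 'a"
  assumes "vector_space smul"
  shows "(\<lambda>_. 0) \<in> topological_dual smul \<sigma>"
proof -
  have "vector_space ((*) :: 'k \<Rightarrow> 'k \<Rightarrow> 'k)"
    by unfold_locales (auto simp: algebra_simps)
  then show ?thesis
    using assms by (simp add: topological_dual_def Vector_Spaces.linear_iff)
qed

lemma open_product_contains_box: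
  fixes W :: "('a \<Rightarrow> 'b::metric_space) set"
  assumes "open W" "g \<in> W"
  obtains A e where "finite A" "0 < e" "\<And>h. (\<And>x. x \<in> A \<Longrightarrow> dist (g x) (h x) < e) \<Longrightarrow> h \<in> W"
proof -
  obtain X where X: "g \<in> (\<Pi>\<^sub>E x\<in>UNIV. X x)" "\<And>x. open (X x)" "finite {x. X x \<noteq> UNIV}"
    "(\<Pi>\<^sub>E x\<in>UNIV. X x) \<subseteq> W"
    using product_topology_open_contains_basis[of "\<lambda>_. euclidean" UNIV W g] assms
    by (auto simp: euclidean_product_topology)
  let ?A = "{x. X x \<noteq> UNIV}"
  have "\<forall>x. \<exists>e>0. ball (g x) e \<subseteq> X x"
    using X(1,2) open_contains_ball by (metis PiE_mem UNIV_I)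
  then obtain e where e: "\<And>x. 0 < e x" "\<And>x. ball (g x) (e x) \<subseteq> X x" by metis
  show ?thesis
  proof (rule that[OF X(3)])
    \<comment> \<open>The inserted \<open>1\<close> keeps the minimum meaningful when no coordinate
      is restricted.\<close>
    show "0 < Min (insert 1 (e ` ?A))" using X(3) e(1) by auto
    fix h assume h: "\<And>x. x \<in> ?A \<Longrightarrow> dist (g x) (h x) < Min (insert 1 (e ` ?A))"
    have "h x \<in> X x" for x
    proof (cases "x \<in> ?A")
      case True
      then have "dist (g x) (h x) < e x" using h X(3) by fastforce
      then show ?thesis using e(2)[of x] by auto
    qed auto
    then show "h \<in> W" using X(4) by (auto simp: PiE_iff)
  qed
qed

lemma positive_continuous_bounded_away_from_zero:
  assumes k: "continuous_map I euclideanreal k" "\<And>t. t \<in> topspace I \<Longrightarrow> 0 < k t"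
  shows "locally_bounded_away_from_zero I k"
  unfolding locally_bounded_away_from_zero_def
proof (intro allI impI)
  fix M assume M: "compactin I M \<and> M \<noteq> {}"
  then have "compact (k ` M)" using image_compactin[OF _ k(1)] by auto
  then obtain t where t: "t \<in> M" "\<And>u. u \<in> M \<Longrightarrow> k t \<le> k u"
    using compact_attains_inf[of "k ` M"] M by auto
  have "0 < k t" using k(2) t(1) M compactin_subset_topspace by blast
  also have "k t \<le> (INF t\<in>M. k t)" using M t(2) by (intro cINF_greatest) auto
  finally show "0 < (INF t\<in>M. k t)" .
qed

context mixed_Saks_space
begin

lemma dominated_functional_in_dual:
  assumes f: "Vector_Spaces.linear smul (*) f" and s: "s \<in> Q" and le: "\<And>x. norm (f x) \<le> 2 * s x"
  shows "f \<in> topological_dual smul \<gamma>"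
proof -
  interpret f: Vector_Spaces.linear smul "(*)" f by (fact f)
  have "continuous_map \<gamma> Met_TC.mtopology f"
    unfolding Met_TC.continuous_map_to_metric
  proof (intro ballI allI impI)
    fix x and e :: real assume e: "0 < e"
    let ?U = "{y. s (y - x) < e / 2}"
    have "f y \<in> ball (f x) e" if "y \<in> ?U" for y
      using that le[of "y - x"] by (simp add: f.diff dist_norm norm_minus_commute)
    moreover have "openin \<gamma> ?U"
      unfolding \<gamma>_eq using s e by (intro openin_seminorm_ball) auto
    moreover have "x \<in> ?U"
      using e seminorm_zero[OF smul_vector_space Q_seminorm[OF s]] by simp
    ultimately show "\<exists>U. openin \<gamma> U \<and> x \<in> U \<and> (\<forall>y\<in>U. f y \<in> Met_TC.mball (f x) e)"
      by (intro exI[of _ ?U]) auto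
  qed
  then show ?thesis using f by (simp add: topological_dual_def)
qed

text \<open>
  Compactness comes from the vanishing of \<open>R\<close> at infinity: away from a compact subset of \<open>I\<close> the
  functionals \<open>f \<circ> R t\<close> lie in any given weak* neighbourhood of \<open>0\<close>.
\<close>

lemma compact_composed_functionals:
  assumes s: "s \<in> Q"
    and cont: "strongly_continuous \<gamma> I R"
    and van: "\<And>x e. 0 < e \<Longrightarrow> \<exists>M. compactin I M \<and> (\<forall>t\<in>topspace I - M. s (R t x) < e)"
    and D_def: "D = {f. Vector_Spaces.linear smul (*) f \<and> (\<forall>x. norm (f x) \<le> 2 * s x)}"
  shows "compact (insert (\<lambda>_. 0) ((\<lambda>(t, f) x. f (R t x)) ` (topspace I \<times> D)))"
    (is "compact (insert _ (?\<Phi> ` _))")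
proof (rule compactI)
  have D: "compact D"
    unfolding D_def by (rule compact_dominated_functionals[OF smul_vector_space])
  have image: "compact (?\<Phi> ` (M \<times> D))" if M: "compactin I M" for M
  proof -
    let ?X = "prod_topology (subtopology I M) (subtopology euclidean D)"
    have "continuous_map ?X (product_topology (\<lambda>_. euclidean) UNIV) ?\<Phi>"
      unfolding continuous_map_componentwise_UNIV
    proof
      fix x
      have "continuous_map ?X Met_TC.mtopology (\<lambda>z. ?\<Phi> z x)"
        unfolding Met_TC.continuous_map_to_metric
      proof (intro ballI allI impI)
        fix z and e :: real assume z: "z \<in> topspace ?X" and e: "0 < e"
        obtain t f where tf: "z = (t, f)" "t \<in> topspace I" "t \<in> M" "f \<in> D"
          using z by auto
        \<comment> \<open>Joint continuity works because \<open>D\<close> is equicontinuous: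
          \<open>norm (g y) \<le> 2 * s y\<close> turns \<open>e / 4\<close> into
          \<open>e / 2\<close> for the change from \<open>R t x\<close> to \<open>R u x\<close>,
          uniformly in \<open>g\<close>. The change of functional is then measured at the single
          point \<open>R t x\<close>.\<close>
        let ?V = "{u \<in> topspace I. R u x \<in> {y. s (y - R t x) < e / 4}}"
        let ?N = "{g. dist (g (R t x)) (f (R t x)) < e / 2}"
        let ?U = "(?V \<inter> M) \<times> (?N \<inter> D)"
        have V: "openin I ?V"
          using cont e openin_seminorm_ball[OF s, of "e / 4" "R t x"] unfolding strongly_continuous_def
          by (intro openin_continuous_map_preimage[where Y = \<gamma>]) (auto simp: \<gamma>_eq)
        have N: "openin euclidean ?N" unfolding open_openin[symmetric]
          by (intro open_Collect_less continuous_intros continuous_on_product_coordinates)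
        have "openin ?X ?U"
          using openin_subtopology_Int[OF V] openin_subtopology_Int[OF N]
          by (intro iffD2[OF openin_prod_Times_iff] disjI2 conjI)
        moreover have "z \<in> ?U"
          using tf e seminorm_zero[OF smul_vector_space Q_seminorm[OF s]] by simp
        moreover have "?\<Phi> w x \<in> ball (?\<Phi> z x) e" if w: "w \<in> ?U" for w
        proof -
          obtain u g where ug: "w = (u, g)" "s (R u x - R t x) < e / 4"
            "dist (g (R t x)) (f (R t x)) < e / 2" "g \<in> D"
            using w by auto
          interpret g: Vector_Spaces.linear smul "(*)" g
            using ug(4) by (simp add: D_def)
          have "norm (g (R u x - R t x)) \<le> 2 * s (R u x - R t x)"
            using ug(4) by (simp add: D_def)
          then have "dist (g (R u x)) (g (R t x)) < e / 2"
            using ug(2) by (simp add: g.diff dist_norm)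
          then have "dist (g (R u x)) (f (R t x)) < e"
            using ug(3) dist_triangle_half_r[of "g (R t x)"] by (simp add: dist_commute)
          then show ?thesis by (simp add: tf(1) ug(1) dist_commute)
        qed
        ultimately show "\<exists>U. openin ?X U \<and> z \<in> U \<and> (\<forall>w\<in>U. ?\<Phi> w x \<in> Met_TC.mball (?\<Phi> z x) e)"
          by (intro exI[of _ ?U]) auto
      qed
      then show "continuous_map ?X euclidean (\<lambda>z. ?\<Phi> z x)" by simp
    qed
    moreover have "compactin ?X (M \<times> D)"
      using M D by (simp add: compactin_Times compactin_subtopology)
    ultimately have "compactin (product_topology (\<lambda>_. euclidean) UNIV) (?\<Phi> ` (M \<times> D))"
      using image_compactin by blast
    then show ?thesis by (simp add: euclidean_product_topology)
  qed
  fix \<C> assume op: "\<forall>W\<in>\<C>. open W" and cover: "insert (\<lambda>_. 0) (?\<Phi> ` (topspace I \<times> D)) \<subseteq> \<Union>\<C>"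
  \<comment> \<open>The member of the cover around \<open>0\<close> absorbs all functionals with
    \<open>t\<close> outside a compact set. It restricts finitely many coordinates only, so finitely
    many compact sets \<open>M x\<close> are enough.\<close>
  then obtain W where W: "W \<in> \<C>" "(\<lambda>_. 0) \<in> W" by auto
  obtain A e where A: "finite A" "0 < e" "\<And>h. (\<And>x. x \<in> A \<Longrightarrow> dist (0::'k) (h x) < e) \<Longrightarrow> h \<in> W"
    using open_product_contains_box[of W "\<lambda>_. 0"] op W by blast
  have "\<exists>M. compactin I M \<and> (\<forall>t\<in>topspace I - M. s (R t x) < e / 2)" for x
    by (rule van[OF half_gt_zero[OF A(2)]])
  then obtain M where M: "\<And>x. compactin I (M x)" "\<And>x t. t \<in> topspace I - M x \<Longrightarrow> s (R t x) < e / 2"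
    by metis
  let ?M = "\<Union>x\<in>A. M x"
  have cM: "compactin I ?M"
    using A(1) M(1) by (intro compactin_Union) auto
  have off: "?\<Phi> (t, f) \<in> W" if "t \<in> topspace I - ?M" "f \<in> D" for t f
  proof (rule A(3))
    fix x assume "x \<in> A"
    then have "s (R t x) < e / 2" using that(1) M(2) by blast
    moreover have "norm (f (R t x)) \<le> 2 * s (R t x)"
      using that(2) by (simp add: D_def)
    ultimately show "dist 0 (?\<Phi> (t, f) x) < e" by simp
  qed
  have "?\<Phi> ` (?M \<times> D) \<subseteq> \<Union>\<C>"
    using cover compactin_subset_topspace[OF cM] by blast
  then obtain \<C>' where \<C>': "\<C>' \<subseteq> \<C>" "finite \<C>'" "?\<Phi> ` (?M \<times> D) \<subseteq> \<Union>\<C>'"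
    using image[OF cM] op by (meson compactE)
  have "insert (\<lambda>_. 0) (?\<Phi> ` (topspace I \<times> D)) \<subseteq> \<Union>(insert W \<C>')"
  proof
    fix h assume "h \<in> insert (\<lambda>_. 0) (?\<Phi> ` (topspace I \<times> D))"
    then consider "h = (\<lambda>_. 0)" | t f where "t \<in> topspace I" "f \<in> D" "h = ?\<Phi> (t, f)"
      by auto
    then show "h \<in> \<Union>(insert W \<C>')"
    proof cases
      case 1
      then show ?thesis using W(2) by simp
    next
      case 2
      show ?thesis
      proof (cases "t \<in> ?M")
        case True
        then have "h \<in> ?\<Phi> ` (?M \<times> D)" using 2 by (intro image_eqI[of _ _ "(t, f)"]) auto
        then show ?thesis using \<C>'(3) by blast
      next
        case False
        then have "h \<in> W" using off[of t f] 2 by simp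
        then show ?thesis by simp
      qed
    qed
  qed
  then show "\<exists>\<C>'\<subseteq>\<C>. finite \<C>' \<and> insert (\<lambda>_. 0) (?\<Phi> ` (topspace I \<times> D)) \<subseteq> \<Union>\<C>'"
    using \<C>' W(1) by (intro exI[of _ "insert W \<C>'"]) auto
qed

text \<open>Up to the factor \<open>2\<close>, \<open>D\<close> is the polar of the unit ball of
  \<open>s\<close>. The Mackey property gives one neighbourhood on which all
  \<open>f \<circ> R t\<close> with \<open>f\<close> in \<open>D\<close> are small, and Hahn--Banach
  recovers \<open>s (R t x)\<close> from these values.\<close>

lemma strong_Mackey_equicontinuous:
  assumes Mackey: "strong_Mackey_space smul \<gamma>"
    and lin: "\<And>t. t \<in> topspace I \<Longrightarrow> Vector_Spaces.linear smul smul (R t)"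
    and cont: "strongly_continuous \<gamma> I R"
    and dual: "\<And>t f. t \<in> topspace I \<Longrightarrow> f \<in> topological_dual smul \<gamma> \<Longrightarrow>
      (\<lambda>x. f (R t x)) \<in> topological_dual smul \<gamma>"
    and van: "\<And>s x e. s \<in> Q \<Longrightarrow> 0 < e \<Longrightarrow> \<exists>M. compactin I M \<and> (\<forall>t\<in>topspace I - M. s (R t x) < e)"
  shows "equicontinuous_family Q (topspace I) R"
  unfolding equicontinuous_family_def
proof
  fix s assume s: "s \<in> Q"
  define D where "D = {f. Vector_Spaces.linear smul (*) f \<and> (\<forall>x. norm (f x) \<le> 2 * s x)}"
  let ?H = "insert (\<lambda>_. 0) ((\<lambda>(t, f) x. f (R t x)) ` (topspace I \<times> D))"
  have "?H \<subseteq> topological_dual smul \<gamma>"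
    using zero_in_topological_dual[OF smul_vector_space] dual dominated_functional_in_dual[OF _ s]
    by (auto simp: D_def)
  then have "compactin (weak_star_topology smul \<gamma>) ?H"
    using compact_composed_functionals[OF s cont van[OF s] D_def]
    by (simp add: weak_star_topology_def compactin_subtopology euclidean_product_topology)
  then have "equicontinuous_functionals \<gamma> ?H"
    using Mackey unfolding strong_Mackey_space_def by blast
  \<comment> \<open>The threshold \<open>1 / 2\<close> compensates the factor \<open>2\<close> in
    \<open>Hahn_Banach_seminorm\<close>.\<close>
  then obtain U where U: "openin \<gamma> U" "0 \<in> U" "\<And>h x. h \<in> ?H \<Longrightarrow> x \<in> U \<Longrightarrow> norm (h x) < 1 / 2"
    unfolding equicontinuous_functionals_def by (meson half_gt_zero zero_less_one)
  have "s (R t x) \<le> 1" if t: "t \<in> topspace I" and x: "x \<in> U" for t x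
  proof -
    obtain f where f: "Vector_Spaces.linear smul (*) f" "\<And>y. norm (f y) \<le> 2 * s y"
      "s (R t x) \<le> 2 * norm (f (R t x))"
      using Hahn_Banach_seminorm[OF normed_space Q_seminorm[OF s]] by blast
    then have "(\<lambda>x. f (R t x)) \<in> ?H"
      using t by (intro insertI2 image_eqI[of _ _ "(t, f)"]) (auto simp: D_def)
    then have "norm (f (R t x)) < 1 / 2" by (rule U(3)[OF _ x])
    then show ?thesis using f(3) by linarith
  qed
  then show "\<exists>q\<in>Q. \<exists>K\<ge>0. \<forall>t\<in>topspace I. \<forall>x. s (R t x) \<le> K * q x"
    using U(1,2) seminorm_comp_linear[OF Q_seminorm[OF s] lin]
    by (intro dominatedI_openin[OF normed_space Q_directed]) (auto simp: \<gamma>_eq)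
qed

lemma strongly_continuous_weighted:
  assumes k: "continuous_map I euclideanreal k" and S: "strongly_continuous \<gamma> I S"
  shows "strongly_continuous \<gamma> I (weighted k S)"
  unfolding strongly_continuous_def
proof
  fix x
  have "continuous_map I euclidean ((of_real :: real \<Rightarrow> 'k) \<circ> k)"
    using k by (intro continuous_map_compose[of _ euclidean])
      (auto simp: continuous_map_iff_continuous2 intro!: continuous_intros)
  then have "continuous_map I (prod_topology euclidean \<gamma>) (\<lambda>t. (of_real (k t) :: 'k, S t x))"
    using S by (intro continuous_map_pairedI) (auto simp: strongly_continuous_def o_def)
  then have "continuous_map I \<gamma> ((\<lambda>(c, y). smul c y) \<circ> (\<lambda>t. (of_real (k t), S t x)))"
    using candidate by (elim continuous_map_compose)
      (simp add: mixed_topology_candidate_def linear_topology_def)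
  moreover have "smul (of_real r) y = r *\<^sub>R y" for r y
    using normed_space by (simp add: normed_space_over_def)
  ultimately show "continuous_map I \<gamma> (\<lambda>t. weighted k S t x)"
    by (simp add: o_def weighted_def)
qed

text \<open>Shared by the steps from (d) and from (a) to (b). These differ in how they obtain
  \<open>dual\<close>: from continuity of the operators in (d), from the Mazur property in
  (a).\<close>

lemma F_bounded_imp_F_equicontinuous:
  assumes Mackey: "strong_Mackey_space smul \<gamma>"
    and lin: "\<And>t. t \<in> topspace I \<Longrightarrow> Vector_Spaces.linear smul smul (S t)"
    and F: "F \<subseteq> topspace I \<rightarrow> {0..}" "rV_infinity I F" "F_bounded smul I F S"
    and F_cont: "\<And>k. k \<in> F \<Longrightarrow> continuous_map I euclideanreal k"
    and cont: "strongly_continuous \<gamma> I S"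
    and dual: "\<And>t f. t \<in> topspace I \<Longrightarrow> f \<in> topological_dual smul \<gamma> \<Longrightarrow>
      (\<lambda>x. f (S t x)) \<in> topological_dual smul \<gamma>"
  shows "F_equicontinuous Q I F S"
proof -
  obtain k where k: "k \<in> F" and van: "\<And>e. 0 < e \<Longrightarrow>
    \<exists>M. compactin I M \<and> (\<forall>t\<in>topspace I - M. \<forall>x. norm (weighted k S t x) \<le> e * norm x)"
    using vanishing_at_infinity[OF lin F] by blast
  have "equicontinuous_family Q (topspace I) (weighted k S)"
  proof (rule strong_Mackey_equicontinuous[OF Mackey])
    show "Vector_Spaces.linear smul smul (weighted k S t)" if "t \<in> topspace I" for t
      using linear_weighted[of S t k, OF lin[OF that]] .
    show "strongly_continuous \<gamma> I (weighted k S)"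
      using strongly_continuous_weighted[OF F_cont[OF k] cont] .
    show "(\<lambda>x. f (weighted k S t x)) \<in> topological_dual smul \<gamma>"
      if "t \<in> topspace I" and f: "f \<in> topological_dual smul \<gamma>" for t f
    proof -
      have "f (r *\<^sub>R y) = of_real r * f y" for r y
        using f normed_space
        unfolding topological_dual_def Vector_Spaces.linear_iff normed_space_over_def by (metis (mono_tags, lifting) mem_Collect_eq)
      then show ?thesis
        using topological_dual_scale[OF dual[OF that]] by (simp add: weighted_def)
    qed
    fix s and x :: 'a and e :: real assume s: "s \<in> Q" and e: "0 < e"
    obtain K where K: "0 \<le> K" "\<And>x. s x \<le> K * norm x"
      using Q_le_norm[OF s] by blast
    \<comment> \<open>Smallness is needed for one \<open>x\<close> at a time, so the tolerance may
      depend on \<open>norm x\<close>; adding \<open>1\<close> to \<open>K\<close> and to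
      \<open>norm x\<close> avoids a zero denominator and makes the final inequality strict.\<close>
    let ?e = "e / ((K + 1) * (norm x + 1))"
    have pos: "0 < (K + 1) * (norm x + 1)" using K(1) by (simp add: add_nonneg_pos)
    then obtain M where M: "compactin I M"
      "\<And>t. t \<in> topspace I - M \<Longrightarrow> norm (weighted k S t x) \<le> ?e * norm x"
      using van[of ?e] e by auto
    have "s (weighted k S t x) < e" if "t \<in> topspace I - M" for t
    proof -
      have "s (weighted k S t x) \<le> K * (?e * norm x)"
        using K(2) mult_left_mono[OF M(2)[OF that] K(1)] order_trans by blast
      also have "\<dots> = ?e * (K * norm x)" by simp
      also have "\<dots> < ?e * ((K + 1) * (norm x + 1))"
        using pos e K(1) by (intro mult_strict_left_mono) (auto simp: distrib_left distrib_right add_nonneg_pos)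
      also have "\<dots> = e" using pos by (metis less_irrefl nonzero_divide_eq_eq)
      finally show ?thesis .
    qed
    then show "\<exists>M. compactin I M \<and> (\<forall>t\<in>topspace I - M. s (weighted k S t x) < e)"
      using M(1) by blast
  qed
  then show ?thesis using k by (auto simp: F_equicontinuous_def)
qed

lemma equicontinuous_imp_continuous_operators:
  assumes lin: "Vector_Spaces.linear smul smul (S t)" and t: "t \<in> topspace I" "0 < k t"
    and eq: "equicontinuous_family Q (topspace I) (weighted k S)"
  shows "S t \<in> continuous_operators smul \<gamma>"
proof -
  interpret S: Vector_Spaces.linear smul smul "S t" by (fact lin)
  have "continuous_map \<gamma> \<gamma> (S t)"
    unfolding \<gamma>_eq continuous_map_seminorm_topology[OF smul_vector_space Q_directed]
  proof (intro ballI allI impI)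
    fix x s and r :: real assume s: "s \<in> Q" and r: "0 < r"
    obtain q K where q: "q \<in> Q" "0 \<le> K" "\<And>x. s (weighted k S t x) \<le> K * q x"
      using eq s t(1) unfolding equicontinuous_family_def by meson
    \<comment> \<open>The factor \<open>k t\<close> pays for removing the weight, and
      \<open>K + 1\<close> stands in for a \<open>K\<close> that may be \<open>0\<close>.\<close>
    let ?U = "{y. q (y - x) < r * k t / (K + 1)}"
    have "s (S t y - S t x) < r" if y: "y \<in> ?U" for y
    proof -
      have "k t * s (S t y - S t x) \<le> K * q (y - x)"
        using q(3)[of "y - x"] t(2)
        by (simp add: weighted_def seminorm_scaleR[OF normed_space Q_seminorm[OF s]] S.diff)
      also have "\<dots> \<le> (K + 1) * q (y - x)"
        using seminorm_nonneg[OF Q_seminorm[OF q(1)]] by (simp add: distrib_right)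
      also have "\<dots> < r * k t"
        using y q(2) by (simp add: field_simps)
      finally show ?thesis using t(2) by (simp add: mult.commute)
    qed
    moreover have "x \<in> ?U"
      using r t(2) q(2) seminorm_zero[OF smul_vector_space Q_seminorm[OF q(1)]] by simp
    moreover have "openin (seminorm_topology Q) ?U"
      using q r t(2) by (intro openin_seminorm_ball) auto
    ultimately show "\<exists>U. openin (seminorm_topology Q) U \<and> x \<in> U \<and> (\<forall>y\<in>U. s (S t y - S t x) < r)"
      by (intro exI[of _ ?U]) auto
  qed
  then show ?thesis using lin by (simp add: continuous_operators_def)
qed

lemma continuous_operators_comp_dual:
  assumes "T \<in> continuous_operators smul \<gamma>" "f \<in> topological_dual smul \<gamma>"
  shows "(\<lambda>x. f (T x)) \<in> topological_dual smul \<gamma>"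
  using assms continuous_map_compose[of \<gamma> \<gamma> T euclidean f]
  by (auto simp: continuous_operators_def topological_dual_def Vector_Spaces.linear_iff o_def)

text \<open>Bi-equicontinuity on the compact set \<open>{t}\<close> preserves
  \<open>\<tau>\<close>-convergence of bounded sequences, and boundedness of \<open>S t\<close>
  keeps them bounded; by \<open>limitin_\<gamma>_iff\<close> the operator is sequentially continuous
  for \<open>\<gamma>\<close>. The Mazur property upgrades the composition with \<open>f\<close> to
  a continuous functional.\<close>

lemma Mazur_comp_dual:
  assumes Mazur: "Mazur_space smul \<gamma>"
    and S: "locally_bi_continuous smul \<tau> I S" "t \<in> topspace I"
    and f: "f \<in> topological_dual smul \<gamma>"
  shows "(\<lambda>x. f (S t x)) \<in> topological_dual smul \<gamma>"
proof -
  have lin: "Vector_Spaces.linear smul smul (S t)" and bl: "bounded_linear (S t)"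
    using S by (auto simp: locally_bi_continuous_def bounded_operators_def)
  interpret T: Vector_Spaces.linear smul smul "S t" by (fact lin)
  have f_lin: "Vector_Spaces.linear smul (*) (\<lambda>x. f (S t x))"
    using f lin by (auto simp: topological_dual_def Vector_Spaces.linear_iff)
  have "(\<lambda>n. f (S t (xs n))) \<longlonglongrightarrow> f (S t x)" if xs: "limitin \<gamma> xs x sequentially" for xs x
  proof -
    have xs': "bounded (range xs) \<and> limitin \<tau> xs x sequentially"
      using xs by (simp add: limitin_\<gamma>_iff)
    have "bi_equicontinuous_family \<tau> {t} S"
      using S by (simp add: locally_bi_continuous_def)
    then have ev: "\<forall>\<^sub>F n in sequentially. S t (xs n - x) \<in> U" if "openin \<tau> U" "0 \<in> U" for U
      using xs' that unfolding bi_equicontinuous_family_def by auto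
    have "limitin \<tau> (\<lambda>n. S t (xs n)) (S t x) sequentially"
      unfolding \<tau>_eq limitin_seminorm_topology[OF smul_vector_space P_directed]
    proof (intro ballI tendstoI)
      fix p and e :: real assume p: "p \<in> P" "0 < e"
      have "\<forall>\<^sub>F n in sequentially. S t (xs n - x) \<in> {y. p (y - 0) < e}"
        using p seminorm_zero[OF smul_vector_space P_seminorm[OF p(1)]]
        by (intro ev) (auto simp: \<tau>_eq intro!: openin_seminorm_ball[of _ _ _ 0, simplified])
      then show "\<forall>\<^sub>F n in sequentially. dist (p (S t (xs n) - S t x)) 0 < e"
        using seminorm_nonneg[OF P_seminorm[OF p(1)]] by (simp add: T.diff)
    qed
    moreover have "bounded (range (\<lambda>n. S t (xs n)))"
      using bounded_linear_image[OF _ bl, of "range xs"] xs' by (simp add: image_image)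
    ultimately have "limitin \<gamma> (\<lambda>n. S t (xs n)) (S t x) sequentially"
      by (simp add: limitin_\<gamma>_iff)
    moreover have "continuous_map \<gamma> euclidean f"
      using f by (simp add: topological_dual_def)
    ultimately have "limitin euclidean (f \<circ> (\<lambda>n. S t (xs n))) (f (S t x)) sequentially"
      by (intro continuous_map_limit)
    then show ?thesis by (simp add: o_def)
  qed
  then have "continuous_map \<gamma> euclidean (\<lambda>x. f (S t x))"
    using Mazur f_lin unfolding Mazur_space_def by blast
  then show ?thesis using f_lin by (simp add: topological_dual_def)
qed

end

section \<open>The implications between the four assertions\<close>

theorem theorem5p4:
  fixes smul :: "'k::real_or_complex \<Rightarrow> 'a::real_normed_vector \<Rightarrow> 'a"
    and \<tau> \<gamma> :: "'a topology"
    and P\<^sub>\<tau> P\<^sub>\<gamma> :: "('a \<Rightarrow> real) set"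
    and I :: "'i topology"
    and F :: "('i \<Rightarrow> real) set"
    and S :: "'i \<Rightarrow> 'a \<Rightarrow> 'a"
  assumes "Saks_space smul P\<^sub>\<tau> \<tau>"
    and "is_mixed_topology smul \<tau> \<gamma>"
    and "generating_seminorms smul P\<^sub>\<gamma> \<gamma>"
    and "Hausdorff_space I"
    and "F \<subseteq> topspace I \<rightarrow> {0..}"
    and "\<forall>t\<in>topspace I. Vector_Spaces.linear smul smul (S t)"
  shows
    "let a = (locally_bi_continuous smul \<tau> I S \<and> F_bounded smul I F S);
         b = (strongly_continuous \<gamma> I S \<and> F_equicontinuous P\<^sub>\<gamma> I F S);
         c = (strongly_continuous \<gamma> I S \<and> F_equitight P\<^sub>\<tau> I F S);
         d = (strongly_continuous \<gamma> I S \<and>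
              (\<forall>t\<in>topspace I. S t \<in> continuous_operators smul \<gamma>) \<and> F_bounded smul I F S)
     in
       ((C_sequential \<gamma> \<and> k_lcs_space I \<and> (\<forall>k\<in>F. locally_bounded_weight I k) \<and> rV_infinity I F
           \<longrightarrow> (a \<longrightarrow> b)) \<and>
        ((\<forall>k\<in>F. locally_bounded_away_from_zero I k) \<longrightarrow> (b \<longrightarrow> a))) \<and>
       ((\<gamma> = submixed_topology P\<^sub>\<tau> \<longrightarrow> (b \<longrightarrow> c)) \<and>
        (F_equitight_bounded smul P\<^sub>\<tau> I F S \<longrightarrow> (c \<longrightarrow> b))) \<and>
       (strong_Mackey_space smul \<gamma> \<and> locally_compact_space I \<and>
          (\<forall>k\<in>F. continuous_map I euclideanreal k \<and> (\<forall>t\<in>topspace I. 0 < k t)) \<and> rV_infinity I F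
          \<longrightarrow> (b \<longleftrightarrow> d)) \<and>
       (strong_Mackey_space smul \<gamma> \<and> Mazur_space smul \<gamma> \<and> locally_compact_space I \<and>
          (\<forall>k\<in>F. continuous_map I euclideanreal k \<and> (\<forall>t\<in>topspace I. 0 < k t)) \<and> rV_infinity I F
          \<longrightarrow> (a \<longleftrightarrow> b) \<and> (b \<longleftrightarrow> d))"
proof -
  interpret mixed_Saks_space smul \<tau> \<gamma> P\<^sub>\<tau> P\<^sub>\<gamma>
    using assms(1-3) by unfold_locales
  have lin: "Vector_Spaces.linear smul smul (S t)" if "t \<in> topspace I" for t
    using assms(6) that by blast
  note F = assms(5)
  define a where "a = (locally_bi_continuous smul \<tau> I S \<and> F_bounded smul I F S)"
  define b where "b = (strongly_continuous \<gamma> I S \<and> F_equicontinuous P\<^sub>\<gamma> I F S)"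
  define c where "c = (strongly_continuous \<gamma> I S \<and> F_equitight P\<^sub>\<tau> I F S)"
  define d where "d = (strongly_continuous \<gamma> I S \<and>
    (\<forall>t\<in>topspace I. S t \<in> continuous_operators smul \<gamma>) \<and> F_bounded smul I F S)"
  \<comment> \<open>Assertion (a) yields continuity for \<open>\<gamma>\<close> on compact sets
    only; \<open>k_lcs_space I\<close> in (i) and local compactness in (iv) extend it to
    \<open>I\<close>.\<close>
  have compacts: "continuous_map (subtopology I M) \<gamma> (\<lambda>t. S t x)" if a "compactin I M" for M x
    using that locally_bi_continuous_imp_continuous_on_compacts[of I S M x, OF _ _ lin]
    by (simp add: a_def)
  have i1: b
    if C: "C_sequential \<gamma>" and k: "k_lcs_space I" and lb: "\<forall>k\<in>F. locally_bounded_weight I k"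
      and rV: "rV_infinity I F" and a: a
  proof -
    have "continuous_map I \<gamma> (\<lambda>t. S t x)" for x
      using k_lcs_space_continuous[OF k, of smul] Hausdorff_lcs_\<gamma> compacts[OF a]
      unfolding continuous_if_on_compacts_def by blast
    moreover have "F_equicontinuous P\<^sub>\<gamma> I F S"
      using locally_bi_continuous_imp_F_equicontinuous[OF lin F rV _ _ C] lb a by (simp add: a_def)
    ultimately show ?thesis by (simp add: b_def strongly_continuous_def)
  qed
  have i2: a if away: "\<forall>k\<in>F. locally_bounded_away_from_zero I k" and b: b
  proof -
    obtain k where k: "k \<in> F" "equicontinuous_family P\<^sub>\<gamma> (topspace I) (weighted k S)"
      using b by (auto simp: b_def F_equicontinuous_def)
    have nonneg: "0 \<le> k t" if "t \<in> topspace I" for t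
      using F k(1) that by auto
    \<comment> \<open>A singleton is compact, so the local lower bound gives positivity at each
      point, which is needed to divide by \<open>k t\<close>.\<close>
    have pos: "0 < k t" if t: "t \<in> topspace I" for t
    proof -
      obtain r where "0 < r" "r \<le> k t"
        using locally_bounded_away_from_zeroE[of I k "{t}"] away k(1) nonneg t by auto
      then show ?thesis by linarith
    qed
    show ?thesis
      using equicontinuous_imp_F_bounded[OF lin k(1) pos k(2)] b away k(1)
        equicontinuous_imp_locally_bi_continuous[OF lin nonneg _ k(2)]
      by (simp add: a_def b_def)
  qed
  have ii1: c if "\<gamma> = submixed_topology P\<^sub>\<tau>" b
    using that F_equicontinuous_imp_F_equitight unfolding b_def c_def by blast
  have ii2: b if "F_equitight_bounded smul P\<^sub>\<tau> I F S" c
    using that F_equitight_bounded_imp_F_equicontinuous[OF lin] by (simp add: b_def c_def)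
  have iii1: d if F': "\<forall>k\<in>F. continuous_map I euclideanreal k \<and> (\<forall>t\<in>topspace I. 0 < k t)" and b: b
  proof -
    obtain k where k: "k \<in> F" "equicontinuous_family P\<^sub>\<gamma> (topspace I) (weighted k S)"
      using b by (auto simp: b_def F_equicontinuous_def)
    have pos: "0 < k t" if "t \<in> topspace I" for t
      using F' k(1) that by blast
    show ?thesis
      using equicontinuous_imp_F_bounded[OF lin k(1) pos k(2)] b
        equicontinuous_imp_continuous_operators[OF lin _ pos k(2)]
      by (simp add: b_def d_def)
  qed
  have iii2: b if Mackey: "strong_Mackey_space smul \<gamma>" and rV: "rV_infinity I F"
    and F': "\<forall>k\<in>F. continuous_map I euclideanreal k \<and> (\<forall>t\<in>topspace I. 0 < k t)" and d: d
  proof -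
    have "F_equicontinuous P\<^sub>\<gamma> I F S"
      using F_bounded_imp_F_equicontinuous[OF Mackey lin F rV] F' d continuous_operators_comp_dual
      by (simp add: d_def)
    then show ?thesis using d by (simp add: b_def d_def)
  qed
  have iv: b if Mackey: "strong_Mackey_space smul \<gamma>" and Mazur: "Mazur_space smul \<gamma>"
    and I: "locally_compact_space I" and rV: "rV_infinity I F"
    and F': "\<forall>k\<in>F. continuous_map I euclideanreal k \<and> (\<forall>t\<in>topspace I. 0 < k t)" and a: a
  proof -
    have cont: "strongly_continuous \<gamma> I S"
      unfolding strongly_continuous_def
      using continuous_map_locally_compact[OF I compacts[OF a]] by blast
    moreover have "F_equicontinuous P\<^sub>\<gamma> I F S"
      using F_bounded_imp_F_equicontinuous[of I S F, OF Mackey lin F rV] F' a cont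
        Mazur_comp_dual[OF Mazur, of I S] by (simp add: a_def)
    ultimately show ?thesis by (simp add: b_def)
  qed
  \<comment> \<open>Such weights have a positive minimum on each nonempty compact set, so the step
    from (b) to (a) in (iv) is an instance of \<open>i2\<close>.\<close>
  have away: "\<forall>k\<in>F. locally_bounded_away_from_zero I k"
    if "\<forall>k\<in>F. continuous_map I euclideanreal k \<and> (\<forall>t\<in>topspace I. 0 < k t)"
    using that positive_continuous_bounded_away_from_zero by blast
  show ?thesis
    unfolding Let_def a_def[symmetric] b_def[symmetric] c_def[symmetric] d_def[symmetric]
    using i1 i2 ii1 ii2 iii1 iii2 iv away by blast
qed

end
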